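(* There exists a universal constant $c$ such that for every $n\ge 1$, every $R>0$ and every $n$-dimensional log-concave random vector $X$ taking values in the hypercube $[-R,R]^n$, with law $\mu$, it holds $$W_2^2(\overline{\mu},\overline{\nu}) \leq c R^2 D(\nu\,\|\, \mu)$$ for all probability measures $\nu$ on $\mathbb{R}^n$, where $\overline{\mu}$ and $\overline{\nu}$ denote respectively the laws of $\overline{X}$ and $\overline{Y}$, $Y$ being distributed according to $\nu$.
   Context: An $n$-dimensional log-concave random vector is a random vector with values in $\mathbb{R}^n$ having a density of the form $e^{-V}$ with respect to Lebesgue measure on $\mathbb{R}^n$, where $V:\mathbb{R}^n\to\mathbb{R}\cup\{+\infty\}$ is convex. For a random vector $Z=(Z_1,\ldots,Z_n)$, the recentered vector $\overline{Z}$ is defined by $\overline{Z}_i=Z_i-\mathbb{E}[Z_i\,|\,Z_1,\ldots,Z_{i-1}]$, $i\in\{1,\ldots,n\}$ (for $i=1$ the conditional expectation is the plain expectation). $W_2^2(\nu_0,\nu_1)=\inf_{\pi\in C(\nu_0,\nu_1)}\iint |y-x|^2\,\pi(dx\,dy)$, where $C(\nu_0,\nu_1)$ is the set of probability measures on $\mathbb{R}^n\times\mathbb{R}^n$ with marginals $\nu_0$ and $\nu_1$. The relative entropy is $D(\nu\,\|\,\mu)=\int\log\frac{d\nu}{d\mu}\,d\nu$ if $\nu$ is absolutely continuous with respect to $\mu$, and $D(\nu\,\|\,\mu)=+\infty$ otherwise. The inequality is understood to hold trivially when $D(\nu\,\|\,\mu)=+\infty$ (in particular when $\nu$ has no finite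 first moment, so that $\overline{Y}$ may be undefined). *)

theory Defs
  imports "HOL-Probability.Probability"
begin

text \<open>The constant of the theorem is chosen before the dimension, so \<open>\<real>\<^sup>n\<close> cannot be a
  type depending on \<open>n\<close>. Points of \<open>\<real>\<^sup>n\<close> are the functions with arguments \<open>1, \<dots>, n\<close>,
  extended by \<open>undefined\<close> elsewhere, as in the product measures of the library.\<close>

definition Rn :: "nat \<Rightarrow> (nat \<Rightarrow> real) measure" where
  "Rn n = (\<Pi>\<^sub>M i\<in>{1..n}. borel)"

definition lborel_n :: "nat \<Rightarrow> (nat \<Rightarrow> real) measure" where
  "lborel_n n = (\<Pi>\<^sub>M i\<in>{1..n}. lborel)"

definition prob_measures :: "nat \<Rightarrow> (nat \<Rightarrow> real) measure set" where
  "prob_measures n = {\<nu>. prob_space \<nu> \<and> sets \<nu> = sets (Rn n)}"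

text \<open>Convexity of \<open>V : \<real>\<^sup>n \<rightarrow> \<real> \<union> {+\<infinity>}\<close>. For \<open>t \<in> {0, 1}\<close> the inequality holds trivially,
  since \<open>0 * \<infinity> = 0\<close> in \<^typ>\<open>ereal\<close>.\<close>

definition convex_potential :: "nat \<Rightarrow> ((nat \<Rightarrow> real) \<Rightarrow> ereal) \<Rightarrow> bool" where
  "convex_potential n V \<longleftrightarrow>
     (\<forall>x\<in>space (Rn n). V x \<noteq> -\<infinity>) \<and>
     (\<forall>x\<in>space (Rn n). \<forall>y\<in>space (Rn n). \<forall>t\<in>{0..1::real}.
        V (\<lambda>i\<in>{1..n}. (1 - t) * x i + t * y i) \<le> ereal (1 - t) * V x + ereal t * V y)"

definition exp_neg :: "ereal \<Rightarrow> ennreal" where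
  "exp_neg v = (if v = \<infinity> then 0 else ennreal (exp (- real_of_ereal v)))"

text \<open>\<^const>\<open>distributed\<close> requires the density to be Borel measurable. A convex function may fail
  to be Borel measurable on the boundary of its domain, which is a null set; replacing it by its
  lower semicontinuous hull changes neither its convexity nor the law.\<close>

definition log_concave_vector :: "nat \<Rightarrow> 'a measure \<Rightarrow> ('a \<Rightarrow> nat \<Rightarrow> real) \<Rightarrow> bool" where
  "log_concave_vector n M X \<longleftrightarrow>
     prob_space M \<and> X \<in> measurable M (Rn n) \<and>
     (\<exists>V. convex_potential n V \<and> distributed M (lborel_n n) X (\<lambda>x. exp_neg (V x)))"

text \<open>The \<open>\<sigma>\<close>-algebra generated by \<open>Z\<^sub>1, \<dots>, Z\<^sub>i\<^sub>-\<^sub>1\<close>; it is trivial for \<open>i = 1\<close>.\<close>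

definition past :: "'a measure \<Rightarrow> ('a \<Rightarrow> nat \<Rightarrow> real) \<Rightarrow> nat \<Rightarrow> 'a measure" where
  "past M Z i = vimage_algebra (space M) (\<lambda>\<omega>. restrict (Z \<omega>) {1..<i}) (\<Pi>\<^sub>M j\<in>{1..<i}. borel)"

definition recentered :: "nat \<Rightarrow> 'a measure \<Rightarrow> ('a \<Rightarrow> nat \<Rightarrow> real) \<Rightarrow> 'a \<Rightarrow> nat \<Rightarrow> real" where
  "recentered n M Z = (\<lambda>\<omega>. \<lambda>i\<in>{1..n}. Z \<omega> i - real_cond_exp M (past M Z i) (\<lambda>\<omega>'. Z \<omega>' i) \<omega>)"

text \<open>The law of the recentered vector of \<open>Z\<close>, when \<open>Z\<close> has law \<open>\<mu>\<close>, with \<open>Z\<close> realized as the identity on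
  \<open>(\<real>\<^sup>n, \<mu>)\<close>. By \<open>distr_recentered\<close> below any other realization gives the same law.\<close>

definition recentered_law :: "nat \<Rightarrow> (nat \<Rightarrow> real) measure \<Rightarrow> (nat \<Rightarrow> real) measure" where
  "recentered_law n \<mu> = distr \<mu> (Rn n) (recentered n \<mu> (\<lambda>x. x))"

definition couplings ::
    "nat \<Rightarrow> (nat \<Rightarrow> real) measure \<Rightarrow> (nat \<Rightarrow> real) measure \<Rightarrow> ((nat \<Rightarrow> real) \<times> (nat \<Rightarrow> real)) measure set" where
  "couplings n \<nu>\<^sub>0 \<nu>\<^sub>1 = {\<pi>. prob_space \<pi> \<and> sets \<pi> = sets (Rn n \<Otimes>\<^sub>M Rn n) \<and>
     distr \<pi> (Rn n) fst = \<nu>\<^sub>0 \<and> distr \<pi> (Rn n) snd = \<nu>\<^sub>1}"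

definition W2_squared :: "nat \<Rightarrow> (nat \<Rightarrow> real) measure \<Rightarrow> (nat \<Rightarrow> real) measure \<Rightarrow> ennreal" where
  "W2_squared n \<nu>\<^sub>0 \<nu>\<^sub>1 =
     (INF \<pi>\<in>couplings n \<nu>\<^sub>0 \<nu>\<^sub>1. \<integral>\<^sup>+(x, y). ennreal ((L2_set (\<lambda>i. y i - x i) {1..n})\<^sup>2) \<partial>\<pi>)"

text \<open>\<open>D(\<nu> || \<mu>)\<close>. \<^const>\<open>KL_divergence\<close> is a Bochner integral, hence \<open>0\<close> when the
  integral diverges; here the integral is the difference of the integrals of the positive and
  negative parts, the latter always being finite. \<open>entropy_density (exp 1) \<mu> \<nu>\<close> is \<open>ln (d\<nu>/d\<mu>)\<close>.\<close>

definition relative_entropy :: "'a measure \<Rightarrow> 'a measure \<Rightarrow> ereal" where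
  "relative_entropy \<nu> \<mu> =
     (if absolutely_continuous \<mu> \<nu>
      then enn2ereal (\<integral>\<^sup>+x. ennreal (entropy_density (exp 1) \<mu> \<nu> x) \<partial>\<nu>)
         - enn2ereal (\<integral>\<^sup>+x. ennreal (- entropy_density (exp 1) \<mu> \<nu> x) \<partial>\<nu>)
      else \<infinity>)"

lemma relative_entropy_eq_KL_divergence:
  assumes "absolutely_continuous \<mu> \<nu>" "integrable \<nu> (entropy_density (exp 1) \<mu> \<nu>)"
  shows "relative_entropy \<nu> \<mu> = ereal (KL_divergence (exp 1) \<mu> \<nu>)"
proof -
  let ?f = "entropy_density (exp 1) \<mu> \<nu>"
  have "(\<integral>\<^sup>+x. ennreal (?f x) \<partial>\<nu>) \<noteq> \<infinity>" "(\<integral>\<^sup>+x. ennreal (- ?f x) \<partial>\<nu>) \<noteq> \<infinity>"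
    using assms(2) by (auto simp: real_integrable_def)
  then obtain a b where ab: "a \<ge> 0" "b \<ge> 0" "(\<integral>\<^sup>+x. ennreal (?f x) \<partial>\<nu>) = ennreal a"
      "(\<integral>\<^sup>+x. ennreal (- ?f x) \<partial>\<nu>) = ennreal b"
    by (metis ennreal_cases infinity_ennreal_def)
  show ?thesis
    unfolding relative_entropy_def KL_divergence_def real_lebesgue_integral_def[OF assms(2)]
    using ab assms(1) by (simp add: enn2ereal_ennreal)
qed

lemma measurable_restrict_Rn:
  assumes "i \<in> {1..n}"
  shows "(\<lambda>x. restrict x {1..<i}) \<in> measurable (Rn n) (\<Pi>\<^sub>M j\<in>{1..<i}. borel)"
  unfolding Rn_def by (rule measurable_restrict_subset) (use assms in auto)

lemma subalgebra_past:
  assumes "Z \<in> measurable M (Rn n)" "i \<in> {1..n}"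
  shows "subalgebra M (past M Z i)"
proof -
  have "(\<lambda>\<omega>. restrict (Z \<omega>) {1..<i}) \<in> measurable M (\<Pi>\<^sub>M j\<in>{1..<i}. borel)"
    using measurable_compose[OF assms(1) measurable_restrict_Rn[OF assms(2)]] .
  then show ?thesis
    unfolding subalgebra_def past_def
    by (intro conjI space_vimage_algebra sets_image_in_sets) simp_all
qed

lemma real_cond_exp_past_distr:
  assumes "prob_space M" and Z[measurable]: "Z \<in> measurable M (Rn n)" and i: "i \<in> {1..n}"
    and int: "integrable M (\<lambda>\<omega>. Z \<omega> i)"
  defines "\<mu> \<equiv> distr M (Rn n) Z"
  shows "AE \<omega> in M. real_cond_exp M (past M Z i) (\<lambda>\<omega>'. Z \<omega>' i) \<omega> =
    real_cond_exp \<mu> (past \<mu> (\<lambda>x. x) i) (\<lambda>x. x i) (Z \<omega>)"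
proof -
  interpret M: prob_space M by fact
  interpret \<mu>: prob_space \<mu> unfolding \<mu>_def by (rule M.prob_space_distr) fact
  have id: "(\<lambda>x. x) \<in> measurable \<mu> (Rn n)" by (simp add: \<mu>_def)
  have sp: "space \<mu> = space (Rn n)" by (simp add: \<mu>_def)
  interpret A: finite_measure_subalgebra M "past M Z i"
    by unfold_locales (rule subalgebra_past[OF Z i])
  interpret B: finite_measure_subalgebra \<mu> "past \<mu> (\<lambda>x. x) i"
    by unfold_locales (rule subalgebra_past[OF id i])
  let ?g = "real_cond_exp \<mu> (past \<mu> (\<lambda>x. x) i) (\<lambda>x. x i)"
  have xi[measurable]: "(\<lambda>x. x i) \<in> borel_measurable (Rn n)"
    unfolding Rn_def using i by measurable
  have int\<mu>: "integrable \<mu> (\<lambda>x. x i)"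
    unfolding \<mu>_def by (subst integrable_distr_eq) (use int in auto)
  have intg: "integrable \<mu> ?g" using B.real_cond_exp_int(1)[OF int\<mu>] .
  have g[measurable]: "?g \<in> borel_measurable (Rn n)"
    using borel_measurable_integrable[OF intg] by (simp add: \<mu>_def)
  have gZ: "integrable M (\<lambda>\<omega>. ?g (Z \<omega>))"
    using intg unfolding \<mu>_def by (subst (asm) integrable_distr_eq) (auto simp: \<mu>_def[symmetric])
  have Zp: "Z \<in> measurable (past M Z i) (past \<mu> (\<lambda>x. x) i)"
    unfolding past_def[of \<mu>]
  proof (rule measurable_vimage_algebra2)
    show "Z \<in> space (past M Z i) \<rightarrow> space \<mu>"
      using measurable_space[OF Z] by (auto simp: past_def sp)
    show "(\<lambda>x. restrict (Z x) {1..<i}) \<in> measurable (past M Z i) (\<Pi>\<^sub>M j\<in>{1..<i}. borel)"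
      unfolding past_def by (rule measurable_vimage_algebra1) (auto simp: space_PiM)
  qed
  show ?thesis
  proof (rule A.real_cond_exp_charact[OF _ int gZ])
    show "(\<lambda>\<omega>. ?g (Z \<omega>)) \<in> borel_measurable (past M Z i)"
      using measurable_compose[OF Zp borel_measurable_cond_exp] .
    fix S assume "S \<in> sets (past M Z i)"
    then obtain C where C: "C \<in> sets (\<Pi>\<^sub>M j\<in>{1..<i}. borel)"
        and S: "S = (\<lambda>\<omega>. restrict (Z \<omega>) {1..<i}) -` C \<inter> space M"
      unfolding past_def by (subst (asm) sets_vimage_algebra2) (auto simp: space_PiM)
    define T where "T = (\<lambda>x. restrict x {1..<i}) -` C \<inter> space \<mu>"
    have T: "T \<in> sets (past \<mu> (\<lambda>x. x) i)"
      unfolding T_def past_def by (rule in_vimage_algebra[OF C])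
    have [measurable]: "T \<in> sets (Rn n)"
      using T B.subalg by (auto simp: subalgebra_def \<mu>_def)
    have ST: "indicator S \<omega> = (indicator T (Z \<omega>) :: real)" if "\<omega> \<in> space M" for \<omega>
      using that measurable_space[OF Z that] by (auto simp: S T_def sp indicator_def)
    have tr: "(\<integral>\<omega>\<in>S. h (Z \<omega>) \<partial>M) = (\<integral>x\<in>T. h x \<partial>\<mu>)"
      if [measurable]: "h \<in> borel_measurable (Rn n)" for h :: "(nat \<Rightarrow> real) \<Rightarrow> real"
    proof -
      have "(\<integral>x\<in>T. h x \<partial>\<mu>) = (\<integral>\<omega>. indicator T (Z \<omega>) *\<^sub>R h (Z \<omega>) \<partial>M)"
        unfolding set_lebesgue_integral_def \<mu>_def by (rule integral_distr) measurable
      also have "\<dots> = (\<integral>\<omega>\<in>S. h (Z \<omega>) \<partial>M)"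
        unfolding set_lebesgue_integral_def by (rule Bochner_Integration.integral_cong) (auto simp: ST)
      finally show ?thesis ..
    qed
    show "(\<integral>\<omega>\<in>S. Z \<omega> i \<partial>M) = (\<integral>\<omega>\<in>S. ?g (Z \<omega>) \<partial>M)"
      unfolding tr[OF xi] tr[OF g] by (rule B.real_cond_exp_intA[OF int\<mu> T])
  qed
qed

lemma measurable_recentered:
  assumes Z: "Z \<in> measurable M (Rn n)"
  shows "recentered n M Z \<in> measurable M (Rn n)"
proof -
  have 1: "(\<lambda>\<omega>. Z \<omega> i) \<in> borel_measurable M" if "i \<in> {1..n}" for i
    using measurable_compose[OF Z[unfolded Rn_def] measurable_component_singleton[OF that]] .
  show ?thesis
    unfolding recentered_def Rn_def
    by (intro measurable_restrict borel_measurable_diff 1 borel_measurable_cond_exp2)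
qed

lemma distr_recentered:
  assumes "prob_space M" and Z[measurable]: "Z \<in> measurable M (Rn n)"
    and int: "\<And>i. i \<in> {1..n} \<Longrightarrow> integrable M (\<lambda>\<omega>. Z \<omega> i)"
  shows "distr M (Rn n) (recentered n M Z) = recentered_law n (distr M (Rn n) Z)"
proof -
  define \<mu> where "\<mu> = distr M (Rn n) Z"
  have [measurable]: "recentered n \<mu> (\<lambda>x. x) \<in> measurable (Rn n) (Rn n)"
    using measurable_recentered[of "\<lambda>x. x" \<mu> n] by (simp add: \<mu>_def)
  have "AE \<omega> in M. \<forall>i\<in>{1..n}. real_cond_exp M (past M Z i) (\<lambda>\<omega>'. Z \<omega>' i) \<omega> =
      real_cond_exp \<mu> (past \<mu> (\<lambda>x. x) i) (\<lambda>x. x i) (Z \<omega>)"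
    using real_cond_exp_past_distr[OF assms(1) Z _ int, folded \<mu>_def]
    by (intro AE_finite_allI) auto
  then have "AE \<omega> in M. recentered n M Z \<omega> = recentered n \<mu> (\<lambda>x. x) (Z \<omega>)"
    by eventually_elim (auto simp: recentered_def)
  then have "distr M (Rn n) (recentered n M Z) = distr M (Rn n) (\<lambda>\<omega>. recentered n \<mu> (\<lambda>x. x) (Z \<omega>))"
    by (intro distr_cong_AE) (auto intro: measurable_recentered Z)
  also have "\<dots> = recentered_law n \<mu>"
    unfolding recentered_law_def \<mu>_def[symmetric]
    by (subst (2) \<mu>_def, subst distr_distr) (auto simp: comp_def)
  finally show ?thesis unfolding \<mu>_def .
qed

end

theory Submission
  imports Defs
begin

text \<open>Let \<open>T\<close> be the triangular (Knothe) rearrangement carrying \<open>\<nu>\<close> to \<open>\<mu>\<close>: its \<open>i\<close>-th coordinate is the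
increasing map from the conditional law of \<open>y\<^sub>i\<close> given the preceding coordinates of \<open>y\<close> to the conditional law
of \<open>x\<^sub>i\<close> under \<open>\<mu>\<close> given that the preceding coordinates of \<open>x\<close> are those of \<open>T y\<close>. Coupling the recentered
\<open>T y\<close> with the recentered \<open>y\<close> costs exactly the sum over \<open>i\<close> of the expected conditional variances of
\<open>y\<^sub>i - T\<^sub>i y\<close>, because recentering subtracts the conditional means. Write \<open>q\<close> for the conditional
density of \<open>\<nu>\<close>, \<open>p\<close> for the conditional density of \<open>\<mu>\<close> at the image point, and
\<open>\<theta> = q / p\<close>, the derivative of \<open>T\<^sub>i\<close> in its last argument. The inequality
follows by comparing both sides with the integrals of \<open>p - q + q ln (q / p)\<close> along the fibres.

The entropy dominates these integrals (\<open>entropy_lower_bound\<close>). The map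
\<open>y \<mapsto> (1 - t) T y + t y\<close> is again triangular and increasing, so that the integral of \<open>exp (- V)\<close> along it, taken
with its Jacobian \<open>\<Prod> ((1 - t) \<theta>\<^sub>i + t)\<close>, is at most \<open>1\<close>. Convexity of \<open>V\<close> bounds \<open>V\<close> at the interpolated point,
and \<open>ln x \<le> x - 1\<close> turns the bound on the integral into one on the expected logarithm under \<open>\<nu>\<close>; the
first order in \<open>t\<close> as \<open>t\<close> tends to \<open>0\<close> is the claim. Taking the limit after the integration avoids
differentiating \<open>V\<close>. The regions where \<open>q\<close> vanishes have no mass under \<open>\<nu>\<close>, but the displacement may change across
them; they have to be carried along as a separate nonnegative term, which appears below as \<open>gap\<close>.

On a single fibre these integrals dominate the variance (\<open>variance_displacement\<close>). The
displacement \<open>v - S v\<close> of the increasing map \<open>S\<close> has derivative \<open>1 - \<theta>\<close>. By Cauchy-Schwarz with weight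
\<open>1 + \<theta>\<close>, whose integral is at most \<open>4 R\<close> since \<open>v\<close> and \<open>S v\<close> both range in \<open>[-R, R]\<close>, the squared
increments are controlled by \<open>(1 - \<theta>)\<^sup>2 / (1 + \<theta>)\<close>, hence by \<open>1 - \<theta> + \<theta> ln \<theta>\<close>. Averaging over pairs of points gives
the weight \<open>G (1 - G)\<close>, with \<open>G\<close> the distribution function, and this is at most \<open>2 R p\<close> because \<open>p\<close> is
unimodal (\<open>p_lower_bound\<close>). Unimodality of the conditional densities is where the marginals of
\<open>\<mu>\<close> have to be log-concave (\<open>log_concave_integral\<close>), and the one-dimensional transport proves that as well.\<close>

section \<open>Laws on an interval and their quantiles\<close>

text \<open>An integral that is linear in \<open>p\<close>, so that the distribution function of a density
depending measurably on a parameter is measurable in the parameter.\<close>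

definition cdf_of :: "(real \<Rightarrow> real) \<Rightarrow> real \<Rightarrow> real" where
  "cdf_of p x = (\<integral>v. indicator {..x} v * p v \<partial>lborel)"

definition quantile :: "real \<Rightarrow> (real \<Rightarrow> real) \<Rightarrow> real \<Rightarrow> real" where
  "quantile R p u = Inf {x\<in>{-R..R}. u \<le> cdf_of p x}"

locale bounded_density =
  fixes p :: "real \<Rightarrow> real" and R :: real
  assumes p_measurable[measurable]: "p \<in> borel_measurable borel"
    and p_nonneg: "0 \<le> p x"
    and p_support: "x \<notin> {-R..R} \<Longrightarrow> p x = 0"
    and p_total: "(\<integral>\<^sup>+x. ennreal (p x) \<partial>lborel) = 1"
begin

definition law :: "real measure" where "law = density lborel (\<lambda>x. ennreal (p x))"

lemma sets_law[measurable_cong, simp]: "sets law = sets borel"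
  by (simp add: law_def)

lemma space_law[simp]: "space law = UNIV"
  by (simp add: law_def)

sublocale law: real_distribution law
  by (intro real_distribution.intro real_distribution_axioms.intro prob_spaceI)
    (simp_all add: law_def emeasure_density p_total)

lemma nn_integral_law: "f \<in> borel_measurable borel \<Longrightarrow>
    (\<integral>\<^sup>+x. f x \<partial>law) = (\<integral>\<^sup>+x. ennreal (p x) * f x \<partial>lborel)"
  unfolding law_def by (subst nn_integral_density) auto

lemma integral_law: "f \<in> borel_measurable borel \<Longrightarrow>
    (\<integral>x. f x \<partial>law) = (\<integral>x. p x * f x \<partial>lborel)"
  unfolding law_def by (subst integral_density) (auto simp: p_nonneg)

lemma AE_law: "Measurable.pred borel P \<Longrightarrow> (AE x in law. P x) \<longleftrightarrow> (AE x in lborel. 0 < p x \<longrightarrow> P x)"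
  unfolding law_def by (subst AE_density) auto

lemma AE_law_pos: "AE x in law. 0 < p x"
  by (subst AE_law) auto

lemma AE_law_range: "AE x in law. x \<in> {-R..R}"
  using p_support by (subst AE_law) (auto, force+)

lemma R_nonneg: "0 \<le> R"
proof (rule ccontr)
  assume "\<not> 0 \<le> R"
  then have "AE x in law. False" using AE_law_range by auto
  then show False by auto
qed

lemma cdf_of_eq: "cdf_of p x = cdf law x"
proof -
  have "cdf law x = (\<integral>v. indicator {..x} v \<partial>law)"
    by (simp add: cdf_def)
  also have "\<dots> = (\<integral>v. p v * indicator {..x} v \<partial>lborel)"
    by (rule integral_law) auto
  finally show ?thesis by (simp add: cdf_of_def mult.commute)
qed

abbreviation "F \<equiv> cdf law"

lemma measure_law_singleton: "measure law {x} = 0"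
proof -
  have "emeasure law {x} = (\<integral>\<^sup>+v. ennreal (p v) * indicator {x} v \<partial>lborel)"
    by (simp add: law_def emeasure_density)
  also have "\<dots> = (\<integral>\<^sup>+(v::real). 0 \<partial>lborel)"
    using AE_lborel_singleton[of x] by (intro nn_integral_cong_AE) (auto elim!: eventually_mono)
  finally show ?thesis by (simp add: measure_def)
qed

lemma isCont_F: "isCont F x"
  by (simp add: law.isCont_cdf measure_law_singleton)

lemma continuous_on_F: "continuous_on A F"
  by (simp add: continuous_at_imp_continuous_on isCont_F)

lemma F_measurable[measurable]: "F \<in> borel_measurable borel"
  using continuous_on_F by (rule borel_measurable_continuous_onI)

lemma F_mono: "x \<le> y \<Longrightarrow> F x \<le> F y"
  by (rule law.cdf_nondecreasing)

lemma F_ge_0: "0 \<le> F x" and F_le_1: "F x \<le> 1"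
  by (auto simp: law.cdf_nonneg law.cdf_bounded_prob)

lemma F_right: "R \<le> x \<Longrightarrow> F x = 1"
  unfolding cdf_def using AE_law_range by (subst law.prob_eq_1) auto

lemma F_left: assumes "x \<le> - R" shows "F x = 0"
proof -
  have "AE v in law. v \<notin> {..x}"
  proof -
    have "AE v in law. v \<noteq> x"
      by (subst AE_law) (auto intro: AE_mp[OF AE_lborel_singleton[of x]])
    with AE_law_range show ?thesis by eventually_elim (use assms in auto)
  qed
  then show ?thesis
    unfolding cdf_def by (subst law.prob_eq_0) auto
qed

lemma F_Ioc: "a \<le> b \<Longrightarrow> emeasure law {a<..b} = ennreal (F b - F a)"
  using law.emeasure_Ioc[of a b] by simp

lemma F_surj:
  assumes "u \<in> {0..1}" obtains x where "x \<in> {-R..R}" "F x = u"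
proof -
  have "\<exists>x. -R \<le> x \<and> x \<le> R \<and> F x = u"
    using assms R_nonneg F_left[of "-R"] F_right[of R]
    by (intro IVT') (auto simp: continuous_on_F)
  then show ?thesis using that by auto
qed

text \<open>Probability integral transform: as the law has no atoms, its distribution function pushes it to
  the uniform law.\<close>

lemma prob_F_le:
  assumes c: "c \<in> {0..1}"
  shows "measure law {v. F v \<le> c} = c"
proof (cases "c = 1")
  case True
  then have "{v. F v \<le> c} = space law" using F_le_1 by auto
  then show ?thesis using True law.prob_space by simp
next
  case False
  then have c1: "c < 1" using c by auto
  define A where "A = {v\<in>{-R..R}. F v \<le> c}"
  have "compact A"
  proof -
    have "A = {-R..R} \<inter> F -` {..c}" by (auto simp: A_def)
    moreover have "closed (F -` {..c} \<inter> UNIV)"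
      using continuous_on_F[of UNIV] continuous_on_closed_vimage[of UNIV F] by auto
    ultimately show ?thesis by (auto intro: compact_Int_closed)
  qed
  moreover have "-R \<in> A" using R_nonneg F_left[of "-R"] c by (auto simp: A_def)
  ultimately obtain w where w: "w \<in> A" "\<And>v. v \<in> A \<Longrightarrow> v \<le> w"
    using compact_attains_sup[of A] by auto
  have eq: "{v. F v \<le> c} = {..w}"
  proof (intro set_eqI iffI)
    fix v assume v: "v \<in> {v. F v \<le> c}"
    then have "v < R" using c1 F_right[of v] by (cases "R \<le> v") auto
    show "v \<in> {..w}"
    proof (cases "v < -R")
      case True then show ?thesis using w(1) by (auto simp: A_def)
    next
      case False then show ?thesis using \<open>v < R\<close> v by (auto intro!: w(2) simp: A_def)
    qed
  next
    fix v assume "v \<in> {..w}"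
    then show "v \<in> {v. F v \<le> c}" using F_mono[of v w] w(1) by (auto simp: A_def)
  qed
  obtain x where x: "x \<in> {-R..R}" "F x = c" using F_surj[OF c] .
  then have "x \<le> w" by (intro w(2)) (auto simp: A_def)
  then have "F w = c" using F_mono[of x w] x w(1) by (auto simp: A_def)
  then have "measure law {..w} = c" by (simp only: cdf_def)
  then show ?thesis by (simp only: eq)
qed

lemma AE_F_neq: "AE v in law. F v \<noteq> c"
proof (cases "c \<in> {0..1}")
  case False
  then show ?thesis using F_ge_0 F_le_1 by (intro AE_I2) auto
next
  case c: True
  have le: "measure law {v. F v = c} \<le> e" if "e > 0" for e
  proof (cases "c - e \<ge> 0")
    case True
    have "measure law {v. F v = c} \<le> measure law ({v. F v \<le> c} - {v. F v \<le> c - e})"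
      using that by (intro law.finite_measure_mono) auto
    also have "\<dots> = measure law {v. F v \<le> c} - measure law {v. F v \<le> c - e}"
      using that by (subst law.finite_measure_Diff) auto
    also have "\<dots> = e" using True c that by (simp add: prob_F_le)
    finally show ?thesis .
  next
    case False
    have "measure law {v. F v = c} \<le> measure law {v. F v \<le> c}"
      by (intro law.finite_measure_mono) auto
    also have "\<dots> = c" using c by (rule prob_F_le)
    finally show ?thesis using False by auto
  qed
  then have "measure law {v. F v = c} \<le> 0" by (rule field_le_epsilon) simp
  then have "measure law {v. F v = c} = 0" by (simp add: measure_le_0_iff)
  then show ?thesis by (subst (asm) law.prob_eq_0) auto
qed

lemma AE_F_interior: "AE v in law. 0 < F v \<and> F v < 1"
  using AE_F_neq[of 0] AE_F_neq[of 1]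
  by eventually_elim (use F_ge_0 F_le_1 in \<open>auto simp: less_le\<close>)

lemma quantile:
  assumes u: "u \<in> {0..1}"
  shows F_quantile: "F (quantile R p u) = u"
    and quantile_range: "quantile R p u \<in> {-R..R}"
    and quantile_le_iff: "c \<in> {-R..R} \<Longrightarrow> quantile R p u \<le> c \<longleftrightarrow> u \<le> F c"
proof -
  define A where "A = {x\<in>{-R..R}. u \<le> F x}"
  have T: "quantile R p u = Inf A"
    by (simp add: quantile_def A_def cdf_of_eq)
  have "compact A"
  proof -
    have "A = {-R..R} \<inter> F -` {u..}" by (auto simp: A_def)
    moreover have "closed (F -` {u..} \<inter> UNIV)"
      using continuous_on_F[of UNIV] continuous_on_closed_vimage[of UNIV F] by auto
    ultimately show ?thesis by (auto intro: compact_Int_closed)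
  qed
  moreover obtain x where x: "x \<in> {-R..R}" "F x = u" using F_surj[OF u] .
  then have xA: "x \<in> A" by (auto simp: A_def)
  ultimately obtain w where w: "w \<in> A" "\<And>v. v \<in> A \<Longrightarrow> w \<le> v"
    using compact_attains_inf[of A] by auto
  have Tw: "quantile R p u = w" unfolding T by (rule cInf_eq_minimum) (use w in auto)
  have "F w \<le> u" using F_mono[of w x] w(2)[OF xA] x by auto
  then show "F (quantile R p u) = u" using w(1) by (auto simp only: Tw A_def mem_Collect_eq)
  show "quantile R p u \<in> {-R..R}" using w(1) by (auto simp: Tw A_def)
  show "quantile R p u \<le> c \<longleftrightarrow> u \<le> F c" if c: "c \<in> {-R..R}"
    using w c F_mono[of w c] by (auto simp: Tw A_def)
qed

end

text \<open>Changes of variables are first computed on half-open intervals with end points inside an open interval;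
these exhaust it.\<close>

lemma nn_integral_Ioc_exhaust:
  fixes f :: "real \<Rightarrow> ennreal"
  assumes f[measurable]: "f \<in> borel_measurable borel"
    and I: "open I" "is_interval I" "bounded I"
    and le: "\<And>a b. a \<in> I \<Longrightarrow> b \<in> I \<Longrightarrow> a < b \<Longrightarrow> (\<integral>\<^sup>+v. indicator {a<..b} v * f v \<partial>lborel) \<le> K"
  shows "(\<integral>\<^sup>+v. indicator I v * f v \<partial>lborel) \<le> K"
proof (cases "I = {}")
  case False
  have bd: "bdd_above I" "bdd_below I" using I(3) by (auto intro: bounded_imp_bdd_above bounded_imp_bdd_below)
  define a where "a = Inf I"
  define b where "b = Sup I"
  have Iab: "I = {a<..<b}"
  proof (intro set_eqI iffI)
    fix x assume x: "x \<in> I"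
    then obtain e where e: "e > 0" "ball x e \<subseteq> I" using I(1) openE by blast
    then have "x - e/2 \<in> I" "x + e/2 \<in> I" by (auto simp: subset_eq dist_real_def)
    then have "a \<le> x - e/2" "x + e/2 \<le> b" using bd by (auto simp: a_def b_def intro: cInf_lower cSup_upper)
    then show "x \<in> {a<..<b}" using e by auto
  next
    fix x assume "x \<in> {a<..<b}"
    then obtain u v where "u \<in> I" "u < x" "v \<in> I" "x < v"
      using cInf_lessD[OF False, of x] less_cSupD[OF False, of x] by (auto simp: a_def b_def)
    then show "x \<in> I" using I(2) unfolding is_interval_1 by (meson less_imp_le)
  qed
  have ab: "a < b" using False Iab by auto
  define \<alpha> where "\<alpha> n = a + (b - a) / (real n + 3)" for n
  define \<beta> where "\<beta> n = b - (b - a) / (real n + 3)" for n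
  have in_I: "\<alpha> n \<in> I" "\<beta> n \<in> I" "\<alpha> n < \<beta> n" for n
  proof -
    define d where "d = (b - a) / (real n + 3)"
    have "d \<le> (b - a) / 3" unfolding d_def using ab by (intro divide_left_mono) auto
    moreover have "0 < d" using ab by (auto simp: d_def)
    ultimately show "\<alpha> n \<in> I" "\<beta> n \<in> I" "\<alpha> n < \<beta> n"
      unfolding Iab \<alpha>_def \<beta>_def d_def[symmetric] using ab by auto
  qed
  have lim: "(\<lambda>n. (b - a) / (real n + 3)) \<longlonglongrightarrow> 0"
    by real_asymp
  have "(\<integral>\<^sup>+v. indicator I v * f v \<partial>lborel) \<le> (\<integral>\<^sup>+v. liminf (\<lambda>n. indicator {\<alpha> n<..\<beta> n} v * f v) \<partial>lborel)"
  proof (rule nn_integral_mono)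
    fix v
    show "indicator I v * f v \<le> liminf (\<lambda>n. indicator {\<alpha> n<..\<beta> n} v * f v)"
    proof (cases "v \<in> I")
      case True
      have "\<alpha> \<longlonglongrightarrow> a + 0" "\<beta> \<longlonglongrightarrow> b - 0" unfolding \<alpha>_def \<beta>_def by (intro tendsto_intros lim)+
      then have "\<forall>\<^sub>F n in sequentially. \<alpha> n < v" "\<forall>\<^sub>F n in sequentially. v < \<beta> n"
        using True Iab by (auto intro: order_tendstoD)
      then have "\<forall>\<^sub>F n in sequentially. indicator I v * f v \<le> indicator {\<alpha> n<..\<beta> n} v * f v"
        by eventually_elim (auto simp: True)
      then show ?thesis by (intro Liminf_bounded)
    qed auto
  qed
  also have "\<dots> \<le> liminf (\<lambda>n. \<integral>\<^sup>+v. indicator {\<alpha> n<..\<beta> n} v * f v \<partial>lborel)"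
    by (intro nn_integral_liminf) auto
  also have "\<dots> \<le> liminf (\<lambda>n. K)"
    by (intro Liminf_mono always_eventually allI le in_I)
  finally show ?thesis by (simp add: Liminf_const)
qed auto

section \<open>Monotone transport between two densities on an interval\<close>

text \<open>The increasing map is taken from the law of \<open>q\<close>, an arbitrary density, to the law of the unimodal density \<open>p\<close>.
In this direction it is continuous wherever the distribution function of \<open>q\<close> lies strictly between \<open>0\<close> and \<open>1\<close>, and
there it is the integral of its derivative, whatever the zeros of \<open>q\<close>; the inverse map jumps across every interval on which \<open>q\<close> vanishes.\<close>

locale monotone_transport = p: bounded_density p R + q: bounded_density q R
  for p q :: "real \<Rightarrow> real" and R :: real +
  assumes quasi_concave: "\<And>x y z. x \<le> y \<Longrightarrow> y \<le> z \<Longrightarrow> min (p x) (p z) \<le> p y"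
begin

abbreviation "F \<equiv> cdf p.law"
abbreviation "G \<equiv> cdf q.law"

definition S :: "real \<Rightarrow> real" where "S v = quantile R p (G v)"
definition I :: "real set" where "I = {v. 0 < G v \<and> G v < 1}"
definition \<theta> :: "real \<Rightarrow> real" where "\<theta> v = q v / p (S v)"

lemma G_unit: "G v \<in> {0..1}"
  using q.F_ge_0 q.F_le_1 by auto

lemma F_S: "F (S v) = G v"
  unfolding S_def by (rule p.F_quantile[OF G_unit])

lemma S_range: "S v \<in> {-R..R}"
  unfolding S_def by (rule p.quantile_range[OF G_unit])

lemma S_le_iff: "c \<in> {-R..R} \<Longrightarrow> S v \<le> c \<longleftrightarrow> G v \<le> F c"
  unfolding S_def by (rule p.quantile_le_iff[OF G_unit])

lemma S_mono: "v \<le> w \<Longrightarrow> S v \<le> S w"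
  using S_le_iff[OF S_range, of v w] by (simp add: F_S q.F_mono)

lemma S_measurable[measurable]: "S \<in> borel_measurable borel"
  by (rule borel_measurable_mono) (auto simp: mono_def S_mono)

lemma \<theta>_measurable[measurable]: "\<theta> \<in> borel_measurable borel"
  unfolding \<theta>_def by measurable

lemma \<theta>_nonneg: "0 \<le> \<theta> v"
  by (simp add: \<theta>_def p.p_nonneg q.p_nonneg)

lemma I_measurable[measurable]: "I \<in> sets borel"
  unfolding I_def by measurable

lemma I_subset: "I \<subseteq> {-R..R}"
proof
  fix v assume "v \<in> I"
  then have "\<not> v \<le> -R" "\<not> R \<le> v" using q.F_left[of v] q.F_right[of v] by (auto simp: I_def)
  then show "v \<in> {-R..R}" by auto
qed

lemma I_open: "open I"
proof -
  have "I = G -` {0<..<1} \<inter> UNIV" by (auto simp: I_def)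
  then show ?thesis using q.continuous_on_F[of UNIV] continuous_on_open_vimage[of UNIV G] by auto
qed

lemma I_convex: "a \<in> I \<Longrightarrow> b \<in> I \<Longrightarrow> a \<le> v \<Longrightarrow> v \<le> b \<Longrightarrow> v \<in> I"
  using q.F_mono[of a v] q.F_mono[of v b] by (auto simp: I_def)

lemma AE_I: "AE v in q.law. v \<in> I"
  using q.AE_F_interior by (simp add: I_def)

text \<open>The mass on one side of \<open>x\<close> is at most the length of the support times the value at
  \<open>x\<close>, because a quasi-concave density is monotone on one of the two sides.\<close>

lemma p_lower_bound: "min (F x) (1 - F x) \<le> 2 * R * p x"
proof -
  have *: "emeasure p.law A \<le> ennreal (2 * R * p x)" if A: "A \<in> sets borel" "\<And>v. v \<in> A \<Longrightarrow> p v \<le> p x" for A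
  proof -
    have "emeasure p.law A = (\<integral>\<^sup>+v. ennreal (p v) * indicator A v \<partial>lborel)"
      using A by (simp add: p.law_def emeasure_density)
    also have "\<dots> \<le> (\<integral>\<^sup>+v. ennreal (p x) * indicator {-R..R} v \<partial>lborel)"
      using p.p_support A(2) by (intro nn_integral_mono) (auto simp: indicator_def intro!: ennreal_leI)
    also have "\<dots> = ennreal (2 * R * p x)"
      using p.R_nonneg p.p_nonneg by (simp add: nn_integral_cmult_indicator ennreal_mult'' mult.commute
        flip: ennreal_mult)
    finally show ?thesis .
  qed
  have nn: "0 \<le> 2 * R * p x" using p.R_nonneg p.p_nonneg[of x] by simp
  consider "\<forall>v\<le>x. p v \<le> p x" | "\<forall>v\<ge>x. p v \<le> p x"
    using quasi_concave[of _ x _] by (metis linorder_le_cases min_le_iff_disj order_trans)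
  then show ?thesis
  proof cases
    case 1
    then have "emeasure p.law {..x} \<le> ennreal (2 * R * p x)" by (intro *) auto
    then have "F x \<le> 2 * R * p x" using nn by (simp add: cdf_def p.law.emeasure_eq_measure)
    then show ?thesis by simp
  next
    case 2
    then have "emeasure p.law {x<..} \<le> ennreal (2 * R * p x)" by (intro *) auto
    then have "measure p.law {x<..} \<le> 2 * R * p x" using nn by (simp add: p.law.emeasure_eq_measure)
    moreover have "measure p.law {x<..} = 1 - F x"
      using p.law.prob_compl[of "{..x}"] by (simp add: cdf_def Compl_eq_Diff_UNIV[symmetric])
    ultimately show ?thesis by simp
  qed
qed

lemma R_pos: "0 < R"
  using p_lower_bound[of "S 0"] p.R_nonneg p.F_left[of 0] p.F_right[of 0]
  by (cases "R = 0") auto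

lemma p_pos: "0 < F x \<Longrightarrow> F x < 1 \<Longrightarrow> 0 < p x"
  using p_lower_bound[of x] R_pos p.p_nonneg[of x] by (cases "p x = 0") (auto simp: min_def split: if_splits)

lemma p_S_pos: "v \<in> I \<Longrightarrow> 0 < p (S v)"
  by (rule p_pos) (auto simp: F_S I_def)

lemma push: "distr q.law borel S = p.law"
proof (rule cdf_unique)
  show "real_distribution (distr q.law borel S)" by (intro q.law.real_distribution_distr) measurable
  show "real_distribution p.law" by (rule p.law.real_distribution_axioms)
  show "cdf (distr q.law borel S) = F"
  proof
    fix c
    have "cdf (distr q.law borel S) c = measure q.law {v. S v \<le> c}"
      by (simp add: cdf_def measure_distr vimage_def)
    also have "\<dots> = F c"
    proof (cases "c \<in> {-R..R}")
      case True
      then show ?thesis using q.prob_F_le[of "F c"] p.F_ge_0 p.F_le_1 by (simp add: S_le_iff)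
    next
      case False
      then consider "c < -R" | "R < c" by force
      then show ?thesis
      proof cases
        case 1
        then have "{v. S v \<le> c} = {}" using S_range by (auto simp: set_eq_iff) (metis leD le_less_trans atLeastAtMost_iff)
        then show ?thesis using p.F_left[of c] 1 by simp
      next
        case 2
        then have "{v. S v \<le> c} = space q.law" using S_range by (auto simp: set_eq_iff) (metis le_less_trans less_imp_le atLeastAtMost_iff)
        then show ?thesis using p.F_right[of c] 2 q.law.prob_space by simp
      qed
    qed
    finally show "cdf (distr q.law borel S) c = F c" .
  qed
qed

lemma nn_integral_push:
  assumes [measurable]: "\<phi> \<in> borel_measurable borel"
  shows "(\<integral>\<^sup>+v. ennreal (q v) * \<phi> (S v) \<partial>lborel) = (\<integral>\<^sup>+x. ennreal (p x) * \<phi> x \<partial>lborel)"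
proof -
  have "(\<integral>\<^sup>+x. ennreal (p x) * \<phi> x \<partial>lborel) = (\<integral>\<^sup>+x. \<phi> x \<partial>p.law)"
    by (rule p.nn_integral_law[symmetric]) measurable
  also have "\<dots> = (\<integral>\<^sup>+v. \<phi> (S v) \<partial>q.law)"
    by (subst push[symmetric], subst nn_integral_distr) auto
  also have "\<dots> = (\<integral>\<^sup>+v. ennreal (q v) * \<phi> (S v) \<partial>lborel)"
    by (rule q.nn_integral_law) measurable
  finally show ?thesis ..
qed

text \<open>\<open>\<theta>\<close> is the derivative of \<open>S\<close>: this is the change of variables \<open>x = S v\<close> in
  \<open>\<integral> 1 dx = \<integral> (1 / p x) p x dx\<close>.\<close>

lemma nn_integral_\<theta>:
  assumes a: "a \<in> I" and b: "b \<in> I" and ab: "a \<le> b"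
  shows "(\<integral>\<^sup>+v. indicator {a<..b} v * ennreal (\<theta> v) \<partial>lborel) = ennreal (S b - S a)"
proof -
  define J where "J = {S a<..S b}"
  have "(\<integral>\<^sup>+v. indicator {a<..b} v * ennreal (\<theta> v) \<partial>lborel)
      = (\<integral>\<^sup>+v. ennreal (q v) * (indicator {a<..b} v * ennreal (1 / p (S v))) \<partial>lborel)"
    by (intro nn_integral_cong) (auto simp: \<theta>_def indicator_def p.p_nonneg q.p_nonneg ennreal_mult[symmetric])
  also have "\<dots> = (\<integral>\<^sup>+v. indicator {a<..b} v * ennreal (1 / p (S v)) \<partial>q.law)"
    by (rule q.nn_integral_law[symmetric]) measurable
  also have "\<dots> = (\<integral>\<^sup>+v. indicator J (S v) * ennreal (1 / p (S v)) \<partial>q.law)"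
  proof (rule nn_integral_cong_AE)
    show "AE v in q.law. indicator {a<..b} v * ennreal (1 / p (S v)) = indicator J (S v) * ennreal (1 / p (S v))"
      using q.AE_F_neq[of "G a"] q.AE_F_neq[of "G b"]
    proof eventually_elim
      case v: (elim v)
      then have "S v \<noteq> S a" "S v \<noteq> S b" by (metis F_S)+
      then have "v \<in> {a<..b} \<longleftrightarrow> S v \<in> J"
        using S_mono[of v a] S_mono[of a v] S_mono[of v b] S_mono[of b v]
        unfolding J_def greaterThanAtMost_iff by linarith
      then show ?case
        by (auto simp: indicator_def)
    qed
  qed
  also have "\<dots> = (\<integral>\<^sup>+v. ennreal (q v) * (indicator J (S v) * ennreal (1 / p (S v))) \<partial>lborel)"
    by (rule q.nn_integral_law) (auto simp: J_def)
  also have "\<dots> = (\<integral>\<^sup>+x. ennreal (p x) * (indicator J x * ennreal (1 / p x)) \<partial>lborel)"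
    by (rule nn_integral_push) (auto simp: J_def)
  also have "\<dots> = (\<integral>\<^sup>+x. indicator J x \<partial>lborel)"
  proof (intro nn_integral_cong)
    fix x
    have "0 < p x" if "x \<in> J"
      using that p.F_mono[of "S a" x] p.F_mono[of x "S b"] a b by (intro p_pos) (auto simp: J_def F_S I_def)
    then show "ennreal (p x) * (indicator J x * ennreal (1 / p x)) = indicator J x"
      by (auto simp: indicator_def ennreal_mult[symmetric])
  qed
  also have "\<dots> = ennreal (S b - S a)"
    using S_mono[OF ab] by (simp add: J_def)
  finally show ?thesis .
qed

text \<open>By \<open>p_lower_bound\<close> the distribution function \<open>F\<close> is strictly increasing where \<open>0 < F < 1\<close>. Hence \<open>S\<close> maps
\<open>I\<close> onto that open set, and a monotone function with open image is continuous.\<close>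

lemma S_continuous: "continuous_on I S"
proof (rule continuous_onI_mono)
  show "S x \<le> S y" if "x \<le> y" for x y using S_mono that .
  have "S ` I = F -` {0<..<1} \<inter> UNIV"
  proof (intro set_eqI iffI)
    fix x assume "x \<in> F -` {0<..<1} \<inter> UNIV"
    then have x: "0 < F x" "F x < 1" by auto
    then obtain v where v: "G v = F x" using q.F_surj[of "F x"] by auto
    have xR: "x \<in> {-R..R}"
      using x p.F_left[of x] p.F_right[of x] by (cases "x \<le> -R"; cases "R \<le> x") auto
    have Sx: "S v \<le> x" using S_le_iff[OF xR, of v] v by simp
    define \<delta> where "\<delta> = min (F x) (1 - F x) / (2 * R)"
    have \<delta>: "0 < \<delta>" using x R_pos by (simp add: \<delta>_def)
    have "\<delta> \<le> p w" if "w \<in> {S v<..x}" for w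
    proof -
      have "F w = F x" using that p.F_mono[of "S v" w] p.F_mono[of w x] F_S[of v] v by auto
      then show ?thesis using p_lower_bound[of w] R_pos by (simp add: \<delta>_def field_simps)
    qed
    then have "(\<integral>\<^sup>+w. ennreal \<delta> * indicator {S v<..x} w \<partial>lborel) \<le> emeasure p.law {S v<..x}"
      by (simp add: p.law_def emeasure_density)
        (intro nn_integral_mono, auto simp: indicator_def intro!: ennreal_leI)
    also have "emeasure p.law {S v<..x} = 0"
      using p.F_Ioc[OF Sx] F_S[of v] v by simp
    finally have "\<delta> * (x - S v) \<le> 0"
      using Sx \<delta> by (simp add: nn_integral_cmult_indicator ennreal_mult[symmetric])
    then have "x = S v" using Sx \<delta> by (simp add: mult_le_0_iff)
    then show "x \<in> S ` I" using v x by (auto simp: I_def)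
  qed (auto simp: F_S I_def)
  then show "open (S ` I)" using p.continuous_on_F[of UNIV] continuous_on_open_vimage[of UNIV F] by auto
qed

definition interp :: "real \<Rightarrow> real \<Rightarrow> real" where "interp t v = (1 - t) * S v + t * v"

lemma interp_measurable[measurable]: "interp t \<in> borel_measurable borel"
  unfolding interp_def by measurable

lemma interp_strict_mono: "0 < t \<Longrightarrow> t \<le> 1 \<Longrightarrow> v < w \<Longrightarrow> interp t v < interp t w"
  unfolding interp_def using S_mono[of v w] by (intro add_le_less_mono mult_left_mono) auto

lemma interp_continuous: "continuous_on I (interp t)"
  unfolding interp_def by (intro continuous_intros S_continuous)

lemma nn_integral_interp_derivative:
  assumes t: "0 \<le> t" "t \<le> 1" and a: "a \<in> I" and b: "b \<in> I" and ab: "a \<le> b"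
  shows "(\<integral>\<^sup>+v. indicator {a<..b} v * ennreal ((1 - t) * \<theta> v + t) \<partial>lborel) = ennreal (interp t b - interp t a)"
proof -
  have "(\<integral>\<^sup>+v. indicator {a<..b} v * ennreal ((1 - t) * \<theta> v + t) \<partial>lborel)
      = (\<integral>\<^sup>+v. ennreal (1 - t) * (indicator {a<..b} v * ennreal (\<theta> v)) + ennreal t * indicator {a<..b} v \<partial>lborel)"
    using t \<theta>_nonneg by (intro nn_integral_cong) (auto simp: indicator_def ennreal_mult)
  also have "\<dots> = ennreal (1 - t) * ennreal (S b - S a) + ennreal t * ennreal (b - a)"
    using ab by (subst nn_integral_add) (auto simp: nn_integral_cmult nn_integral_\<theta>[OF a b ab])
  also have "\<dots> = ennreal ((1 - t) * (S b - S a) + t * (b - a))"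
    using t ab S_mono[OF ab] by (simp add: ennreal_mult)
  also have "(1 - t) * (S b - S a) + t * (b - a) = interp t b - interp t a"
    by (simp add: interp_def algebra_simps)
  finally show ?thesis .
qed

text \<open>Substitution of \<open>x = (1 - t) S v + t v\<close>. It is an equality over the image of \<open>I\<close>, which need not be the whole line.\<close>

lemma nn_integral_interp_le:
  assumes t: "0 < t" "t \<le> 1" and [measurable]: "\<phi> \<in> borel_measurable borel"
  shows "(\<integral>\<^sup>+v. indicator I v * (ennreal ((1 - t) * \<theta> v + t) * \<phi> (interp t v)) \<partial>lborel) \<le> (\<integral>\<^sup>+x. \<phi> x \<partial>lborel)"
proof (rule nn_integral_Ioc_exhaust)
  show "open I" by (rule I_open)
  show "is_interval I" unfolding is_interval_1 using I_convex by blast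
  show "bounded I" using I_subset bounded_subset bounded_closed_interval by blast
  fix a b assume a: "a \<in> I" and b: "b \<in> I" and ab: "a < b"
  let ?z = "interp t"
  define w where "w v = indicator {a<..b} v * ennreal ((1 - t) * \<theta> v + t)" for v
  have [measurable]: "w \<in> borel_measurable borel" unfolding w_def by measurable
  define \<kappa> where "\<kappa> = distr (density lborel w) borel ?z"
  define L where "L = density lborel (indicator {?z a<..?z b})"
  have "\<kappa> = L"
  proof (rule measure_eqI_lessThan)
    show "sets \<kappa> = sets borel" "sets L = sets borel" by (auto simp: \<kappa>_def L_def)
    have both: "emeasure \<kappa> {c<..} = emeasure L {c<..} \<and> emeasure L {c<..} < \<infinity>" for c
    proof -
      \<comment> \<open>\<open>m\<close> is \<open>c\<close> moved into the range of \<open>?z\<close> on \<open>[a, b]\<close>, so one computation serves all positions of \<open>c\<close>.\<close>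
      define m where "m = max (?z a) (min c (?z b))"
      have zab: "?z a < ?z b" using interp_strict_mono[OF t ab] .
      have "continuous_on {a..b} ?z"
        by (rule continuous_on_subset[OF interp_continuous]) (use I_convex[OF a b] in auto)
      then obtain v0 where v0: "a \<le> v0" "v0 \<le> b" "?z v0 = m"
        using IVT'[of ?z a m b] zab ab by (auto simp: m_def)
      have v0I: "v0 \<in> I" using I_convex[OF a b] v0 by auto
      have mono: "?z v < ?z v' \<longleftrightarrow> v < v'" for v v'
        using interp_strict_mono[OF t, of v v'] interp_strict_mono[OF t, of v' v] by (cases v v' rule: linorder_cases) auto
      have "emeasure \<kappa> {c<..} = (\<integral>\<^sup>+v. w v * indicator {v. c < ?z v} v \<partial>lborel)"
        by (simp add: \<kappa>_def emeasure_distr emeasure_density vimage_def)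
      also have "\<dots> = (\<integral>\<^sup>+v. indicator {v0<..b} v * ennreal ((1 - t) * \<theta> v + t) \<partial>lborel)"
      proof (intro nn_integral_cong)
        fix v
        have "a < v \<and> v \<le> b \<and> c < ?z v \<longleftrightarrow> v0 < v \<and> v \<le> b"
          using mono[of a v] mono[of b v] mono[of v0 v] v0 zab
          by (auto simp: m_def max_def min_def split: if_splits)
        then show "w v * indicator {v. c < ?z v} v = indicator {v0<..b} v * ennreal ((1 - t) * \<theta> v + t)"
          by (auto simp: w_def indicator_def)
      qed
      also have "\<dots> = ennreal (?z b - m)"
        using nn_integral_interp_derivative[of t v0 b] t v0I b v0 by simp
      finally have 1: "emeasure \<kappa> {c<..} = ennreal (?z b - m)" .
      have "emeasure L {c<..} = (\<integral>\<^sup>+x. indicator ({?z a<..?z b} \<inter> {c<..}) x \<partial>lborel)"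
        by (simp add: L_def emeasure_density indicator_inter_arith)
      also have "\<dots> = emeasure lborel ({?z a<..?z b} \<inter> {c<..})" by (rule nn_integral_indicator) auto
      also have "{?z a<..?z b} \<inter> {c<..} = {m<..?z b}" by (auto simp: m_def)
      also have "emeasure lborel {m<..?z b} = ennreal (?z b - m)"
        using zab by (simp add: m_def)
      finally show ?thesis using 1 by simp
    qed
    show "emeasure \<kappa> {c<..} = emeasure L {c<..}" "emeasure \<kappa> {c<..} < \<infinity>" for c using both[of c] by auto
  qed
  have "(\<integral>\<^sup>+v. indicator {a<..b} v * (ennreal ((1 - t) * \<theta> v + t) * \<phi> (?z v)) \<partial>lborel) = (\<integral>\<^sup>+v. w v * \<phi> (?z v) \<partial>lborel)"
    by (simp add: w_def mult.assoc)
  also have "\<dots> = (\<integral>\<^sup>+x. \<phi> x \<partial>\<kappa>)"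
    by (simp add: \<kappa>_def nn_integral_distr nn_integral_density)
  also have "\<dots> = (\<integral>\<^sup>+x. indicator {?z a<..?z b} x * \<phi> x \<partial>lborel)"
    unfolding \<open>\<kappa> = L\<close> L_def by (subst nn_integral_density) auto
  also have "\<dots> \<le> (\<integral>\<^sup>+x. \<phi> x \<partial>lborel)"
    by (intro nn_integral_mono) (auto simp: indicator_def)
  finally show "(\<integral>\<^sup>+v. indicator {a<..b} v * (ennreal ((1 - t) * \<theta> v + t) * \<phi> (?z v)) \<partial>lborel) \<le> (\<integral>\<^sup>+x. \<phi> x \<partial>lborel)" .
qed measurable

end

lemma weighted_geometric_mean_le:
  fixes x t :: real
  assumes "0 \<le> x" "0 < t" "t < 1"
  shows "x powr (1 - t) \<le> (1 - t) * x + t"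
proof (cases "x = 0")
  case False
  then have x: "0 < x" using assms by simp
  define L where "L = (1 - t) * ln x"
  have "1 = (1 - t) * (1 + (ln x - L)) + t * (1 + (- L))" by (simp add: L_def algebra_simps)
  also have "\<dots> \<le> (1 - t) * exp (ln x - L) + t * exp (- L)"
    using assms by (intro add_mono mult_left_mono exp_ge_add_one_self) auto
  also have "\<dots> = ((1 - t) * x + t) / exp L"
    using x by (simp add: exp_diff exp_minus field_simps)
  finally have "exp L \<le> (1 - t) * x + t" by (simp add: field_simps)
  then show ?thesis using x by (simp add: powr_def L_def)
qed (use assms in auto)

text \<open>Let \<open>S\<close> carry \<open>g / B\<close> to \<open>f / A\<close>. After substituting \<open>x = (1 - t) S v + t v\<close> the integrand is at least
\<open>((1 - t) \<theta> + t) f (S v) powr (1 - t) g v powr t\<close>, and by the inequality of arithmetic and geometric means the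
Jacobian is at least \<open>\<theta> powr (1 - t)\<close>; the product then collapses to a constant times \<open>g v\<close>.\<close>

lemma prekopa_leindler_interval:
  fixes f g :: "real \<Rightarrow> real" and h :: "real \<Rightarrow> ennreal"
  assumes [measurable]: "f \<in> borel_measurable borel" "g \<in> borel_measurable borel" "h \<in> borel_measurable borel"
    and nonneg: "\<And>x. 0 \<le> f x" "\<And>x. 0 \<le> g x"
    and supp: "\<And>x. x \<notin> {-R..R} \<Longrightarrow> f x = 0" "\<And>x. x \<notin> {-R..R} \<Longrightarrow> g x = 0"
    and quasi: "\<And>x y z. x \<le> y \<Longrightarrow> y \<le> z \<Longrightarrow> min (f x) (f z) \<le> f y"
    and A: "(\<integral>\<^sup>+x. ennreal (f x) \<partial>lborel) = ennreal A" "0 < A"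
    and B: "(\<integral>\<^sup>+x. ennreal (g x) \<partial>lborel) = ennreal B" "0 < B"
    and t: "0 < t" "t < 1"
    and h: "\<And>u v. ennreal (f u powr (1 - t) * g v powr t) \<le> h ((1 - t) * u + t * v)"
  shows "ennreal (A powr (1 - t) * B powr t) \<le> (\<integral>\<^sup>+x. h x \<partial>lborel)"
proof -
  interpret monotone_transport "\<lambda>x. f x / A" "\<lambda>x. g x / B" R
  proof unfold_locales
    show "(\<integral>\<^sup>+x. ennreal (f x / A) \<partial>lborel) = 1" "(\<integral>\<^sup>+x. ennreal (g x / B) \<partial>lborel) = 1"
      using A B nonneg by (simp_all add: divide_ennreal[symmetric] nn_integral_divide)
    show "min (f x / A) (f z / A) \<le> f y / A" if "x \<le> y" "y \<le> z" for x y z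
      using quasi[OF that] A by (auto simp: min_le_iff_disj divide_right_mono)
  qed (use A B nonneg supp in auto)
  have t1: "t \<le> 1" using t by simp
  have pt: "ennreal ((A / B) powr (1 - t) * g v) \<le> indicator I v * (ennreal ((1 - t) * \<theta> v + t) * h (interp t v))"
    if v: "v \<in> I" for v
  proof -
    have f: "0 < f (S v)" using p_S_pos[OF v] A by (simp add: zero_less_divide_iff)
    have "(A / B) powr (1 - t) * g v = \<theta> v powr (1 - t) * (f (S v) powr (1 - t) * g v powr t)"
    proof (cases "g v = 0")
      case False
      then have g: "0 < g v" using nonneg(2)[of v] by simp
      have "\<theta> v = (A / B) * g v / f (S v)" by (simp add: \<theta>_def)
      then have "\<theta> v powr (1 - t) = (A / B) powr (1 - t) * g v powr (1 - t) / f (S v) powr (1 - t)"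
        using A B f g by (simp add: powr_mult powr_divide)
      moreover have "g v powr (1 - t) * g v powr t = g v" using g by (simp add: powr_add[symmetric])
      ultimately show ?thesis using f by (simp add: field_simps)
    qed (simp add: \<theta>_def)
    also have "\<dots> \<le> ((1 - t) * \<theta> v + t) * (f (S v) powr (1 - t) * g v powr t)"
      using t \<theta>_nonneg by (intro mult_right_mono weighted_geometric_mean_le) auto
    finally have "ennreal ((A / B) powr (1 - t) * g v) \<le> ennreal ((1 - t) * \<theta> v + t) * ennreal (f (S v) powr (1 - t) * g v powr t)"
      using t \<theta>_nonneg[of v] by (simp add: ennreal_mult[symmetric] ennreal_leI del: ennreal_plus)
    also have "\<dots> \<le> ennreal ((1 - t) * \<theta> v + t) * h (interp t v)"
      unfolding interp_def by (intro mult_left_mono h) auto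
    finally show ?thesis using v by simp
  qed
  have "A powr (1 - t) * B powr t = (A / B) powr (1 - t) * B"
    using A B by (simp add: powr_divide powr_diff field_simps)
  then have "ennreal (A powr (1 - t) * B powr t) = ennreal ((A / B) powr (1 - t)) * (\<integral>\<^sup>+v. ennreal (g v) \<partial>lborel)"
    using B by (simp add: ennreal_mult)
  also have "\<dots> = (\<integral>\<^sup>+v. ennreal ((A / B) powr (1 - t) * g v) \<partial>lborel)"
    using nonneg by (simp add: ennreal_mult nn_integral_cmult)
  also have "\<dots> \<le> (\<integral>\<^sup>+v. indicator I v * (ennreal ((1 - t) * \<theta> v + t) * h (interp t v)) \<partial>lborel)"
  proof (rule nn_integral_mono_AE)
    have "AE v in lborel. 0 < g v / B \<longrightarrow> v \<in> I"
      using AE_I by (subst (asm) q.AE_law) auto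
    then show "AE v in lborel. ennreal ((A / B) powr (1 - t) * g v) \<le> indicator I v * (ennreal ((1 - t) * \<theta> v + t) * h (interp t v))"
    proof eventually_elim
      case v: (elim v)
      show ?case
      proof (cases "v \<in> I")
        case False
        then have "g v = 0" using v B nonneg(2)[of v] by (auto simp: zero_less_divide_iff)
        then show ?thesis by simp
      qed (rule pt)
    qed
  qed
  also have "\<dots> \<le> (\<integral>\<^sup>+x. h x \<partial>lborel)"
    by (rule nn_integral_interp_le[OF t(1) t1]) measurable
  finally show ?thesis .
qed

section \<open>Variance of the displacement\<close>

text \<open>\<open>P - q + q ln (q / P)\<close>, extended by continuity to \<open>q = 0\<close>. Its integral is the relative entropy when \<open>P\<close> and
\<open>q\<close> are probability densities and \<open>P > 0\<close>; then it is nonnegative at every point.\<close>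

definition entropy_gap :: "real \<Rightarrow> real \<Rightarrow> real" where
  "entropy_gap P q = (if 0 < q then P - q - q * ln (P / q) else P)"

text \<open>Applying \<open>ln x \<le> x - 1\<close> to the square root of \<open>P / q\<close> bounds \<open>entropy_gap P q\<close> below by the squared difference
of the square roots of \<open>P\<close> and \<open>q\<close>; multiplying by the squared sum of the square roots, which is at most \<open>2 (P + q)\<close>, gives \<open>(P - q)\<^sup>2\<close>.\<close>

lemma hellinger_le_entropy_gap:
  assumes "0 < P" "0 \<le> q"
  shows "(P - q)\<^sup>2 / (P + q) \<le> 2 * entropy_gap P q"
proof (cases "q = 0")
  case False
  then have q: "0 < q" using assms by simp
  define a where "a = sqrt P" define b where "b = sqrt q"
  have ab: "a > 0" "b > 0" "P = a\<^sup>2" "q = b\<^sup>2" using assms q by (auto simp: a_def b_def)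
  have "ln (P / q) = 2 * ln (a / b)"
    using ab by (simp add: power_divide[symmetric] ln_realpow)
  also have "\<dots> \<le> 2 * (a / b - 1)" using ab ln_le_minus_one[of "a / b"] by simp
  finally have "q * ln (P / q) \<le> q * (2 * (a / b - 1))" using q by (intro mult_left_mono) auto
  also have "\<dots> = 2 * a * b - 2 * q" using ab by (simp add: field_simps power2_eq_square)
  finally have 1: "(a - b)\<^sup>2 \<le> entropy_gap P q"
    using q ab by (simp add: entropy_gap_def power2_diff)
  have "(P - q)\<^sup>2 = (a - b)\<^sup>2 * (a + b)\<^sup>2" unfolding ab by (simp add: power_mult_distrib[symmetric] power2_eq_square algebra_simps)
  also have "\<dots> \<le> (a - b)\<^sup>2 * (2 * (P + q))"
    using sum_squares_bound[of a b] unfolding ab by (intro mult_left_mono) (auto simp: power2_sum)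
  finally have "(P - q)\<^sup>2 / (P + q) \<le> 2 * (a - b)\<^sup>2"
    using assms by (simp add: field_simps)
  then show ?thesis using 1 by simp
qed (use assms in \<open>simp add: entropy_gap_def power2_eq_square\<close>)

lemma entropy_gap_nonneg: "0 < P \<Longrightarrow> 0 \<le> q \<Longrightarrow> 0 \<le> entropy_gap P q"
  using hellinger_le_entropy_gap[of P q] by (smt (verit) divide_nonneg_pos zero_le_power2)

lemma (in prob_space) nn_variance_eq_double_integral:
  assumes [measurable]: "f \<in> borel_measurable M" and bound: "AE x in M. \<bar>f x\<bar> \<le> C"
  shows "2 * (\<integral>\<^sup>+x. ennreal ((f x - expectation f)\<^sup>2) \<partial>M) = (\<integral>\<^sup>+x. \<integral>\<^sup>+y. ennreal ((f x - f y)\<^sup>2) \<partial>M \<partial>M)"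
proof -
  have f: "integrable M f" by (rule integrable_const_bound[of _ C]) (use bound in auto)
  have f2: "integrable M (\<lambda>x. (f x)\<^sup>2)"
  proof (rule integrable_const_bound[of _ "C\<^sup>2"])
    show "AE x in M. norm ((f x)\<^sup>2) \<le> C\<^sup>2"
      using bound by eventually_elim (auto simp: abs_le_square_iff[symmetric])
  qed auto
  define m where "m = expectation f"
  define E where "E = expectation (\<lambda>x. (f x)\<^sup>2)"
  have *: "(\<integral>\<^sup>+y. ennreal ((c - f y)\<^sup>2) \<partial>M) = ennreal (c\<^sup>2 - 2 * c * m + E)"
    "0 \<le> c\<^sup>2 - 2 * c * m + E" for c
  proof -
    have i: "integrable M (\<lambda>y. (c - f y)\<^sup>2)"
      unfolding power2_diff using f f2 by auto
    have "expectation (\<lambda>y. (c - f y)\<^sup>2) = c\<^sup>2 - 2 * c * m + E"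
      unfolding power2_diff m_def E_def using f f2 by (simp add: prob_space)
    then show "(\<integral>\<^sup>+y. ennreal ((c - f y)\<^sup>2) \<partial>M) = ennreal (c\<^sup>2 - 2 * c * m + E)"
      using nn_integral_eq_integral[OF i] by simp
    show "0 \<le> c\<^sup>2 - 2 * c * m + E"
      unfolding \<open>expectation (\<lambda>y. (c - f y)\<^sup>2) = c\<^sup>2 - 2 * c * m + E\<close>[symmetric] by simp
  qed
  have "(\<integral>\<^sup>+x. \<integral>\<^sup>+y. ennreal ((f x - f y)\<^sup>2) \<partial>M \<partial>M) = (\<integral>\<^sup>+x. ennreal ((f x)\<^sup>2 - 2 * f x * m + E) \<partial>M)"
    by (simp add: *)
  also have "\<dots> = ennreal (expectation (\<lambda>x. (f x)\<^sup>2 - 2 * f x * m + E))"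
    using f f2 * by (intro nn_integral_eq_integral) auto
  also have "expectation (\<lambda>x. (f x)\<^sup>2 - 2 * f x * m + E) = E - 2 * m * m + E"
    using f f2 by (simp add: prob_space m_def E_def)
  also have "\<dots> = 2 * (m\<^sup>2 - 2 * m * m + E)"
    by (simp add: power2_eq_square)
  also have "ennreal \<dots> = 2 * ennreal (m\<^sup>2 - 2 * m * m + E)"
    using *(2)[of m] by (subst ennreal_mult) auto
  also have "ennreal (m\<^sup>2 - 2 * m * m + E) = (\<integral>\<^sup>+x. ennreal ((f x - m)\<^sup>2) \<partial>M)"
    by (simp add: *(1)[symmetric] power2_commute)
  finally show ?thesis by (simp add: m_def)
qed

context monotone_transport
begin

text \<open>Up to a factor between \<open>1\<close> and \<open>2\<close>, the squared difference of \<open>1\<close> and the square root of \<open>\<theta> v\<close>.\<close>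

definition hellinger :: "real \<Rightarrow> real" where "hellinger v = (1 - \<theta> v)\<^sup>2 / (1 + \<theta> v)"

lemma hellinger_measurable[measurable]: "hellinger \<in> borel_measurable borel"
  unfolding hellinger_def by measurable

lemma hellinger_nonneg: "0 \<le> hellinger v"
  using \<theta>_nonneg[of v] by (simp add: hellinger_def)

text \<open>The derivative \<open>1 - \<theta>\<close> of the displacement is not square integrable in general, as \<open>\<theta>\<close> may be large. The weight
\<open>1 + \<theta>\<close> in the Cauchy-Schwarz inequality repairs this at no cost: its integral is the length of the interval
plus the length of its image, at most \<open>4 R\<close>.\<close>

lemma displacement_increment:
  assumes a: "a \<in> I" and b: "b \<in> I" and ab: "a \<le> b"
  shows "ennreal (((a - S a) - (b - S b))\<^sup>2) \<le> ennreal (4 * R) * (\<integral>\<^sup>+v. indicator {a<..b} v * ennreal (hellinger v) \<partial>lborel)"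
proof -
  let ?J = "\<lambda>v. indicator {a<..b} v :: ennreal"
  let ?N = "\<integral>\<^sup>+v. ?J v * ennreal \<bar>1 - \<theta> v\<bar> \<partial>lborel"
  have J2: "?J v ^ 2 = ?J v" "?J v * ?J v = ?J v" for v by (auto simp: indicator_def)
  have lin: "(\<integral>\<^sup>+v. ?J v * ennreal (1 + \<theta> v) \<partial>lborel) = ennreal ((b - a) + (S b - S a))"
  proof -
    have "(\<integral>\<^sup>+v. ?J v * ennreal (1 + \<theta> v) \<partial>lborel) = (\<integral>\<^sup>+v. ?J v + ?J v * ennreal (\<theta> v) \<partial>lborel)"
      using \<theta>_nonneg by (intro nn_integral_cong) (simp add: distrib_left)
    also have "\<dots> = ennreal (b - a) + ennreal (S b - S a)"
      using ab by (subst nn_integral_add) (auto simp: nn_integral_\<theta>[OF a b ab])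
    finally show ?thesis using ab S_mono[OF ab] by simp
  qed
  have le1: "1 \<le> ennreal (\<theta> v) + ennreal \<bar>1 - \<theta> v\<bar>" for v
    using ennreal_leI[of 1 "\<theta> v + \<bar>1 - \<theta> v\<bar>"] \<theta>_nonneg[of v] by simp
  have le2: "ennreal (\<theta> v) \<le> 1 + ennreal \<bar>1 - \<theta> v\<bar>" for v
    using ennreal_leI[of "\<theta> v" "1 + \<bar>1 - \<theta> v\<bar>"] by simp
  have abs: "ennreal \<bar>(a - S a) - (b - S b)\<bar> \<le> ?N"
  proof (cases "S b - S a \<le> b - a")
    case True
    have "ennreal (b - a) = (\<integral>\<^sup>+v. ?J v \<partial>lborel)" using ab by simp
    also have "\<dots> \<le> (\<integral>\<^sup>+v. ?J v * ennreal (\<theta> v) + ?J v * ennreal \<bar>1 - \<theta> v\<bar> \<partial>lborel)"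
      by (intro nn_integral_mono) (auto simp: indicator_def le1)
    also have "\<dots> = ennreal (S b - S a) + ?N"
      by (subst nn_integral_add) (auto simp: nn_integral_\<theta>[OF a b ab])
    finally have "ennreal (b - a) - ennreal (S b - S a) \<le> ?N"
      by (simp add: ennreal_minus_le_iff)
    then show ?thesis using True S_mono[OF ab] by (simp add: ennreal_minus algebra_simps)
  next
    case False
    have "ennreal (S b - S a) = (\<integral>\<^sup>+v. ?J v * ennreal (\<theta> v) \<partial>lborel)" by (simp add: nn_integral_\<theta>[OF a b ab])
    also have "\<dots> \<le> (\<integral>\<^sup>+v. ?J v + ?J v * ennreal \<bar>1 - \<theta> v\<bar> \<partial>lborel)"
      by (intro nn_integral_mono) (auto simp: indicator_def le2)
    also have "\<dots> = ennreal (b - a) + ?N"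
      using ab by (subst nn_integral_add) auto
    finally have "ennreal (S b - S a) - ennreal (b - a) \<le> ?N"
      by (simp add: ennreal_minus_le_iff)
    then show ?thesis using False ab by (simp add: ennreal_minus algebra_simps)
  qed
  have "ennreal (((a - S a) - (b - S b))\<^sup>2) = ennreal \<bar>(a - S a) - (b - S b)\<bar> ^ 2"
    by (simp add: ennreal_power)
  also have "\<dots> \<le> ?N\<^sup>2"
    by (intro power_mono abs) auto
  also have "\<dots> = (\<integral>\<^sup>+v. (?J v * ennreal (sqrt (hellinger v))) * (?J v * ennreal (sqrt (1 + \<theta> v))) \<partial>lborel)\<^sup>2"
  proof (intro arg_cong[where f="\<lambda>x. x\<^sup>2"] nn_integral_cong)
    fix v
    have "\<bar>1 - \<theta> v\<bar> = sqrt (hellinger v) * sqrt (1 + \<theta> v)"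
      using \<theta>_nonneg[of v] by (simp add: hellinger_def real_sqrt_mult[symmetric])
    then show "?J v * ennreal \<bar>1 - \<theta> v\<bar> = (?J v * ennreal (sqrt (hellinger v))) * (?J v * ennreal (sqrt (1 + \<theta> v)))"
      using \<theta>_nonneg[of v] hellinger_nonneg[of v] by (simp add: indicator_def ennreal_mult)
  qed
  also have "\<dots> \<le> (\<integral>\<^sup>+v. (?J v * ennreal (sqrt (hellinger v)))\<^sup>2 \<partial>lborel) * (\<integral>\<^sup>+v. (?J v * ennreal (sqrt (1 + \<theta> v)))\<^sup>2 \<partial>lborel)"
    by (rule Cauchy_Schwarz_nn_integral) measurable
  also have "\<dots> = (\<integral>\<^sup>+v. ?J v * ennreal (hellinger v) \<partial>lborel) * (\<integral>\<^sup>+v. ?J v * ennreal (1 + \<theta> v) \<partial>lborel)"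
    using \<theta>_nonneg hellinger_nonneg by (simp add: power_mult_distrib J2 ennreal_power)
  also have "\<dots> \<le> (\<integral>\<^sup>+v. ?J v * ennreal (hellinger v) \<partial>lborel) * ennreal (4 * R)"
  proof -
    have "(b - a) + (S b - S a) \<le> 4 * R"
      using S_range[of a] S_range[of b] I_subset a b by (auto simp: subset_eq) (smt (verit) atLeastAtMost_iff)
    then show ?thesis unfolding lin by (intro mult_left_mono ennreal_leI) auto
  qed
  finally show ?thesis by (simp add: mult.commute)
qed

lemma measure_lessThan: "emeasure q.law {..<v} = ennreal (G v)"
  and measure_atLeast: "emeasure q.law {v..} = ennreal (1 - G v)"
proof -
  have "{..v} = {..<v} \<union> {v}" by auto
  then have "G v = measure q.law ({..<v} \<union> {v})" by (simp only: cdf_def)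
  also have "\<dots> = measure q.law {..<v}"
    by (subst q.law.finite_measure_Union) (auto simp: q.measure_law_singleton)
  finally have eq: "measure q.law {..<v} = G v" ..
  then show "emeasure q.law {..<v} = ennreal (G v)" by (simp add: q.law.emeasure_eq_measure)
  have "measure q.law {v..} = 1 - measure q.law {..<v}"
    using q.law.prob_compl[of "{..<v}"] by (simp add: Compl_eq_Diff_UNIV[symmetric])
  then show "emeasure q.law {v..} = ennreal (1 - G v)" by (simp add: q.law.emeasure_eq_measure eq)
qed

text \<open>The variance is half the mean of the squared increment over two independent points. A point \<open>y\<close> lies between them
with probability \<open>2 G y (1 - G y)\<close>, which \<open>p_lower_bound\<close> compares with the value of \<open>p\<close> at \<open>S y\<close>; this value
turns \<open>hellinger\<close> into the quotient bounded by \<open>hellinger_le_entropy_gap\<close>.\<close>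

lemma variance_displacement:
  defines "f \<equiv> \<lambda>v. v - S v"
  shows "(\<integral>\<^sup>+v. ennreal ((f v - (\<integral>w. f w \<partial>q.law))\<^sup>2) \<partial>q.law) \<le> ennreal (16 * R\<^sup>2) * (\<integral>\<^sup>+v. indicator I v * ennreal (entropy_gap (p (S v)) (q v)) \<partial>lborel)"
    (is "?V \<le> _ * ?E")
proof -
  have [measurable]: "f \<in> borel_measurable borel" unfolding f_def by measurable
  define h where "h v = indicator I v * ennreal (hellinger v)" for v
  have [measurable]: "h \<in> borel_measurable borel" unfolding h_def by measurable
  let ?H = "\<integral>\<^sup>+y. ennreal (G y) * (ennreal (1 - G y) * h y) \<partial>lborel"
  \<comment> \<open>\<open>K a b y\<close> is \<open>h y\<close> if \<open>a < y \<le> b\<close> and \<open>0\<close> otherwise, in a product form suited to the theorem of Fubini.\<close>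
  define K where "K a b y = (indicator {..<y} a * (indicator {y..} b * h y) :: ennreal)" for a b y
  let ?K = "\<lambda>a b. \<integral>\<^sup>+y. K a b y \<partial>lborel"
  have K_alt: "K a b y = (if a < y \<and> y \<le> b then h y else 0)" for a b y
    by (auto simp: K_def)
  have Kab: "?K a b = (\<integral>\<^sup>+v. indicator {a<..b} v * h v \<partial>lborel)" for a b
    by (intro nn_integral_cong) (auto simp: K_def indicator_def)
  have [measurable]: "(\<lambda>(x, y). K a x y) \<in> borel_measurable (borel \<Otimes>\<^sub>M borel)" 
     "(\<lambda>(x, y). K x b y) \<in> borel_measurable (borel \<Otimes>\<^sub>M borel)" for a b
    unfolding K_alt by measurable
  have inc: "ennreal ((f a - f b)\<^sup>2) \<le> ennreal (4 * R) * (?K a b + ?K b a)"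
    if a: "a \<in> I" and b: "b \<in> I" for a b
  proof -
    have *: "ennreal ((f a - f b)\<^sup>2) \<le> ennreal (4 * R) * ?K a b"
      if a: "a \<in> I" and b: "b \<in> I" and "a \<le> b" for a b
    proof -
      have "(\<integral>\<^sup>+v. indicator {a<..b} v * ennreal (hellinger v) \<partial>lborel) = ?K a b"
        unfolding Kab h_def by (intro nn_integral_cong) (use I_convex[OF a b] in \<open>auto simp: indicator_def\<close>)
      then show ?thesis using displacement_increment[OF that] by (simp add: f_def)
    qed
    show ?thesis
    proof (cases "a \<le> b")
      case True
      show ?thesis by (rule order_trans[OF *[OF a b True]]) (intro mult_left_mono, auto)
    next
      case False
      then have "ennreal ((f b - f a)\<^sup>2) \<le> ennreal (4 * R) * ?K b a" by (intro * a b) auto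
      also have "\<dots> \<le> ennreal (4 * R) * (?K a b + ?K b a)"
        by (intro mult_left_mono) auto
      finally show ?thesis by (simp add: power2_commute)
    qed
  qed
  interpret L: pair_sigma_finite q.law lborel by unfold_locales
  have K1: "(\<integral>\<^sup>+b. ?K a b \<partial>q.law) = (\<integral>\<^sup>+y. indicator {..<y} a * (ennreal (1 - G y) * h y) \<partial>lborel)" for a
  proof -
    have "(\<integral>\<^sup>+b. ?K a b \<partial>q.law) = (\<integral>\<^sup>+y. \<integral>\<^sup>+b. K a b y \<partial>q.law \<partial>lborel)"
      by (rule L.Fubini'[symmetric]) measurable
    also have "\<dots> = (\<integral>\<^sup>+y. indicator {..<y} a * (ennreal (1 - G y) * h y) \<partial>lborel)"
      unfolding K_def by (simp add: nn_integral_cmult nn_integral_multc measure_atLeast)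
    finally show ?thesis .
  qed
  have K2: "(\<integral>\<^sup>+a. \<integral>\<^sup>+b. ?K a b \<partial>q.law \<partial>q.law) = ?H"
  proof -
    have [measurable]: "(\<lambda>(a, y). indicator {..<y} a * (ennreal (1 - G y) * h y)) \<in> borel_measurable (borel \<Otimes>\<^sub>M borel)"
      unfolding indicator_def lessThan_iff by measurable
    have "(\<integral>\<^sup>+a. \<integral>\<^sup>+b. ?K a b \<partial>q.law \<partial>q.law)
        = (\<integral>\<^sup>+y. \<integral>\<^sup>+a. indicator {..<y} a * (ennreal (1 - G y) * h y) \<partial>q.law \<partial>lborel)"
      unfolding K1 by (rule L.Fubini'[symmetric]) measurable
    also have "\<dots> = ?H"
      by (simp add: nn_integral_multc measure_lessThan)
    finally show ?thesis .
  qed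
  have K3: "(\<integral>\<^sup>+a. \<integral>\<^sup>+b. ?K b a \<partial>q.law \<partial>q.law) = ?H"
  proof -
    interpret Q: pair_sigma_finite q.law q.law by unfold_locales
    have [measurable]: "(\<lambda>(a,b). ?K a b) \<in> borel_measurable (borel \<Otimes>\<^sub>M borel)"
      unfolding Kab indicator_def greaterThanAtMost_iff by measurable
    show ?thesis unfolding K2[symmetric] by (rule Q.Fubini') measurable
  qed
  have int: "2 * ?V = (\<integral>\<^sup>+a. \<integral>\<^sup>+b. ennreal ((f a - f b)\<^sup>2) \<partial>q.law \<partial>q.law)"
  proof (rule q.law.nn_variance_eq_double_integral)
    show "AE x in q.law. \<bar>f x\<bar> \<le> 2 * R"
      using q.AE_law_range
    proof eventually_elim
      case (elim x)
      then show ?case using S_range[of x] by (auto simp: f_def abs_le_iff)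
    qed
  qed measurable
  also have "\<dots> \<le> (\<integral>\<^sup>+a. \<integral>\<^sup>+b. ennreal (4 * R) * (?K a b + ?K b a) \<partial>q.law \<partial>q.law)"
  proof (intro nn_integral_mono_AE)
    have "AE b in q.law. ennreal ((f a - f b)\<^sup>2) \<le> ennreal (4 * R) * (?K a b + ?K b a)"
      if "a \<in> I" for a
      using AE_I by eventually_elim (rule inc[OF that])
    then show "AE a in q.law. (\<integral>\<^sup>+b. ennreal ((f a - f b)\<^sup>2) \<partial>q.law)
       \<le> (\<integral>\<^sup>+b. ennreal (4 * R) * (?K a b + ?K b a) \<partial>q.law)"
      using AE_I by (auto elim!: eventually_mono intro!: nn_integral_mono_AE)
  qed
  also have "\<dots> = ennreal (4 * R) * ((\<integral>\<^sup>+a. \<integral>\<^sup>+b. ?K a b \<partial>q.law \<partial>q.law) + (\<integral>\<^sup>+a. \<integral>\<^sup>+b. ?K b a \<partial>q.law \<partial>q.law))"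
  proof -
    have [measurable]: "(\<lambda>(a,b). ?K a b) \<in> borel_measurable (borel \<Otimes>\<^sub>M borel)"
      unfolding Kab indicator_def greaterThanAtMost_iff by measurable
    show ?thesis by (simp add: nn_integral_cmult nn_integral_add)
  qed
  also have "\<dots> = 2 * (ennreal (4 * R) * ?H)"
    unfolding K2 K3 by (simp add: mult_2[symmetric] mult.left_commute)
  also have "?H
      \<le> (\<integral>\<^sup>+v. ennreal (4 * R) * (indicator I v * ennreal (entropy_gap (p (S v)) (q v))) \<partial>lborel)"
  proof (rule nn_integral_mono)
    fix y
    show "ennreal (G y) * (ennreal (1 - G y) * h y) \<le> ennreal (4 * R) * (indicator I y * ennreal (entropy_gap (p (S y)) (q y)))"
    proof (cases "y \<in> I")
      case True
      define P where "P = p (S y)"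
      have P: "0 < P" using p_S_pos[OF True] by (simp add: P_def)
      have G01: "0 < G y" "G y < 1" using True by (auto simp: I_def)
      have "G y * (1 - G y) \<le> min (G y) (1 - G y)"
        using G01 by (auto simp: min_def mult_left_le mult_left_le_one_le)
      also have "\<dots> \<le> 2 * R * P" using p_lower_bound[of "S y"] by (simp add: F_S P_def)
      finally have "G y * (1 - G y) * hellinger y \<le> 2 * R * P * hellinger y"
        by (intro mult_right_mono hellinger_nonneg)
      also have "P * hellinger y = (P - q y)\<^sup>2 / (P + q y)"
      proof -
        have "hellinger y = ((P - q y) / P)\<^sup>2 / ((P + q y) / P)"
          using P by (simp add: hellinger_def \<theta>_def P_def[symmetric] diff_divide_distrib add_divide_distrib)
        also have "\<dots> = (P - q y)\<^sup>2 / (P + q y) / P"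
          using P q.p_nonneg[of y] by (simp add: power2_eq_square)
        finally show ?thesis using P by simp
      qed
      then have "2 * R * P * hellinger y = 2 * R * ((P - q y)\<^sup>2 / (P + q y))" by (simp only: mult.assoc)
      also have "\<dots> \<le> 2 * R * (2 * entropy_gap P (q y))"
        using R_pos P q.p_nonneg by (intro mult_left_mono hellinger_le_entropy_gap) auto
      finally have "G y * (1 - G y) * hellinger y \<le> 4 * R * entropy_gap P (q y)" by simp
      then show ?thesis
        using True G01 hellinger_nonneg[of y] R_pos entropy_gap_nonneg[OF P q.p_nonneg]
        by (simp add: h_def P_def[symmetric] ennreal_mult[symmetric] ennreal_leI mult.assoc)
    qed (simp add: h_def)
  qed
  also have "\<dots> = ennreal (4 * R) * ?E"
    unfolding entropy_gap_def by (subst nn_integral_cmult) auto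
  finally have "2 * ?V
     \<le> 2 * (ennreal (4 * R) * (ennreal (4 * R) * ?E))"
    by (simp add: mult_left_mono)
  then have "?V
     \<le> (ennreal (4 * R) * (ennreal (4 * R) * ?E))"
    by (subst (asm) ennreal_mult_le_mult_iff) auto
  also have "ennreal (4 * R) * (ennreal (4 * R) * X) = ennreal (16 * R\<^sup>2) * X" for X
    using R_pos by (simp add: mult.assoc[symmetric] ennreal_mult[symmetric] power2_eq_square)
  finally show ?thesis .
qed

end

section \<open>Densities of several variables and their conditional densities\<close>

lemma atLeastAtMost_Suc: "{1..Suc k} = insert (Suc k) {1..k}"
  by auto

lemma sets_lborel_n[measurable_cong, simp]: "sets (lborel_n k) = sets (Rn k)"
  unfolding lborel_n_def Rn_def by (intro sets_PiM_cong) auto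

lemma space_lborel_n: "space (lborel_n k) = space (Rn k)"
  by (rule sets_eq_imp_space_eq) simp

lemma measurable_append[measurable]:
  assumes "f \<in> measurable M (Rn k)" "g \<in> borel_measurable M"
  shows "(\<lambda>x. (f x)(Suc k := g x)) \<in> measurable M (Rn (Suc k))"
  using assms unfolding Rn_def by (intro measurable_fun_upd[where J="{1..k}"]) auto

lemma measurable_fibre:
  assumes "f \<in> borel_measurable (Rn (Suc k))" "y \<in> space (Rn k)"
  shows "(\<lambda>v. f (y(Suc k := v))) \<in> borel_measurable borel"
  by (rule measurable_compose[OF measurable_append assms(1)]) (use assms(2) in auto)

lemma append_in_space: "y \<in> space (Rn k) \<Longrightarrow> y(Suc k := v) \<in> space (Rn (Suc k))"
  by (auto simp: Rn_def space_PiM PiE_def extensional_def)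

lemma measurable_coordinate: "i \<in> {1..k} \<Longrightarrow> (\<lambda>y. y i) \<in> borel_measurable (Rn k)"
  unfolding Rn_def by measurable

definition initial :: "nat \<Rightarrow> (nat \<Rightarrow> real) \<Rightarrow> nat \<Rightarrow> real" where
  "initial k y = restrict y {1..k}"

lemma measurable_initial[measurable]: "j \<le> k \<Longrightarrow> initial j \<in> measurable (Rn k) (Rn j)"
  unfolding Rn_def initial_def by (rule measurable_restrict_subset) auto

lemma measurable_last_coordinate: "(\<lambda>y. y (Suc k)) \<in> borel_measurable (Rn (Suc k))"
  by (rule measurable_coordinate) simp

lemma initial_self: "y \<in> space (Rn k) \<Longrightarrow> initial k y = y"
  by (auto simp: Rn_def space_PiM PiE_restrict initial_def)

lemma initial_append: "j \<le> k \<Longrightarrow> initial j (y(Suc k := v)) = initial j y"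
  by (auto simp: restrict_def initial_def)

lemma nn_integral_lborel_n_Suc:
  assumes "f \<in> borel_measurable (Rn (Suc k))"
  shows "(\<integral>\<^sup>+y. f y \<partial>lborel_n (Suc k)) = (\<integral>\<^sup>+y. \<integral>\<^sup>+v. f (y(Suc k := v)) \<partial>lborel \<partial>lborel_n k)"
proof -
  interpret product_sigma_finite "\<lambda>_. lborel :: real measure" by standard
  have eq: "sets (\<Pi>\<^sub>M i\<in>insert (Suc k) {1..k}. lborel) = sets (Rn (Suc k))"
    unfolding Rn_def atLeastAtMost_Suc by (intro sets_PiM_cong) auto
  have "f \<in> borel_measurable (\<Pi>\<^sub>M i\<in>insert (Suc k) {1..k}. lborel)"
    unfolding measurable_cong_sets[OF eq refl] by (rule assms)
  then show ?thesis
    unfolding lborel_n_def atLeastAtMost_Suc by (intro product_nn_integral_insert) auto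
qed

interpretation lborel_n: sigma_finite_measure "lborel_n k" for k
proof -
  interpret product_sigma_finite "\<lambda>_. lborel :: real measure" by standard
  show "sigma_finite_measure (lborel_n k)" unfolding lborel_n_def by (intro sigma_finite) auto
qed

text \<open>\<open>N k\<close> is the joint density of the first \<open>k\<close> coordinates. A density may have infinite integral over some fibres, so the
marginalization identity holds almost everywhere only; where \<open>N k\<close> is positive it is required at every
point, which makes the conditional densities probability densities there.\<close>

locale density_chain =
  fixes N :: "nat \<Rightarrow> (nat \<Rightarrow> real) \<Rightarrow> real" and n :: nat and R :: real
  assumes N_measurable[measurable]: "k \<le> n \<Longrightarrow> N k \<in> borel_measurable (Rn k)"
    and N_nonneg: "0 \<le> N k y"
    and N_support: "k < n \<Longrightarrow> y \<in> space (Rn k) \<Longrightarrow> v \<notin> {-R..R} \<Longrightarrow> N (Suc k) (y(Suc k := v)) = 0"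
    and N_0: "y \<in> space (Rn 0) \<Longrightarrow> N 0 y = 1"
    and N_fibre: "k < n \<Longrightarrow> AE y in lborel_n k. (\<integral>\<^sup>+v. ennreal (N (Suc k) (y(Suc k := v))) \<partial>lborel) = ennreal (N k y)"
    and N_fibre_pos: "k < n \<Longrightarrow> y \<in> space (Rn k) \<Longrightarrow> 0 < N k y \<Longrightarrow>
      (\<integral>\<^sup>+v. ennreal (N (Suc k) (y(Suc k := v))) \<partial>lborel) = ennreal (N k y)"
begin

definition marg :: "nat \<Rightarrow> (nat \<Rightarrow> real) measure" where
  "marg k = density (lborel_n k) (\<lambda>y. ennreal (N k y))"

definition cond :: "nat \<Rightarrow> (nat \<Rightarrow> real) \<Rightarrow> real \<Rightarrow> real" where
  "cond k y v = N (Suc k) (y(Suc k := v)) / N k y"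

definition cond_mean :: "nat \<Rightarrow> (nat \<Rightarrow> real) \<Rightarrow> real" where
  "cond_mean k y = (\<integral>v. cond k y v * v \<partial>lborel)"

lemma sets_marg[measurable_cong, simp]: "sets (marg k) = sets (Rn k)"
  by (simp add: marg_def)

lemma space_marg: "space (marg k) = space (Rn k)"
  by (rule sets_eq_imp_space_eq) simp

lemma cond_measurable[measurable]: "k < n \<Longrightarrow> (\<lambda>(y, v). cond k y v) \<in> borel_measurable (Rn k \<Otimes>\<^sub>M borel)"
  unfolding cond_def using N_measurable[of "Suc k"] by measurable

lemma cond_mean_measurable[measurable]: "k < n \<Longrightarrow> cond_mean k \<in> borel_measurable (Rn k)"
  unfolding cond_mean_def by measurable

lemma cond_density:
  assumes k: "k < n" and y: "y \<in> space (Rn k)" "0 < N k y"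
  shows "bounded_density (cond k y) R"
proof
  show "cond k y \<in> borel_measurable borel"
    using measurable_Pair2[OF cond_measurable[OF k] y(1)] by simp
  show "0 \<le> cond k y v" for v by (simp add: cond_def N_nonneg)
  show "cond k y v = 0" if "v \<notin> {-R..R}" for v by (simp add: cond_def N_support[OF k y(1) that])
  have [measurable]: "(\<lambda>v. N (Suc k) (y(Suc k := v))) \<in> borel_measurable borel"
    using N_measurable[of "Suc k"] k y(1) by (intro measurable_fibre[OF _ y(1)]) auto
  show "(\<integral>\<^sup>+v. ennreal (cond k y v) \<partial>lborel) = 1"
    using y(2) N_fibre_pos[OF k y]
    by (simp add: cond_def divide_ennreal[symmetric] N_nonneg nn_integral_divide)
qed

lemma AE_marg: "k \<le> n \<Longrightarrow> Measurable.pred (Rn k) P \<Longrightarrow>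
    (AE y in marg k. P y) \<longleftrightarrow> (AE y in lborel_n k. 0 < N k y \<longrightarrow> P y)"
  unfolding marg_def by (subst AE_density) auto

lemma AE_N_pos: "k \<le> n \<Longrightarrow> AE y in marg k. 0 < N k y"
  by (subst AE_marg) auto

lemma AE_cond_density:
  assumes k: "k < n"
  shows "AE y in marg k. y \<in> space (Rn k) \<and> 0 < N k y \<and> bounded_density (cond k y) R"
  using AE_N_pos[OF less_imp_le[OF k]] AE_space[of "marg k"]
  by eventually_elim (auto simp: space_marg intro: cond_density[OF k])

lemma nn_integral_marg: "k \<le> n \<Longrightarrow> \<phi> \<in> borel_measurable (Rn k) \<Longrightarrow>
    (\<integral>\<^sup>+y. \<phi> y \<partial>marg k) = (\<integral>\<^sup>+y. ennreal (N k y) * \<phi> y \<partial>lborel_n k)"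
  unfolding marg_def by (subst nn_integral_density) auto

lemma nn_integral_marg_Suc:
  assumes k: "k < n" and [measurable]: "\<phi> \<in> borel_measurable (Rn (Suc k))"
  shows "(\<integral>\<^sup>+y. \<phi> y \<partial>marg (Suc k)) = (\<integral>\<^sup>+y. \<integral>\<^sup>+v. ennreal (cond k y v) * \<phi> (y(Suc k := v)) \<partial>lborel \<partial>marg k)"
proof -
  let ?A = "\<lambda>y. \<integral>\<^sup>+v. ennreal (N (Suc k) (y(Suc k := v))) * \<phi> (y(Suc k := v)) \<partial>lborel"
  let ?B = "\<lambda>y. \<integral>\<^sup>+v. ennreal (cond k y v) * \<phi> (y(Suc k := v)) \<partial>lborel"
  have [measurable]: "N (Suc k) \<in> borel_measurable (Rn (Suc k))" "N k \<in> borel_measurable (Rn k)" using k by auto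
  have [measurable]: "(\<lambda>(y, v). cond k y v) \<in> borel_measurable (Rn k \<Otimes>\<^sub>M borel)" using k by simp
  have "(\<integral>\<^sup>+y. \<phi> y \<partial>marg (Suc k)) = (\<integral>\<^sup>+y. ennreal (N (Suc k) y) * \<phi> y \<partial>lborel_n (Suc k))"
    using k by (intro nn_integral_marg) auto
  also have "\<dots> = (\<integral>\<^sup>+y. ?A y \<partial>lborel_n k)"
    by (rule nn_integral_lborel_n_Suc) measurable
  also have "\<dots> = (\<integral>\<^sup>+y. ennreal (N k y) * ?B y \<partial>lborel_n k)"
  proof (rule nn_integral_cong_AE)
    show "AE y in lborel_n k. ?A y =
      ennreal (N k y) * ?B y"
      using N_fibre[OF k] AE_space
    proof eventually_elim
      case (elim y)
      note * = elim(1)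
      note elim(2)
      then have y[measurable]: "y \<in> space (Rn k)" by (simp add: space_lborel_n)
      have [measurable]: "(\<lambda>v. cond k y v) \<in> borel_measurable borel"
        using measurable_Pair2[OF cond_measurable[OF k] y(1)] by simp
      have [measurable]: "(\<lambda>v. N (Suc k) (y(Suc k := v))) \<in> borel_measurable borel" "(\<lambda>v. \<phi> (y(Suc k := v))) \<in> borel_measurable borel"
        by (rule measurable_fibre[OF _ y], measurable)+
      show ?case
      proof (cases "N k y = 0")
        case True
        then have "AE v in lborel. ennreal (N (Suc k) (y(Suc k := v))) = 0"
          using * by (simp add: nn_integral_0_iff_AE)
        then have "?A y = (\<integral>\<^sup>+(v::real). 0 \<partial>lborel)"
          by (intro nn_integral_cong_AE, eventually_elim) simp
        then show ?thesis using True by simp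
      next
        case False
        have eq: "ennreal (N (Suc k) (y(Suc k := v))) = ennreal (N k y) * ennreal (cond k y v)" for v
          using False by (subst ennreal_mult[symmetric]) (simp_all add: cond_def N_nonneg)
        show ?thesis unfolding eq mult.assoc by (rule nn_integral_cmult) measurable
      qed
    qed
  qed
  also have "\<dots> = (\<integral>\<^sup>+y. ?B y \<partial>marg k)"
    using k by (intro nn_integral_marg[symmetric]) auto
  finally show ?thesis .
qed

lemma emeasure_marg: "k \<le> n \<Longrightarrow> emeasure (marg k) (space (marg k)) = 1"
proof (induction k)
  case 0
  interpret product_sigma_finite "\<lambda>_. lborel :: real measure" by standard
  have "(\<integral>\<^sup>+y. 1 \<partial>marg 0) = (\<integral>\<^sup>+y. ennreal (N 0 y) * 1 \<partial>lborel_n 0)"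
    by (rule nn_integral_marg) auto
  also have "\<dots> = (\<integral>\<^sup>+y. 1 \<partial>lborel_n 0)"
    by (intro nn_integral_cong) (simp add: space_lborel_n N_0)
  also have "\<dots> = 1"
    unfolding lborel_n_def using nn_integral_empty[of "\<lambda>_. 1"] by (simp del: nn_integral_const)
  finally show ?case by simp
next
  case (Suc k)
  then have k: "k < n" by simp
  have "(\<integral>\<^sup>+y. 1 \<partial>marg (Suc k)) = (\<integral>\<^sup>+y. \<integral>\<^sup>+v. ennreal (cond k y v) * 1 \<partial>lborel \<partial>marg k)"
    by (rule nn_integral_marg_Suc[OF k]) auto
  also have "\<dots> = (\<integral>\<^sup>+y. 1 \<partial>marg k)"
    using AE_cond_density[OF k] by (intro nn_integral_cong_AE, eventually_elim) (auto simp: bounded_density.p_total)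
  finally show ?case using Suc by simp
qed

lemma prob_space_marg: "k \<le> n \<Longrightarrow> prob_space (marg k)"
  by (intro prob_spaceI emeasure_marg)

lemma nn_integral_marg_initial:
  assumes jk: "j \<le> k" "k \<le> n" and [measurable]: "\<phi> \<in> borel_measurable (Rn j)"
  shows "(\<integral>\<^sup>+y. \<phi> (initial j y) \<partial>marg k) = (\<integral>\<^sup>+y. \<phi> y \<partial>marg j)"
  using jk
proof (induction k rule: dec_induct)
  case base
  show ?case by (intro nn_integral_cong) (simp add: space_marg initial_self)
next
  case (step k)
  then have k: "k < n" "j \<le> k" by auto
  have [measurable]: "(\<lambda>y. \<phi> (initial j y)) \<in> borel_measurable (Rn (Suc k))"
    using measurable_compose[OF measurable_initial[of j "Suc k"] assms(3)] k by simp
  have "(\<integral>\<^sup>+y. \<phi> (initial j y) \<partial>marg (Suc k)) =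
     (\<integral>\<^sup>+y. \<integral>\<^sup>+v. ennreal (cond k y v) * \<phi> (initial j (y(Suc k := v))) \<partial>lborel \<partial>marg k)"
    by (rule nn_integral_marg_Suc[OF k(1)]) measurable
  also have "\<dots> = (\<integral>\<^sup>+y. \<phi> (initial j y) \<partial>marg k)"
    using AE_cond_density[OF k(1)]
  proof (intro nn_integral_cong_AE, eventually_elim)
    fix y assume "y \<in> space (Rn k) \<and> 0 < N k y \<and> bounded_density (cond k y) R"
    then interpret bounded_density "cond k y" R by simp
    show "(\<integral>\<^sup>+v. ennreal (cond k y v) * \<phi> (initial j (y(Suc k := v))) \<partial>lborel) = \<phi> (initial j y)"
      using k(2) by (simp add: initial_append nn_integral_multc p_total)
  qed
  also have "\<dots> = (\<integral>\<^sup>+y. \<phi> y \<partial>marg j)" using step by simp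
  finally show ?case .
qed

lemma distr_marg_initial:
  assumes "j \<le> k" "k \<le> n"
  shows "distr (marg k) (Rn j) (initial j) = marg j"
proof (rule measure_eqI)
  fix A assume "A \<in> sets (distr (marg k) (Rn j) (initial j))"
  then have A[measurable]: "A \<in> sets (Rn j)" by simp
  have [measurable]: "initial j \<in> measurable (marg k) (Rn j)"
    using measurable_initial[OF assms(1)] by simp
  have "emeasure (distr (marg k) (Rn j) (initial j)) A = (\<integral>\<^sup>+y. indicator A (initial j y) \<partial>marg k)"
    by (subst nn_integral_indicator[symmetric], simp, subst nn_integral_distr) auto
  also have "\<dots> = (\<integral>\<^sup>+y. indicator A y \<partial>marg j)"
    by (rule nn_integral_marg_initial[OF assms]) measurable
  finally show "emeasure (distr (marg k) (Rn j) (initial j)) A = emeasure (marg j) A"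
    by simp
qed simp

lemma AE_marg_initial:
  assumes "j \<le> k" "k \<le> n" "AE y in marg j. P y"
  shows "AE y in marg k. P (initial j y)"
proof -
  have m: "initial j \<in> measurable (marg k) (Rn j)"
    using measurable_initial[OF assms(1)] by simp
  show ?thesis by (rule AE_distrD[OF m]) (unfold distr_marg_initial[OF assms(1,2)], fact assms(3))
qed

lemma AE_marg_Suc:
  assumes k: "k < n" and P: "Measurable.pred (Rn (Suc k)) P"
    and AE: "AE y in marg k. AE v in lborel. 0 < cond k y v \<longrightarrow> P (y(Suc k := v))"
  shows "AE y in marg (Suc k). P y"
proof -
  define \<phi> where "\<phi> y = (if P y then 0 else 1 :: ennreal)" for y
  have [measurable]: "\<phi> \<in> borel_measurable (Rn (Suc k))" unfolding \<phi>_def using P by measurable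
  have "(\<integral>\<^sup>+y. \<phi> y \<partial>marg (Suc k)) = (\<integral>\<^sup>+y. \<integral>\<^sup>+v. ennreal (cond k y v) * \<phi> (y(Suc k := v)) \<partial>lborel \<partial>marg k)"
    by (rule nn_integral_marg_Suc[OF k]) measurable
  also have "\<dots> = (\<integral>\<^sup>+y. 0 \<partial>marg k)"
    using AE
  proof (intro nn_integral_cong_AE, eventually_elim)
    fix y assume "AE v in lborel. 0 < cond k y v \<longrightarrow> P (y(Suc k := v))"
    then have "(\<integral>\<^sup>+v. ennreal (cond k y v) * \<phi> (y(Suc k := v)) \<partial>lborel) = (\<integral>\<^sup>+(v::real). 0 \<partial>lborel)"
      by (intro nn_integral_cong_AE, eventually_elim) (auto simp: \<phi>_def ennreal_neg not_less)
    then show "(\<integral>\<^sup>+v. ennreal (cond k y v) * \<phi> (y(Suc k := v)) \<partial>lborel) = 0" by simp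
  qed
  finally have "AE y in marg (Suc k). \<phi> y = 0" by (simp add: nn_integral_0_iff_AE)
  then show ?thesis by eventually_elim (auto simp: \<phi>_def split: if_splits)
qed

lemma AE_marg_range:
  assumes k: "k < n"
  shows "AE y in marg (Suc k). y (Suc k) \<in> {-R..R}"
proof (rule AE_marg_Suc[OF k])
  show "AE y in marg k. AE v in lborel. 0 < cond k y v \<longrightarrow> (y(Suc k := v)) (Suc k) \<in> {-R..R}"
    using AE_cond_density[OF k]
  proof eventually_elim
    case (elim y)
    then interpret bounded_density "cond k y" R by simp
    show ?case
    proof (intro AE_I2 impI)
      fix v assume "0 < cond k y v"
      then show "(y(Suc k := v)) (Suc k) \<in> {-R..R}" using p_support[of v] by (cases "v \<in> {-R..R}") auto
    qed
  qed
  note [measurable] = measurable_last_coordinate[of k]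
  show "Measurable.pred (Rn (Suc k)) (\<lambda>y. y (Suc k) \<in> {-R..R})" by measurable
qed

end

section \<open>Conditional expectations, and marginals of log-concave densities\<close>

context density_chain
begin

lemma nn_integral_cond_mean:
  assumes k: "k < n" and y: "y \<in> space (Rn k)" "0 < N k y"
  shows "(\<integral>\<^sup>+v. ennreal (cond k y v) * ennreal (v + R) \<partial>lborel) = ennreal (cond_mean k y + R)"
    and "\<bar>cond_mean k y\<bar> \<le> R"
proof -
  interpret bounded_density "cond k y" R by (rule cond_density[OF k y])
  have mean: "cond_mean k y = (\<integral>v. v \<partial>law)" unfolding cond_mean_def by (subst integral_law) auto
  have i: "integrable law (\<lambda>v. v)"
    by (rule law.integrable_const_bound[of _ R]) (use AE_law_range in \<open>eventually_elim, auto\<close>)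
  have "(\<integral>\<^sup>+v. ennreal (cond k y v) * ennreal (v + R) \<partial>lborel) = (\<integral>\<^sup>+v. ennreal (v + R) \<partial>law)"
    by (rule nn_integral_law[symmetric]) auto
  also have "\<dots> = ennreal (\<integral>v. v + R \<partial>law)"
    using i AE_law_range by (intro nn_integral_eq_integral) (auto elim!: eventually_mono)
  also have "(\<integral>v. v + R \<partial>law) = cond_mean k y + R"
    using i law.prob_space by (simp add: mean)
  finally show "(\<integral>\<^sup>+v. ennreal (cond k y v) * ennreal (v + R) \<partial>lborel) = ennreal (cond_mean k y + R)" .
  have "\<bar>\<integral>v. v \<partial>law\<bar> \<le> (\<integral>v. R \<partial>law)"
  proof (rule order_trans[OF integral_abs_bound integral_mono_AE])
    show "AE v in law. \<bar>v\<bar> \<le> R" using AE_law_range by eventually_elim auto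
  qed (use i in auto)
  then show "\<bar>cond_mean k y\<bar> \<le> R" using law.prob_space by (simp add: mean)
qed

lemma past_eq: "past (marg n) (\<lambda>x. x) (Suc k) = vimage_algebra (space (Rn n)) (initial k) (Rn k)"
  unfolding past_def Rn_def[of k] initial_def[abs_def] atLeastLessThanSuc_atLeastAtMost space_marg ..

text \<open>The conditional expectation is the mean of the conditional density. Adding \<open>R\<close> makes the coordinate nonnegative,
and then the defining identity of the conditional expectation is an instance of \<open>nn_integral_marg_Suc\<close>.\<close>

lemma real_cond_exp_marg:
  assumes k: "k < n"
  shows "AE y in marg n. real_cond_exp (marg n) (past (marg n) (\<lambda>x. x) (Suc k)) (\<lambda>x. x (Suc k)) y = cond_mean k (initial k y)"
proof -
  interpret prob_space "marg n" by (rule prob_space_marg) simp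
  interpret A: finite_measure_subalgebra "marg n" "past (marg n) (\<lambda>x. x) (Suc k)"
    by unfold_locales (rule subalgebra_past[of _ _ n], use k in auto)
  define f where "f = (\<lambda>y::nat \<Rightarrow> real. y (Suc k))"
  define g where "g = (\<lambda>y. cond_mean k (initial k y))"
  have pk[measurable]: "initial k \<in> measurable (Rn n) (Rn k)" "initial (Suc k) \<in> measurable (Rn n) (Rn (Suc k))"
    "initial k \<in> measurable (Rn (Suc k)) (Rn k)"
    using k by auto
  have [measurable]: "cond_mean k \<in> borel_measurable (Rn k)" using k by simp
  have f[measurable]: "f \<in> borel_measurable (Rn n)" unfolding f_def by (rule measurable_coordinate) (use k in auto)
  have f'[measurable]: "f \<in> borel_measurable (Rn (Suc k))" unfolding f_def by (rule measurable_coordinate) auto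
  have [measurable]: "g \<in> borel_measurable (Rn n)" unfolding g_def by measurable
  have fR: "AE y in marg n. \<bar>f y\<bar> \<le> R"
  proof -
    have "AE y in marg n. initial (Suc k) y (Suc k) \<in> {-R..R}"
      using k by (intro AE_marg_initial[OF _ _ AE_marg_range]) auto
    then show ?thesis by eventually_elim (auto simp: f_def initial_def)
  qed
  have gR: "AE y in marg n. \<bar>g y\<bar> \<le> R"
    unfolding g_def
  proof (rule AE_marg_initial)
    show "AE y in marg k. \<bar>cond_mean k y\<bar> \<le> R"
      using AE_cond_density[OF k] by eventually_elim (auto intro: nn_integral_cond_mean[OF k])
  qed (use k in auto)
  have fi: "integrable (marg n) f" by (rule integrable_const_bound[of _ R]) (use fR in auto)
  have gi: "integrable (marg n) g" by (rule integrable_const_bound[of _ R]) (use gR in auto)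
  have "AE y in marg n. real_cond_exp (marg n) (past (marg n) (\<lambda>x. x) (Suc k)) f y = g y"
  proof (rule A.real_cond_exp_charact[OF _ fi gi])
    show "g \<in> borel_measurable (past (marg n) (\<lambda>x. x) (Suc k))"
      unfolding past_eq g_def
      by (rule measurable_compose[OF measurable_vimage_algebra1]) (use measurable_space[OF pk(1)] in auto)
    fix S assume "S \<in> sets (past (marg n) (\<lambda>x. x) (Suc k))"
    then obtain C where C[measurable]: "C \<in> sets (Rn k)" and S: "S = initial k -` C \<inter> space (Rn n)"
      unfolding past_eq using measurable_space[OF pk(1)] by (subst (asm) sets_vimage_algebra2) auto
    have [measurable]: "S \<in> sets (Rn n)" unfolding S by measurable
    have shift: "(\<integral>y\<in>S. h y \<partial>marg n) = enn2real (\<integral>\<^sup>+y. indicator C (initial k y) * ennreal (h y + R) \<partial>marg n) - R * measure (marg n) S"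
      if h: "integrable (marg n) h" "AE y in marg n. \<bar>h y\<bar> \<le> R" for h
    proof -
      have [measurable]: "h \<in> borel_measurable (Rn n)" using h(1) by auto
      have hi: "integrable (marg n) (\<lambda>y. indicator S y * h y)" 
        using integrable_mult_indicator[OF _ h(1), of S] by simp
      have si: "integrable (marg n) (\<lambda>y. indicator S y * R)" by (auto intro!: integrable_real_indicator simp: emeasure_eq_measure)
      have "(\<integral>y. indicator S y * (h y + R) \<partial>marg n) = (\<integral>y. indicator S y * h y \<partial>marg n) + (\<integral>y. indicator S y * R \<partial>marg n)"
        unfolding distrib_left by (rule Bochner_Integration.integral_add[OF hi si])
      also have "(\<integral>y. indicator S y * R \<partial>marg n) = R * measure (marg n) S" by simp
      also have "(\<integral>y. indicator S y * (h y + R) \<partial>marg n) = enn2real (\<integral>\<^sup>+y. ennreal (indicator S y * (h y + R)) \<partial>marg n)"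
        using h(2) by (intro integral_eq_nn_integral) (auto elim!: eventually_mono simp: indicator_def)
      also have "(\<integral>\<^sup>+y. ennreal (indicator S y * (h y + R)) \<partial>marg n) = (\<integral>\<^sup>+y. indicator C (initial k y) * ennreal (h y + R) \<partial>marg n)"
        by (intro nn_integral_cong) (auto simp: S indicator_def space_marg)
      finally show ?thesis by (simp add: set_lebesgue_integral_def)
    qed
    have "(\<integral>\<^sup>+y. indicator C (initial k y) * ennreal (f y + R) \<partial>marg n)
        = (\<integral>\<^sup>+y. indicator C (initial k (initial (Suc k) y)) * ennreal (f (initial (Suc k) y) + R) \<partial>marg n)"
      by (intro nn_integral_cong) (auto simp: f_def initial_def intro!: arg_cong[where f="\<lambda>x. indicator C x * _"])
    also have "\<dots> = (\<integral>\<^sup>+y. indicator C (initial k y) * ennreal (f y + R) \<partial>marg (Suc k))"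
      using k by (intro nn_integral_marg_initial) auto
    also have "\<dots> = (\<integral>\<^sup>+y. \<integral>\<^sup>+v. ennreal (cond k y v) * (indicator C (initial k (y(Suc k := v))) * ennreal (f (y(Suc k := v)) + R)) \<partial>lborel \<partial>marg k)"
      by (rule nn_integral_marg_Suc[OF k]) measurable
    also have "\<dots> = (\<integral>\<^sup>+y. indicator C y * ennreal (cond_mean k y + R) \<partial>marg k)"
      using AE_cond_density[OF k]
    proof (intro nn_integral_cong_AE, eventually_elim)
      fix y assume *: "y \<in> space (Rn k) \<and> 0 < N k y \<and> bounded_density (cond k y) R"
      then interpret bounded_density "cond k y" R by simp
      have "(\<integral>\<^sup>+v. ennreal (cond k y v) * (indicator C (initial k (y(Suc k := v))) * ennreal (f (y(Suc k := v)) + R)) \<partial>lborel)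
        = (\<integral>\<^sup>+v. indicator C y * (ennreal (cond k y v) * ennreal (v + R)) \<partial>lborel)"
        using * by (intro nn_integral_cong) (simp add: initial_append initial_self f_def mult.left_commute)
      also have "\<dots> = indicator C y * ennreal (cond_mean k y + R)"
        using * by (simp add: nn_integral_cmult nn_integral_cond_mean(1)[OF k])
      finally show "(\<integral>\<^sup>+v. ennreal (cond k y v) * (indicator C (initial k (y(Suc k := v))) * ennreal (f (y(Suc k := v)) + R)) \<partial>lborel)
        = indicator C y * ennreal (cond_mean k y + R)" .
    qed
    also have "\<dots> = (\<integral>\<^sup>+y. indicator C (initial k y) * ennreal (g y + R) \<partial>marg n)"
      unfolding g_def using k by (intro nn_integral_marg_initial[symmetric]) auto
    finally show "(\<integral>y\<in>S. f y \<partial>marg n) = (\<integral>y\<in>S. g y \<partial>marg n)"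
      unfolding shift[OF fi fR] shift[OF gi gR] by simp
  qed
  then show ?thesis by (simp add: f_def g_def)
qed

lemma AE_recentered:
  "AE y in marg n. \<forall>k<n. recentered n (marg n) (\<lambda>x. x) y (Suc k) = y (Suc k) - cond_mean k (initial k y)"
proof -
  have "AE y in marg n. \<forall>k\<in>{..<n}. real_cond_exp (marg n) (past (marg n) (\<lambda>x. x) (Suc k)) (\<lambda>x. x (Suc k)) y = cond_mean k (initial k y)"
    by (intro AE_finite_allI real_cond_exp_marg) auto
  then show ?thesis by eventually_elim (auto simp: recentered_def)
qed

end

text \<open>The coordinates \<open>n, n - 1, \<dots>\<close> are integrated out successively. An infinite integral is replaced by \<open>0\<close>; for an
integrable density this happens on a null set, and for a log-concave density with bounded support it never happens.\<close>

primrec integrate_out :: "nat \<Rightarrow> ((nat \<Rightarrow> real) \<Rightarrow> real) \<Rightarrow> nat \<Rightarrow> (nat \<Rightarrow> real) \<Rightarrow> real" where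
  "integrate_out n f 0 = f"
| "integrate_out n f (Suc d) = (\<lambda>y. enn2real (\<integral>\<^sup>+v. ennreal (integrate_out n f d (y(n - d := v))) \<partial>lborel))"

definition marginal :: "nat \<Rightarrow> ((nat \<Rightarrow> real) \<Rightarrow> real) \<Rightarrow> nat \<Rightarrow> (nat \<Rightarrow> real) \<Rightarrow> real" where
  "marginal n f k = integrate_out n f (n - k)"

lemma marginal_self: "marginal n f n = f"
  by (simp add: marginal_def)

lemma marginal_step:
  assumes "k < n"
  shows "marginal n f k y = enn2real (\<integral>\<^sup>+v. ennreal (marginal n f (Suc k) (y(Suc k := v))) \<partial>lborel)"
proof -
  have "n - k = Suc (n - Suc k)" "n - (n - Suc k) = Suc k" using assms by auto
  then show ?thesis by (simp add: marginal_def)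
qed

lemma marginal_nonneg: "(\<And>y. 0 \<le> f y) \<Longrightarrow> 0 \<le> marginal n f k y"
  unfolding marginal_def by (cases "n - k") auto

lemma marginal_measurable:
  assumes "f \<in> borel_measurable (Rn n)" "k \<le> n"
  shows "marginal n f k \<in> borel_measurable (Rn k)"
  using assms(2)
proof (induction k rule: inc_induct)
  case base
  then show ?case using assms(1) by (simp add: marginal_self)
next
  case (step k)
  note [measurable] = step.IH
  show ?case unfolding marginal_step[OF step.hyps(2), abs_def] by measurable
qed

lemma marginal_support:
  fixes f :: "(nat \<Rightarrow> real) \<Rightarrow> real" and y :: "nat \<Rightarrow> real" and R :: real
  assumes f: "\<And>(y::nat \<Rightarrow> real) i. i \<in> {1..n} \<Longrightarrow> y i \<notin> {-R..R} \<Longrightarrow> f y = 0" and "k \<le> n"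
    and i: "i \<in> {1..k}" and y: "y i \<notin> {-R..R}"
  shows "marginal n f k y = 0"
proof -
  have "\<forall>y::nat \<Rightarrow> real. i \<in> {1..k} \<longrightarrow> y i \<notin> {-R..R} \<longrightarrow> marginal n f k y = 0"
    using assms(2)
  proof (induction k rule: inc_induct)
    case base
    then show ?case using f by (simp add: marginal_self)
  next
    case (step k)
    show ?case
    proof (intro allI impI)
      fix y :: "nat \<Rightarrow> real" assume "i \<in> {1..k}" "y i \<notin> {-R..R}"
      then have "marginal n f (Suc k) (y(Suc k := v)) = 0" for v
        using step.IH[THEN spec, of "y(Suc k := v)"] by (auto simp: fun_upd_def)
      then show "marginal n f k y = 0" by (simp add: marginal_step[OF step.hyps(2)])
    qed
  qed
  then show ?thesis using i y by blast
qed

lemma density_chain_marginal: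
  fixes f :: "(nat \<Rightarrow> real) \<Rightarrow> real" and R :: real
  assumes f[measurable]: "f \<in> borel_measurable (Rn n)" and nonneg: "\<And>y. 0 \<le> f y"
    and supp: "\<And>(y::nat \<Rightarrow> real) i. i \<in> {1..n} \<Longrightarrow> y i \<notin> {-R..R} \<Longrightarrow> f y = 0"
    and total: "(\<integral>\<^sup>+y. ennreal (f y) \<partial>lborel_n n) = 1"
  shows "density_chain (marginal n f) n R"
proof -
  let ?N = "marginal n f"
  note [measurable] = marginal_measurable[OF f]
  have fibre: "AE y in lborel_n k. (\<integral>\<^sup>+v. ennreal (?N (Suc k) (y(Suc k := v))) \<partial>lborel) = ennreal (?N k y)"
    if k: "k < n" and tot: "(\<integral>\<^sup>+y. ennreal (?N (Suc k) y) \<partial>lborel_n (Suc k)) = 1" for k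
  proof -
    have [measurable]: "?N (Suc k) \<in> borel_measurable (Rn (Suc k))" using k by simp
    have "(\<integral>\<^sup>+y. \<integral>\<^sup>+v. ennreal (?N (Suc k) (y(Suc k := v))) \<partial>lborel \<partial>lborel_n k) \<noteq> \<infinity>"
      using tot by (subst (asm) nn_integral_lborel_n_Suc) auto
    then have "AE y in lborel_n k. (\<integral>\<^sup>+v. ennreal (?N (Suc k) (y(Suc k := v))) \<partial>lborel) \<noteq> \<infinity>"
      by (intro nn_integral_PInf_AE) auto
    then show ?thesis by eventually_elim (simp add: marginal_step[OF k] less_top)
  qed
  have tot: "(\<integral>\<^sup>+y. ennreal (?N k y) \<partial>lborel_n k) = 1" if "k \<le> n" for k
    using that
  proof (induction k rule: inc_induct)
    case base
    then show ?case by (simp add: marginal_self total)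
  next
    case (step k)
    have [measurable]: "?N (Suc k) \<in> borel_measurable (Rn (Suc k))" using step.hyps by simp
    have "(\<integral>\<^sup>+y. ennreal (?N k y) \<partial>lborel_n k) = (\<integral>\<^sup>+y. \<integral>\<^sup>+v. ennreal (?N (Suc k) (y(Suc k := v))) \<partial>lborel \<partial>lborel_n k)"
      using fibre[OF step.hyps(2) step.IH] by (intro nn_integral_cong_AE, eventually_elim) simp
    also have "\<dots> = 1" using step.IH by (subst (asm) nn_integral_lborel_n_Suc) auto
    finally show ?case .
  qed
  show ?thesis
  proof
    show "?N k \<in> borel_measurable (Rn k)" if "k \<le> n" for k using that by measurable
    show "0 \<le> ?N k y" for k y using nonneg by (rule marginal_nonneg)
    show "?N (Suc k) (y(Suc k := v)) = 0" if "k < n" "v \<notin> {-R..R}" for k y v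
      using that by (intro marginal_support[OF supp, where k="Suc k" and i="Suc k"]) auto
    show "AE y in lborel_n k. (\<integral>\<^sup>+v. ennreal (?N (Suc k) (y(Suc k := v))) \<partial>lborel) = ennreal (?N k y)" if "k < n" for k
      by (rule fibre) (use that tot in auto)
    show "(\<integral>\<^sup>+v. ennreal (?N (Suc k) (y(Suc k := v))) \<partial>lborel) = ennreal (?N k y)"
      if "k < n" "0 < ?N k y" for k y
      using that(2) unfolding marginal_step[OF that(1)] by (auto simp: enn2real_positive_iff less_top)
    show "?N 0 y = 1" if "y \<in> space (Rn 0)" for y
    proof -
      interpret product_sigma_finite "\<lambda>_. lborel :: real measure" by standard
      have y: "y = (\<lambda>_. undefined)" using that by (simp add: Rn_def space_PiM)
      have "ennreal (?N 0 y) = (\<integral>\<^sup>+y. ennreal (?N 0 y) \<partial>lborel_n 0)"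
        unfolding lborel_n_def y using nn_integral_empty[of "\<lambda>y. ennreal (?N 0 y)"] by simp
      then show ?thesis using tot[of 0] marginal_nonneg[where f=f and n=n and k=0 and y=y, OF nonneg] by simp
    qed
  qed
qed

definition segment_point :: "nat \<Rightarrow> real \<Rightarrow> (nat \<Rightarrow> real) \<Rightarrow> (nat \<Rightarrow> real) \<Rightarrow> nat \<Rightarrow> real" where
  "segment_point k t x y = (\<lambda>i\<in>{1..k}. (1 - t) * x i + t * y i)"

lemma segment_point_append:
  "segment_point (Suc k) t (x(Suc k := u)) (y(Suc k := v)) = (segment_point k t x y)(Suc k := (1 - t) * u + t * v)"
  by (auto simp: segment_point_def restrict_def fun_eq_iff)

lemma segment_point_in_space[simp]: "segment_point k t x y \<in> space (Rn k)"
  by (auto simp: segment_point_def Rn_def space_PiM)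

lemma segment_point_measurable[measurable]:
  assumes f: "f \<in> measurable A (Rn k)" and g: "g \<in> measurable A (Rn k)"
  shows "(\<lambda>x. segment_point k t (f x) (g x)) \<in> measurable A (Rn k)"
proof -
  have "(\<lambda>x. f x i) \<in> borel_measurable A" "(\<lambda>x. g x i) \<in> borel_measurable A" if "i \<in> {1..k}" for i
    using measurable_compose[OF f measurable_coordinate[OF that]] measurable_compose[OF g measurable_coordinate[OF that]] by auto
  then show ?thesis unfolding segment_point_def Rn_def by (intro measurable_restrict) auto
qed

text \<open>Since \<open>0 powr s = 0\<close>, the inequality is trivial as soon as \<open>h\<close> vanishes at one of the two points.\<close>

definition log_concave :: "nat \<Rightarrow> ((nat \<Rightarrow> real) \<Rightarrow> real) \<Rightarrow> bool" where
  "log_concave k h \<longleftrightarrow> (\<forall>x\<in>space (Rn k). \<forall>y\<in>space (Rn k). \<forall>t. 0 < t \<longrightarrow> t < 1 \<longrightarrow>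
     h x powr (1 - t) * h y powr t \<le> h (segment_point k t x y))"

lemma log_concaveD:
  "log_concave k h \<Longrightarrow> x \<in> space (Rn k) \<Longrightarrow> y \<in> space (Rn k) \<Longrightarrow> 0 < t \<Longrightarrow> t < 1 \<Longrightarrow>
    h x powr (1 - t) * h y powr t \<le> h (segment_point k t x y)"
  by (auto simp: log_concave_def)

lemma log_concave_fibre:
  assumes "log_concave (Suc k) h" "x \<in> space (Rn k)" "y \<in> space (Rn k)" "0 < t" "t < 1"
  shows "h (x(Suc k := u)) powr (1 - t) * h (y(Suc k := v)) powr t
    \<le> h ((segment_point k t x y)(Suc k := (1 - t) * u + t * v))"
  using assms append_in_space[of x k u] append_in_space[of y k v]
  unfolding log_concave_def segment_point_append[symmetric] by blast

lemma segment_point_same: "x \<in> space (Rn k) \<Longrightarrow> segment_point k t x x = x"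
  by (rule trans[OF _ initial_self]) (auto simp: segment_point_def initial_def algebra_simps restrict_def)

lemma log_concave_fibre_quasi_concave:
  assumes h: "log_concave (Suc k) h" and nonneg: "\<And>x. 0 \<le> h x" and x: "x \<in> space (Rn k)"
    and le: "u \<le> v" "v \<le> w"
  shows "min (h (x(Suc k := u))) (h (x(Suc k := w))) \<le> h (x(Suc k := v))"
proof (cases "u < v \<and> v < w")
  case False
  then show ?thesis using le by (auto simp: min_le_iff_disj)
next
  case True
  define t where "t = (v - u) / (w - u)"
  have t: "0 < t" "t < 1" using True by (auto simp: t_def)
  have v: "v = (1 - t) * u + t * w"
  proof -
    have "t * (w - u) = v - u" using True by (simp add: t_def)
    then show ?thesis by (simp add: algebra_simps)
  qed
  define m where "m = min (h (x(Suc k := u))) (h (x(Suc k := w)))"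
  have m: "0 \<le> m" using nonneg by (simp add: m_def)
  have "m = m powr (1 - t) * m powr t" using m by (simp add: powr_add[symmetric])
  also have "\<dots> \<le> h (x(Suc k := u)) powr (1 - t) * h (x(Suc k := w)) powr t"
    using m t by (intro mult_mono powr_mono2) (auto simp: m_def)
  also have "\<dots> \<le> h (x(Suc k := v))"
    using log_concave_fibre[OF h x x t, of u w] by (simp add: segment_point_same[OF x] v)
  finally show ?thesis by (simp add: m_def)
qed

text \<open>The line through \<open>(a, ln (p a))\<close> and \<open>(c, ln (p c))\<close> lies above \<open>ln \<circ> p\<close> beyond \<open>c\<close>.\<close>

lemma log_concave_bounded:
  fixes p :: "real \<Rightarrow> real"
  assumes nonneg: "\<And>x. 0 \<le> p x" and supp: "\<And>x. x \<notin> {-R..R} \<Longrightarrow> p x = 0"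
    and lc: "\<And>u v t. 0 < t \<Longrightarrow> t < 1 \<Longrightarrow> p u powr (1 - t) * p v powr t \<le> p ((1 - t) * u + t * v)"
  obtains C where "\<And>x. p x \<le> C"
proof (cases "\<exists>a b. a < b \<and> 0 < p a \<and> 0 < p b")
  case False
  have "\<exists>C. \<forall>x. p x \<le> C"
  proof (cases "\<exists>a. 0 < p a")
    case True
    then obtain a where a: "0 < p a" by blast
    have "p x \<le> p a" for x
      using False a nonneg[of x] by (cases x a rule: linorder_cases) (metis less_le order.strict_trans2 order_refl)+
    then show ?thesis by blast
  next
    case False
    then show ?thesis by (metis not_le)
  qed
  then show ?thesis using that by blast
next
  case True
  then obtain a b where ab: "a < b" "0 < p a" "0 < p b" by blast
  define c where "c = (1 - 1/2) * a + (1/2) * b"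
  have c: "a < c" "c < b" using ab by (auto simp: c_def)
  have "0 < p a powr (1 - 1/2) * p b powr (1/2)" using ab by simp
  also have "\<dots> \<le> p c" unfolding c_def by (rule lc) auto
  finally have pc: "0 < p c" .
  have in_range: "x \<in> {-R..R}" if "0 < p x" for x using supp[of x] that by (cases "x \<in> {-R..R}") auto
  define K where "K a = exp (ln (p a) + \<bar>ln (p c) - ln (p a)\<bar> * (2 * R / \<bar>c - a\<bar>))" for a
  have beyond: "p v \<le> K a" if a: "0 < p a" and t: "c = (1 - t) * a + t * v" "0 < t" "t < 1" and ca: "c \<noteq> a" for a v t
  proof (cases "p v = 0")
    case True
    then show ?thesis by (simp add: K_def)
  next
    case False
    then have v: "0 < p v" using nonneg[of v] by simp
    have "ln (p a powr (1 - t) * p v powr t) \<le> ln (p c)"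
      using lc[OF t(2,3), of a v] a v pc unfolding t(1)[symmetric] by (subst ln_le_cancel_iff) auto
    then have "(1 - t) * ln (p a) + t * ln (p v) \<le> ln (p c)"
      using a v by (simp add: ln_mult ln_powr)
    then have "t * (ln (p v) - ln (p a)) \<le> ln (p c) - ln (p a)" by (simp add: algebra_simps)
    also have "\<dots> \<le> \<bar>ln (p c) - ln (p a)\<bar>" by simp
    finally have 1: "ln (p v) - ln (p a) \<le> \<bar>ln (p c) - ln (p a)\<bar> * (1 / t)"
      using t by (simp add: pos_le_divide_eq mult.commute)
    have "\<bar>c - a\<bar> = t * \<bar>v - a\<bar>"
    proof -
      have "c - a = t * (v - a)" using t(1) by (simp add: algebra_simps)
      then show ?thesis using t by (simp add: abs_mult)
    qed
    also have "\<dots> \<le> t * (2 * R)" using in_range[OF v] in_range[OF a] t by (intro mult_left_mono) auto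
    finally have "1 / t \<le> 2 * R / \<bar>c - a\<bar>" using t ca by (simp add: field_simps)
    then have "\<bar>ln (p c) - ln (p a)\<bar> * (1 / t) \<le> \<bar>ln (p c) - ln (p a)\<bar> * (2 * R / \<bar>c - a\<bar>)"
      by (intro mult_left_mono) auto
    with 1 have "ln (p v) \<le> ln (p a) + \<bar>ln (p c) - ln (p a)\<bar> * (2 * R / \<bar>c - a\<bar>)" by simp
    then have "exp (ln (p v)) \<le> K a" unfolding K_def by (subst exp_le_cancel_iff)
    then show ?thesis using v by simp
  qed
  have "p v \<le> max (p c) (max (K a) (K b))" for v
  proof (cases v c rule: linorder_cases)
    case less
    define t where "t = (b - c) / (b - v)"
    have "t * (b - v) = b - c" using less c by (simp add: t_def)
    then have "c = (1 - t) * b + t * v" by (simp add: algebra_simps)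
    then have "p v \<le> K b" using less c ab by (intro beyond[of b t v]) (auto simp: t_def)
    then show ?thesis by simp
  next
    case greater
    define t where "t = (c - a) / (v - a)"
    have "t * (v - a) = c - a" using greater c by (simp add: t_def)
    then have "c = (1 - t) * a + t * v" by (simp add: algebra_simps)
    then have "p v \<le> K a" using greater c ab by (intro beyond[of a t v]) (auto simp: t_def)
    then show ?thesis by simp
  qed auto
  then show ?thesis by (rule that)
qed

context
  fixes h :: "(nat \<Rightarrow> real) \<Rightarrow> real" and k :: nat and R :: real
  assumes h[measurable]: "h \<in> borel_measurable (Rn (Suc k))" and nonneg: "\<And>x. 0 \<le> h x"
    and supp: "\<And>x v. x \<in> space (Rn k) \<Longrightarrow> v \<notin> {-R..R} \<Longrightarrow> h (x(Suc k := v)) = 0"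
    and lc: "log_concave (Suc k) h"
begin

lemma log_concave_fibre_integrable:
  assumes x: "x \<in> space (Rn k)"
  shows "(\<integral>\<^sup>+v. ennreal (h (x(Suc k := v))) \<partial>lborel) < \<infinity>"
proof -
  obtain C where C: "\<And>v. h (x(Suc k := v)) \<le> C"
  proof (rule log_concave_bounded[of "\<lambda>v. h (x(Suc k := v))" R])
    show "h (x(Suc k := u)) powr (1 - t) * h (x(Suc k := v)) powr t \<le> h (x(Suc k := (1 - t) * u + t * v))"
      if "0 < t" "t < 1" for u v t
      using log_concave_fibre[OF lc x x that, of u v] by (simp add: segment_point_same[OF x])
  qed (use nonneg supp[OF x] in auto)
  have "(\<integral>\<^sup>+v. ennreal (h (x(Suc k := v))) \<partial>lborel) \<le> (\<integral>\<^sup>+v. ennreal C * indicator {-R..R} v \<partial>lborel)"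
    using supp[OF x] C by (intro nn_integral_mono) (auto simp: indicator_def intro!: ennreal_leI)
  also have "\<dots> < \<infinity>" by (auto simp: nn_integral_cmult_indicator ennreal_mult_less_top emeasure_lborel_Icc_eq)
  finally show ?thesis .
qed

text \<open>Prekopa's theorem for one integrated variable: two fibres and the fibre in between satisfy the hypothesis of the
one-dimensional inequality.\<close>

lemma log_concave_integral:
  "log_concave k (\<lambda>x. enn2real (\<integral>\<^sup>+v. ennreal (h (x(Suc k := v))) \<partial>lborel))"
  unfolding log_concave_def
proof (intro ballI allI impI)
  fix x y t assume x: "x \<in> space (Rn k)" and y: "y \<in> space (Rn k)" and t: "0 < t" "t < (1::real)"
  let ?J = "\<lambda>x. \<integral>\<^sup>+v. ennreal (h (x(Suc k := v))) \<partial>lborel"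
  have J: "?J x = ennreal (enn2real (?J x))" if "x \<in> space (Rn k)" for x
    using log_concave_fibre_integrable[OF that] by simp
  show "enn2real (?J x) powr (1 - t) * enn2real (?J y) powr t \<le> enn2real (?J (segment_point k t x y))"
  proof (cases "0 < enn2real (?J x) \<and> 0 < enn2real (?J y)")
    case False
    then have "enn2real (?J x) = 0 \<or> enn2real (?J y) = 0" by (smt (verit) enn2real_nonneg)
    then show ?thesis by auto
  next
    case True
    have "ennreal (enn2real (?J x) powr (1 - t) * enn2real (?J y) powr t) \<le> ?J (segment_point k t x y)"
    proof (rule prekopa_leindler_interval[where R=R])
      show "?J x = ennreal (enn2real (?J x))" "?J y = ennreal (enn2real (?J y))" using J x y by auto
      show "ennreal (h (x(Suc k := u)) powr (1 - t) * h (y(Suc k := v)) powr t)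
          \<le> ennreal (h ((segment_point k t x y)(Suc k := (1 - t) * u + t * v)))" for u v
        by (intro ennreal_leI log_concave_fibre[OF lc x y t])
      show "min (h (x(Suc k := u))) (h (x(Suc k := w))) \<le> h (x(Suc k := v))" if "u \<le> v" "v \<le> w" for u v w
        by (rule log_concave_fibre_quasi_concave[OF lc nonneg x that])
    qed (use True t nonneg supp x y in \<open>auto intro!: measurable_fibre[OF h] measurable_compose[OF _ measurable_ennreal]\<close>)
    then show ?thesis using J[of "segment_point k t x y"] by (metis ennreal_le_iff enn2real_nonneg segment_point_in_space)
  qed
qed

end

lemma
  fixes f :: "(nat \<Rightarrow> real) \<Rightarrow> real" and R :: real
  assumes f: "f \<in> borel_measurable (Rn n)" and nonneg: "\<And>y. 0 \<le> f y"
    and supp: "\<And>(y::nat \<Rightarrow> real) i. i \<in> {1..n} \<Longrightarrow> y i \<notin> {-R..R} \<Longrightarrow> f y = 0"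
    and lc: "log_concave n f"
  shows log_concave_marginal: "k \<le> n \<Longrightarrow> log_concave k (marginal n f k)"
    and marginal_fibre: "k < n \<Longrightarrow> x \<in> space (Rn k) \<Longrightarrow>
      (\<integral>\<^sup>+v. ennreal (marginal n f (Suc k) (x(Suc k := v))) \<partial>lborel) = ennreal (marginal n f k x)"
proof -
  have st: "marginal n f (Suc k) \<in> borel_measurable (Rn (Suc k))" "0 \<le> marginal n f (Suc k) x"
    "v \<notin> {-R..R} \<Longrightarrow> marginal n f (Suc k) (x(Suc k := v)) = 0" if "k < n" for k x v
    using that marginal_measurable[OF f, of "Suc k"] marginal_nonneg[of f n "Suc k" x, OF nonneg]
      marginal_support[OF supp, where k="Suc k" and i="Suc k" and y="x(Suc k := v)"] by auto
  show *: "log_concave k (marginal n f k)" if "k \<le> n" for k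
    using that
  proof (induction k rule: inc_induct)
    case base
    then show ?case using lc by (simp add: marginal_self)
  next
    case (step k)
    show ?case unfolding marginal_step[OF step.hyps(2), abs_def]
      using st(3)[OF step.hyps(2)]
      by (rule log_concave_integral[where R=R, OF st(1)[OF step.hyps(2)] st(2)[OF step.hyps(2)] _ step.IH])
  qed
  show "(\<integral>\<^sup>+v. ennreal (marginal n f (Suc k) (x(Suc k := v))) \<partial>lborel) = ennreal (marginal n f k x)"
    if k: "k < n" and x: "x \<in> space (Rn k)"
    using log_concave_fibre_integrable[where R=R, OF st(1)[OF k] st(2)[OF k] st(3)[OF k] *[of "Suc k"] x] k
    by (simp add: marginal_step[OF k])
qed

section \<open>The triangular transport map\<close>

lemma borel_measurable_cdf_of:
  assumes [measurable]: "(\<lambda>(x, v). f x v) \<in> borel_measurable (A \<Otimes>\<^sub>M borel)" "u \<in> borel_measurable A"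
  shows "(\<lambda>x. cdf_of (f x) (u x)) \<in> borel_measurable A"
  unfolding cdf_of_def indicator_def atMost_iff by measurable

text \<open>Where the normalizing marginal vanishes, the conditional density is identically \<open>0\<close> by the convention on division by zero. Measurability of
the quantile in the parameter has to cover these parameters too, so its sublevel sets are described in both cases.\<close>

lemma quantile_le_cases:
  assumes "bounded_density p R \<or> p = (\<lambda>_. 0)"
  shows "quantile R p u \<le> c \<longleftrightarrow>
    (if 0 \<le> R \<and> u \<le> cdf_of p R then -R \<le> c \<and> (R \<le> c \<or> u \<le> cdf_of p c) else Inf {} \<le> c)"
  using assms
proof
  assume "p = (\<lambda>_. 0)"
  then have z: "cdf_of p x = 0" for x by (simp add: cdf_of_def)
  show ?thesis
  proof (cases "0 \<le> R \<and> u \<le> 0")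
    case True
    then have "{x \<in> {-R..R}. u \<le> cdf_of p x} = {-R..R}" by (auto simp: z)
    then show ?thesis using True by (simp add: quantile_def z)
  next
    case False
    then have "{x \<in> {-R..R}. u \<le> cdf_of p x} = {}" by (auto simp: z)
    then have "quantile R p u = Inf {}" by (simp only: quantile_def)
    moreover have "\<not> (0 \<le> R \<and> u \<le> cdf_of p R)" using False by (simp only: z) simp
    ultimately show ?thesis by (simp only: if_False)
  qed
next
  assume "bounded_density p R"
  then interpret bounded_density p R .
  have one: "cdf_of p R = 1" by (simp add: cdf_of_eq F_right)
  consider "1 < u" | "u < 0" | "u \<in> {0..1}" by force
  then show ?thesis
  proof cases
    case 1
    then have "{x \<in> {-R..R}. u \<le> cdf_of p x} = {}" using F_le_1 by (auto simp: cdf_of_eq not_le intro: le_less_trans)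
    then have "quantile R p u = Inf {}" by (simp only: quantile_def)
    then show ?thesis using 1 by (simp add: one)
  next
    case 2
    then have u: "u \<le> cdf_of p x" for x using F_ge_0[of x] by (simp add: cdf_of_eq)
    then have "{x \<in> {-R..R}. u \<le> cdf_of p x} = {-R..R}" by auto
    then show ?thesis using u R_nonneg by (simp add: quantile_def)
  next
    case 3
    then have r: "quantile R p u \<in> {-R..R}" by (rule quantile_range)
    show ?thesis
    proof (cases "c \<in> {-R..R}")
      case True
      then show ?thesis
        using quantile_le_iff[OF 3 True] 3 R_nonneg F_right[of c] by (auto simp: cdf_of_eq one F_right)
    next
      case False
      then show ?thesis using r 3 R_nonneg by (auto simp: one)
    qed
  qed
qed

lemma borel_measurable_quantile:
  assumes f[measurable]: "(\<lambda>(x, v). f x v) \<in> borel_measurable (A \<Otimes>\<^sub>M borel)" and u[measurable]: "u \<in> borel_measurable A"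
    and alt: "\<And>x. x \<in> space A \<Longrightarrow> bounded_density (f x) R \<or> f x = (\<lambda>_. 0)"
  shows "(\<lambda>x. quantile R (f x) (u x)) \<in> borel_measurable A"
  unfolding borel_measurable_iff_le
proof
  fix c
  have [measurable]: "(\<lambda>x. cdf_of (f x) c) \<in> borel_measurable A" for c
    by (rule borel_measurable_cdf_of) measurable
  have "{x \<in> space A. quantile R (f x) (u x) \<le> c} =
    {x \<in> space A. if 0 \<le> R \<and> u x \<le> cdf_of (f x) R then -R \<le> c \<and> (R \<le> c \<or> u x \<le> cdf_of (f x) c) else Inf {} \<le> c}"
    using quantile_le_cases[OF alt] by auto
  also have "\<dots> \<in> sets A" by measurable
  finally show "{x \<in> space A. quantile R (f x) (u x) \<le> c} \<in> sets A" .
qed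

text \<open>\<open>M\<close> belongs to the log-concave law and \<open>N\<close> to the other one. The pointwise domination expresses absolute
continuity for densities chosen so that it holds without exceptional sets.\<close>

locale knothe = M: density_chain M n R + N: density_chain N n R
  for M N :: "nat \<Rightarrow> (nat \<Rightarrow> real) \<Rightarrow> real" and n :: nat and R :: real +
  assumes M_log_concave: "k \<le> n \<Longrightarrow> log_concave k (M k)"
    and M_fibre: "k < n \<Longrightarrow> x \<in> space (Rn k) \<Longrightarrow>
      (\<integral>\<^sup>+v. ennreal (M (Suc k) (x(Suc k := v))) \<partial>lborel) = ennreal (M k x)"
    and dominated: "k \<le> n \<Longrightarrow> y \<in> space (Rn k) \<Longrightarrow> 0 < N k y \<Longrightarrow> 0 < M k y"
begin

text \<open>The triangular map from the law with density \<open>N n\<close> to the one with density \<open>M n\<close>; \<open>T k y\<close> consists of its first \<open>k\<close> coordinates,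
which depend on the first \<open>k\<close> coordinates of \<open>y\<close>.\<close>

primrec T :: "nat \<Rightarrow> (nat \<Rightarrow> real) \<Rightarrow> nat \<Rightarrow> real" where
  "T 0 y = (\<lambda>_. undefined)"
| "T (Suc k) y = (T k y)(Suc k := quantile R (M.cond k (T k y)) (cdf_of (N.cond k (initial k y)) (y (Suc k))))"

definition fibre_map :: "nat \<Rightarrow> (nat \<Rightarrow> real) \<Rightarrow> real \<Rightarrow> real" where
  "fibre_map k y v = quantile R (M.cond k (T k y)) (cdf_of (N.cond k y) v)"

lemma T_in_space[simp]: "T k y \<in> space (Rn k)"
proof (induction k)
  case 0
  show ?case by (simp add: Rn_def space_PiM)
next
  case (Suc k)
  show ?case unfolding T.simps by (rule append_in_space[OF Suc])
qed

lemma initial_initial: "j \<le> k \<Longrightarrow> initial j (initial k y) = initial j y"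
  by (auto simp: initial_def restrict_def)

lemma T_initial: "j \<le> k \<Longrightarrow> T j (initial k y) = T j y"
proof (induction j)
  case (Suc j)
  then have "initial k y (Suc j) = y (Suc j)" by (simp add: initial_def)
  then show ?case using Suc by (simp add: initial_initial)
qed simp

lemma T_append: "T k (y(Suc k := v)) = T k y"
  using T_initial[of k k "y(Suc k := v)"] T_initial[of k k y] by (simp add: initial_append)

lemma T_Suc_append: "y \<in> space (Rn k) \<Longrightarrow> T (Suc k) (y(Suc k := v)) = (T k y)(Suc k := fibre_map k y v)"
  by (simp add: T_append initial_append initial_self fibre_map_def)

lemma M_cond_cases: "k < n \<Longrightarrow> x \<in> space (Rn k) \<Longrightarrow> bounded_density (M.cond k x) R \<or> M.cond k x = (\<lambda>_. 0)"
  using M.cond_density[of k x] M.N_nonneg[of k x] by (cases "M k x = 0") (auto simp: M.cond_def)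

lemma T_measurable[measurable]: "k \<le> n \<Longrightarrow> T k \<in> measurable (Rn k) (Rn k)"
proof (induction k)
  case 0
  have "T 0 = (\<lambda>y. \<lambda>_. undefined)" by auto
  then show ?case by (simp add: Rn_def space_PiM)
next
  case (Suc k)
  then have k: "k < n" by simp
  note [measurable] = M.cond_measurable[OF k] N.cond_measurable[OF k]
  have pk[measurable]: "initial k \<in> measurable (Rn (Suc k)) (Rn k)" by simp
  note [measurable] = measurable_last_coordinate[of k]
  have "T k \<in> measurable (Rn k) (Rn k)" using Suc by simp
  from measurable_compose[OF pk this] have Tk[measurable]: "T k \<in> measurable (Rn (Suc k)) (Rn k)"
    by (simp add: T_initial)
  have u: "(\<lambda>y. cdf_of (N.cond k (initial k y)) (y (Suc k))) \<in> borel_measurable (Rn (Suc k))"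
    by (rule borel_measurable_cdf_of) measurable
  have "(\<lambda>y. quantile R (M.cond k (T k y)) (cdf_of (N.cond k (initial k y)) (y (Suc k)))) \<in> borel_measurable (Rn (Suc k))"
    by (rule borel_measurable_quantile[OF _ u M_cond_cases[OF k T_in_space]]) measurable
  with Tk show ?case unfolding T.simps(2)[abs_def] by (rule measurable_append)
qed

lemma T_measurable_Suc:
  assumes k: "k < n"
  shows "T k \<in> measurable (Rn (Suc k)) (Rn k)" "(\<lambda>y. T (Suc k) y (Suc k)) \<in> borel_measurable (Rn (Suc k))"
proof -
  show "T k \<in> measurable (Rn (Suc k)) (Rn k)"
    using measurable_compose[OF measurable_initial T_measurable, of k "Suc k"] k by (simp add: T_initial)
  show "(\<lambda>y. T (Suc k) y (Suc k)) \<in> borel_measurable (Rn (Suc k))"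
    using k by (intro measurable_compose[OF T_measurable measurable_last_coordinate]) auto
qed

lemma fibre_map_measurable: "k < n \<Longrightarrow> (\<lambda>(y, v). fibre_map k y v) \<in> borel_measurable (Rn k \<Otimes>\<^sub>M borel)"
proof -
  assume k: "k < n"
  note [measurable] = M.cond_measurable[OF k] N.cond_measurable[OF k]
  have [measurable]: "T k \<in> measurable (Rn k) (Rn k)" using k by simp
  have u: "(\<lambda>x. cdf_of (N.cond k (fst x)) (snd x)) \<in> borel_measurable (Rn k \<Otimes>\<^sub>M borel)"
    by (rule borel_measurable_cdf_of) measurable
  have "(\<lambda>x. quantile R (M.cond k (T k (fst x))) (cdf_of (N.cond k (fst x)) (snd x))) \<in> borel_measurable (Rn k \<Otimes>\<^sub>M borel)"
    by (rule borel_measurable_quantile[OF _ u M_cond_cases[OF k T_in_space]]) measurable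
  then show ?thesis by (simp add: fibre_map_def split_beta')
qed

text \<open>The points at which both normalizing constants of the next fibre are positive.\<close>

definition good :: "nat \<Rightarrow> (nat \<Rightarrow> real) \<Rightarrow> bool" where
  "good k y \<longleftrightarrow> y \<in> space (Rn k) \<and> 0 < N k y \<and> 0 < M k (T k y)"

lemma fibre_transport:
  assumes k: "k < n" and y: "good k y"
  shows "monotone_transport (M.cond k (T k y)) (N.cond k y) R"
proof -
  interpret p: bounded_density "M.cond k (T k y)" R by (rule M.cond_density[OF k]) (use y in \<open>auto simp: good_def\<close>)
  interpret q: bounded_density "N.cond k y" R by (rule N.cond_density[OF k]) (use y in \<open>auto simp: good_def\<close>)
  show ?thesis
  proof
    fix u v w :: real assume "u \<le> v" "v \<le> w"
    moreover have "log_concave (Suc k) (M (Suc k))" using M_log_concave k by simp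
    ultimately show "min (M.cond k (T k y) u) (M.cond k (T k y) w) \<le> M.cond k (T k y) v"
      using log_concave_fibre_quasi_concave[of k "M (Suc k)" "T k y" u v w] M.N_nonneg[of "Suc k"] y
      by (auto simp: M.cond_def min_le_iff_disj good_def divide_right_mono)
  qed
qed

lemma fibre_S: assumes "k < n" "good k y" shows "monotone_transport.S (M.cond k (T k y)) (N.cond k y) R = fibre_map k y"
proof -
  interpret monotone_transport "M.cond k (T k y)" "N.cond k y" R by (rule fibre_transport[OF assms])
  show ?thesis by (simp add: fun_eq_iff S_def fibre_map_def q.cdf_of_eq)
qed

lemma nn_integral_push_T:
  "k \<le> n \<Longrightarrow> \<phi> \<in> borel_measurable (Rn k) \<Longrightarrow> (\<integral>\<^sup>+y. \<phi> (T k y) \<partial>N.marg k) = (\<integral>\<^sup>+x. \<phi> x \<partial>M.marg k)"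
  and AE_good: "k \<le> n \<Longrightarrow> AE y in N.marg k. good k y"
proof -
  have AE_good': "AE y in N.marg k. good k y"
    if k: "k \<le> n" and push: "\<And>\<phi>. \<phi> \<in> borel_measurable (Rn k) \<Longrightarrow> (\<integral>\<^sup>+y. \<phi> (T k y) \<partial>N.marg k) = (\<integral>\<^sup>+x. \<phi> x \<partial>M.marg k)" for k
  proof -
    have [measurable]: "M k \<in> borel_measurable (Rn k)" "T k \<in> measurable (Rn k) (Rn k)" using k by auto
    define \<phi> where "\<phi> x = (if 0 < M k x then 0 else 1 :: ennreal)" for x
    have [measurable]: "\<phi> \<in> borel_measurable (Rn k)" unfolding \<phi>_def by measurable
    have "(\<integral>\<^sup>+y. \<phi> (T k y) \<partial>N.marg k) = (\<integral>\<^sup>+x. \<phi> x \<partial>M.marg k)" by (rule push) measurable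
    also have "\<dots> = (\<integral>\<^sup>+x. 0 \<partial>M.marg k)"
      using M.AE_N_pos[OF k] by (intro nn_integral_cong_AE, eventually_elim) (simp add: \<phi>_def)
    finally have "AE y in N.marg k. \<phi> (T k y) = 0" by (simp add: nn_integral_0_iff_AE)
    then show ?thesis using N.AE_N_pos[OF k] AE_space
      by eventually_elim (auto simp: \<phi>_def good_def N.space_marg split: if_splits)
  qed
  have push: "(\<integral>\<^sup>+y. \<phi> (T k y) \<partial>N.marg k) = (\<integral>\<^sup>+x. \<phi> x \<partial>M.marg k)"
    if "k \<le> n" "\<phi> \<in> borel_measurable (Rn k)" for k \<phi>
    using that
  proof (induction k arbitrary: \<phi>)
    case 0
    have "(\<integral>\<^sup>+y. \<phi> (T 0 y) \<partial>N.marg 0) = \<phi> (\<lambda>_. undefined)"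
      using N.emeasure_marg[of 0] by simp
    moreover have "(\<integral>\<^sup>+x. \<phi> x \<partial>M.marg 0) = (\<integral>\<^sup>+x. \<phi> (\<lambda>_. undefined) \<partial>M.marg 0)"
      by (intro nn_integral_cong) (simp add: M.space_marg Rn_def space_PiM)
    ultimately show ?case using M.emeasure_marg[of 0] by simp
  next
    case (Suc k)
    then have k: "k < n" by simp
    note [measurable] = Suc.prems(2)
    have [measurable]: "T (Suc k) \<in> measurable (Rn (Suc k)) (Rn (Suc k))" using Suc.prems by (intro T_measurable) 
    note [measurable] = M.cond_measurable[OF k]
    define \<psi> where "\<psi> x = (\<integral>\<^sup>+v. ennreal (M.cond k x v) * \<phi> (x(Suc k := v)) \<partial>lborel)" for x
    have [measurable]: "\<psi> \<in> borel_measurable (Rn k)" unfolding \<psi>_def by measurable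
    have "(\<integral>\<^sup>+y. \<phi> (T (Suc k) y) \<partial>N.marg (Suc k)) = (\<integral>\<^sup>+y. \<integral>\<^sup>+v. ennreal (N.cond k y v) * \<phi> (T (Suc k) (y(Suc k := v))) \<partial>lborel \<partial>N.marg k)"
      by (rule N.nn_integral_marg_Suc[OF k]) measurable
    also have "\<dots> = (\<integral>\<^sup>+y. \<psi> (T k y) \<partial>N.marg k)"
    proof (rule nn_integral_cong_AE)
      have "AE y in N.marg k. good k y" using k by (intro AE_good' Suc.IH) auto
      then show "AE y in N.marg k. (\<integral>\<^sup>+v. ennreal (N.cond k y v) * \<phi> (T (Suc k) (y(Suc k := v))) \<partial>lborel) = \<psi> (T k y)"
      proof eventually_elim
        case y: (elim y)
        then interpret monotone_transport "M.cond k (T k y)" "N.cond k y" R by (rule fibre_transport[OF k])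
        have "y \<in> space (Rn k)" using y by (simp add: good_def)
        then have "(\<integral>\<^sup>+v. ennreal (N.cond k y v) * \<phi> (T (Suc k) (y(Suc k := v))) \<partial>lborel)
          = (\<integral>\<^sup>+v. ennreal (N.cond k y v) * \<phi> ((T k y)(Suc k := S v)) \<partial>lborel)"
          by (simp only: T_Suc_append fibre_S[OF k y])
        also have "\<dots> = \<psi> (T k y)"
          unfolding \<psi>_def by (rule nn_integral_push) (rule measurable_fibre, measurable)
        finally show ?case .
      qed
    qed
    also have "\<dots> = (\<integral>\<^sup>+x. \<psi> x \<partial>M.marg k)" using k by (intro Suc.IH) auto
    also have "\<dots> = (\<integral>\<^sup>+x. \<phi> x \<partial>M.marg (Suc k))"
      unfolding \<psi>_def by (rule M.nn_integral_marg_Suc[OF k, symmetric]) measurable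
    finally show ?case .
  qed
  show "k \<le> n \<Longrightarrow> \<phi> \<in> borel_measurable (Rn k) \<Longrightarrow> (\<integral>\<^sup>+y. \<phi> (T k y) \<partial>N.marg k) = (\<integral>\<^sup>+x. \<phi> x \<partial>M.marg k)"
    by (rule push)
  show "k \<le> n \<Longrightarrow> AE y in N.marg k. good k y" by (intro AE_good' push)
qed

lemma distr_T: assumes k: "k \<le> n" shows "distr (N.marg k) (Rn k) (T k) = M.marg k"
proof (rule measure_eqI)
  fix A assume "A \<in> sets (distr (N.marg k) (Rn k) (T k))"
  then have A[measurable]: "A \<in> sets (Rn k)" by simp
  have [measurable]: "T k \<in> measurable (N.marg k) (Rn k)" using T_measurable[OF k] by simp
  have "emeasure (distr (N.marg k) (Rn k) (T k)) A = (\<integral>\<^sup>+y. indicator A (T k y) \<partial>N.marg k)"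
    by (subst nn_integral_indicator[symmetric], simp, subst nn_integral_distr) auto
  also have "\<dots> = (\<integral>\<^sup>+y. indicator A y \<partial>M.marg k)"
    by (rule nn_integral_push_T[OF k]) measurable
  finally show "emeasure (distr (N.marg k) (Rn k) (T k)) A = emeasure (M.marg k) A" by simp
qed simp

text \<open>The Jacobian of the map \<open>y \<mapsto> (1 - t) T y + t y\<close> in the first \<open>k\<close> coordinates, divided by the density \<open>N k\<close>: a factor
\<open>(1 - t) \<theta> + t\<close> with \<open>\<theta> = q / p\<close>, divided by \<open>q\<close>, is \<open>(1 - t) / p + t / q\<close>.\<close>

primrec weight :: "real \<Rightarrow> nat \<Rightarrow> (nat \<Rightarrow> real) \<Rightarrow> real" where
  "weight t 0 y = 1"
| "weight t (Suc k) y = weight t k y *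
     ((1 - t) / M.cond k (T k y) (T (Suc k) y (Suc k)) + t / N.cond k (initial k y) (y (Suc k)))"

lemma weight_initial: "j \<le> k \<Longrightarrow> weight t j (initial k y) = weight t j y"
proof (induction j)
  case (Suc j)
  then have "initial k y (Suc j) = y (Suc j)" by (simp add: initial_def)
  then show ?case using Suc by (simp add: initial_initial T_initial)
qed simp

lemma weight_append: "weight t k (y(Suc k := v)) = weight t k y"
  using weight_initial[of k k t "y(Suc k := v)"] weight_initial[of k k t y] by (simp add: initial_append)

lemma weight_Suc_append: "y \<in> space (Rn k) \<Longrightarrow> weight t (Suc k) (y(Suc k := v)) =
    weight t k y * ((1 - t) / M.cond k (T k y) (fibre_map k y v) + t / N.cond k y v)"
  by (simp add: weight_append T_append initial_append initial_self fibre_map_def)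

lemma weight_nonneg: "0 \<le> t \<Longrightarrow> t \<le> 1 \<Longrightarrow> 0 \<le> weight t k y"
  by (induction k) (auto simp: M.cond_def N.cond_def M.N_nonneg N.N_nonneg)

lemma weight_measurable[measurable]: "k \<le> n \<Longrightarrow> weight t k \<in> borel_measurable (Rn k)"
proof (induction k)
  case 0
  have "weight t 0 = (\<lambda>y. 1)" by auto
  then show ?case by simp
next
  case (Suc k)
  then have k: "k < n" by simp
  note [measurable] = M.cond_measurable[OF k] N.cond_measurable[OF k]
  have pk[measurable]: "initial k \<in> measurable (Rn (Suc k)) (Rn k)" by simp
  note [measurable] = measurable_last_coordinate[of k]
  note [measurable] = T_measurable_Suc[OF k]
  have "weight t k \<in> borel_measurable (Rn k)" using Suc by simp
  from measurable_compose[OF pk this] have [measurable]: "weight t k \<in> borel_measurable (Rn (Suc k))"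
    by (simp add: weight_initial)
  show ?case unfolding weight.simps(2)[abs_def] by measurable
qed

text \<open>The mean of \<open>energy t k\<close> under the law with density \<open>N k\<close> is the integral of \<open>M k\<close> along the interpolated map,
restricted to the points where \<open>N k\<close> is positive.\<close>

definition energy :: "real \<Rightarrow> nat \<Rightarrow> (nat \<Rightarrow> real) \<Rightarrow> real" where
  "energy t k y = weight t k y * M k (segment_point k t (T k y) y)"

text \<open>The contribution to the integral of \<open>M (Suc k)\<close> along the interpolated map of the points \<open>v\<close> at which the conditional density vanishes
although the conditional law has mass on both sides. There \<open>\<theta> = 0\<close>, so the Jacobian factor of the last coordinate is \<open>t\<close>,
which is left out here.\<close>

definition gap :: "real \<Rightarrow> nat \<Rightarrow> (nat \<Rightarrow> real) \<Rightarrow> real \<Rightarrow> real" where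
  "gap t k y v = (if 0 < cdf_of (N.cond k y) v \<and> cdf_of (N.cond k y) v < 1 \<and> N.cond k y v = 0
     then weight t k y * M (Suc k) ((segment_point k t (T k y) y)(Suc k := (1 - t) * fibre_map k y v + t * v)) else 0)"

lemma energy_measurable[measurable]: "k \<le> n \<Longrightarrow> energy t k \<in> borel_measurable (Rn k)"
  unfolding energy_def by measurable

lemma gap_measurable: 
  assumes k: "k < n" shows "(\<lambda>(y, v). gap t k y v) \<in> borel_measurable (Rn k \<Otimes>\<^sub>M borel)"
proof -
  have [measurable]: "T k \<in> measurable (Rn k) (Rn k)" "weight t k \<in> borel_measurable (Rn k)"
    "M (Suc k) \<in> borel_measurable (Rn (Suc k))" using k by auto
  note [measurable] = M.cond_measurable[OF k] N.cond_measurable[OF k] fibre_map_measurable[OF k]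
  have [measurable]: "(\<lambda>x. cdf_of (N.cond k (fst x)) (snd x)) \<in> borel_measurable (Rn k \<Otimes>\<^sub>M borel)"
    by (rule borel_measurable_cdf_of) measurable
  show ?thesis unfolding gap_def split_beta' by measurable
qed

text \<open>The substitution of \<open>nn_integral_interp_le\<close> in the last coordinate, with the others held fixed, bounds the integral of
\<open>M (Suc k)\<close> along a fibre by \<open>M k\<close> at the interpolated point.\<close>

lemma energy_step:
  assumes k: "k < n" and t: "0 < t" "t < 1"
  shows "(\<integral>\<^sup>+y. ennreal (energy t (Suc k) y) \<partial>N.marg (Suc k)) + ennreal t * (\<integral>\<^sup>+y. \<integral>\<^sup>+v. ennreal (gap t k y v) \<partial>lborel \<partial>N.marg k)
    \<le> (\<integral>\<^sup>+y. ennreal (energy t k y) \<partial>N.marg k)"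
proof -
  let ?E0 = "\<integral>\<^sup>+y. ennreal (energy t k y) \<partial>N.marg k"
  let ?E1 = "\<integral>\<^sup>+y. ennreal (energy t (Suc k) y) \<partial>N.marg (Suc k)"
  let ?C = "\<lambda>y. \<integral>\<^sup>+v. ennreal (N.cond k y v) * ennreal (energy t (Suc k) (y(Suc k := v))) \<partial>lborel"
  let ?D = "\<lambda>y. \<integral>\<^sup>+v. ennreal (gap t k y v) \<partial>lborel"
  note [measurable] = M.cond_measurable[OF k] N.cond_measurable[OF k] fibre_map_measurable[OF k] gap_measurable[OF k]
  have [measurable]: "energy t (Suc k) \<in> borel_measurable (Rn (Suc k))" using k by simp
  have fibre: "?C y + ennreal t * ?D y
     \<le> ennreal (energy t k y)" if y: "good k y" for y
  proof -
    interpret monotone_transport "M.cond k (T k y)" "N.cond k y" R by (rule fibre_transport[OF k y])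
    have ys: "y \<in> space (Rn k)" using y by (simp add: good_def)
    define z where "z = segment_point k t (T k y) y"
    define \<phi> where "\<phi> x = ennreal (weight t k y * M (Suc k) (z(Suc k := x)))" for x
    have zs: "z \<in> space (Rn k)" by (simp add: z_def)
    have MS[measurable]: "(\<lambda>x. M (Suc k) (z(Suc k := x))) \<in> borel_measurable borel"
      by (rule measurable_fibre[OF _ zs]) (use k in simp)
    have [measurable]: "\<phi> \<in> borel_measurable borel" unfolding \<phi>_def by measurable
    have [measurable]: "(\<lambda>v. gap t k y v) \<in> borel_measurable borel"
      using measurable_Pair2[OF gap_measurable[OF k] ys] by simp
    have [measurable]: "(\<lambda>v. energy t (Suc k) (y(Suc k := v))) \<in> borel_measurable borel"
      by (rule measurable_fibre[OF _ ys]) measurable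
    have S: "S = fibre_map k y" by (rule fibre_S[OF k y])
    have I: "v \<in> I \<longleftrightarrow> 0 < cdf_of (N.cond k y) v \<and> cdf_of (N.cond k y) v < 1" for v
      by (simp add: I_def q.cdf_of_eq)
    have w: "0 \<le> weight t k y" using t by (intro weight_nonneg) auto
    have E: "energy t (Suc k) (y(Suc k := v)) = ((1 - t) / M.cond k (T k y) (S v) + t / N.cond k y v) * (weight t k y * M (Suc k) (z(Suc k := interp t v)))" for v
      by (simp only: energy_def weight_Suc_append[OF ys] T_Suc_append[OF ys] segment_point_append z_def interp_def S mult.commute mult.left_commute)
    let ?X = "\<lambda>v. ennreal (N.cond k y v) * ennreal (energy t (Suc k) (y(Suc k := v))) + ennreal t * ennreal (gap t k y v)" and ?Y = "\<lambda>v. indicator I v * (ennreal ((1 - t) * \<theta> v + t) * \<phi> (interp t v))"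
    have "?C y + ennreal t * ?D y
      = (\<integral>\<^sup>+v. ?X v \<partial>lborel)"
      by (subst nn_integral_add) (auto simp: nn_integral_cmult)
    also have "\<dots> \<le> (\<integral>\<^sup>+v. ?Y v \<partial>lborel)"
    proof (rule nn_integral_mono_AE)
      have "AE v in lborel. 0 < N.cond k y v \<longrightarrow> v \<in> I" using AE_I by (subst (asm) q.AE_law) auto
      then show "AE v in lborel. ?X v
         \<le> ?Y v"
      proof eventually_elim
        case v: (elim v)
        let ?W = "weight t k y * M (Suc k) (z(Suc k := interp t v))"
        have W: "0 \<le> ?W" using w by (simp add: M.N_nonneg)
        have th: "0 \<le> (1 - t) * \<theta> v + t" using t \<theta>_nonneg[of v] by simp
        show ?case
        proof (cases "N.cond k y v = 0")
          case True
          then have th0: "\<theta> v = 0" by (simp add: \<theta>_def)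
          show ?thesis
          proof (cases "v \<in> I")
            case vI: True
            then have "gap t k y v = ?W" using True by (simp add: gap_def I z_def interp_def S)
            then show ?thesis using vI True by (simp add: th0 \<phi>_def)
          next
            case False
            then have "gap t k y v = 0" by (auto simp: gap_def I)
            then show ?thesis using True by simp
          qed
        next
          case False
          then have q: "0 < N.cond k y v" using q.p_nonneg[of v] by simp
          then have vI: "v \<in> I" using v by simp
          have p: "0 < M.cond k (T k y) (S v)" by (rule p_S_pos[OF vI])
          have "N.cond k y v * energy t (Suc k) (y(Suc k := v)) = ((1 - t) * \<theta> v + t) * ?W"
            unfolding E \<theta>_def using p q by (simp add: field_simps)
          moreover have "gap t k y v = 0" using q by (simp add: gap_def)
          ultimately show ?thesis
            using vI q th W by (simp add: \<phi>_def ennreal_mult[symmetric] ennreal_mult'[symmetric] del: ennreal_plus)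
        qed
      qed
    qed
    also have "\<dots> \<le> (\<integral>\<^sup>+x. \<phi> x \<partial>lborel)"
      using t by (intro nn_integral_interp_le) auto
    also have "\<dots> = ennreal (weight t k y) * ennreal (M k z)"
      using w M.N_nonneg by (simp add: \<phi>_def ennreal_mult nn_integral_cmult M_fibre[OF k zs])
    also have "\<dots> = ennreal (energy t k y)"
      using w M.N_nonneg by (simp add: energy_def z_def ennreal_mult)
    finally show ?thesis .
  qed
  have "?E1 + ennreal t * (\<integral>\<^sup>+y. \<integral>\<^sup>+v. ennreal (gap t k y v) \<partial>lborel \<partial>N.marg k)
    = (\<integral>\<^sup>+y. ?C y + ennreal t * ?D y \<partial>N.marg k)"
    by (subst N.nn_integral_marg_Suc[OF k], measurable, subst nn_integral_add) (auto simp: nn_integral_cmult)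
  also have "\<dots> \<le> ?E0"
    using AE_good[OF less_imp_le[OF k]] by (intro nn_integral_mono_AE, eventually_elim) (rule fibre)
  finally show ?thesis .
qed

lemma energy_sum:
  assumes t: "0 < t" "t < 1" and "k \<le> n"
  shows "(\<integral>\<^sup>+y. ennreal (energy t k y) \<partial>N.marg k) + ennreal t * (\<Sum>j<k. \<integral>\<^sup>+y. \<integral>\<^sup>+v. ennreal (gap t j y v) \<partial>lborel \<partial>N.marg j) \<le> 1"
  using assms(3)
proof (induction k)
  case 0
  have "(\<integral>\<^sup>+y. ennreal (energy t 0 y) \<partial>N.marg 0) = (\<integral>\<^sup>+y. 1 \<partial>N.marg 0)"
    by (intro nn_integral_cong) (simp add: energy_def M.N_0)
  then show ?case using N.emeasure_marg[of 0] by simp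
next
  case (Suc k)
  let ?E1 = "\<integral>\<^sup>+y. ennreal (energy t (Suc k) y) \<partial>N.marg (Suc k)"
  let ?J = "\<lambda>j. \<integral>\<^sup>+y. \<integral>\<^sup>+v. ennreal (gap t j y v) \<partial>lborel \<partial>N.marg j"
  have "?E1 + ennreal t * (\<Sum>j<Suc k. ?J j)
     = (?E1 + ennreal t * ?J k) + ennreal t * (\<Sum>j<k. ?J j)"
    by (simp add: distrib_left add_ac)
  also have "\<dots> \<le> (\<integral>\<^sup>+y. ennreal (energy t k y) \<partial>N.marg k) + ennreal t * (\<Sum>j<k. ?J j)"
    using Suc t by (intro add_mono energy_step) auto
  also have "\<dots> \<le> 1" using Suc by simp
  finally show ?case .
qed

end

section \<open>The entropy inequality along the interpolation\<close>

text \<open>The logarithm of the ratio of the weighted arithmetic and geometric means of \<open>1\<close> and \<open>s\<close>. To first order in \<open>t\<close> it is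
\<open>t (s - 1 - ln s)\<close>.\<close>

definition amgm_defect :: "real \<Rightarrow> real \<Rightarrow> real" where
  "amgm_defect t s = ln (1 - t + t * s) - t * ln s"

lemma amgm_defect_nonneg:
  assumes "0 < s" "0 < t" "t < 1" shows "0 \<le> amgm_defect t s"
proof -
  have "s powr t \<le> 1 - t + t * s" using weighted_geometric_mean_le[of s "1 - t"] assms by simp
  then have "ln (s powr t) \<le> ln (1 - t + t * s)" using assms by (subst ln_le_cancel_iff) (auto intro: add_pos_pos)
  then show ?thesis using assms by (simp add: amgm_defect_def ln_powr)
qed

lemma amgm_defect_limit:
  assumes "0 < s"
  shows "(\<lambda>m. amgm_defect (1 / (real m + 2)) s / (1 / (real m + 2))) \<longlonglongrightarrow> s - 1 - ln s"
proof -
  have "((\<lambda>t. ln (1 + t * (s - 1)) / t) \<longlongrightarrow> s - 1) (at_right 0)"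
    by real_asymp
  moreover have "filterlim (\<lambda>m. 1 / (real m + 2)) (at_right 0) sequentially" by real_asymp
  ultimately have "(\<lambda>m. ln (1 + 1 / (real m + 2) * (s - 1)) / (1 / (real m + 2))) \<longlonglongrightarrow> s - 1"
    by (rule filterlim_compose)
  then have "(\<lambda>m. ln (1 + 1 / (real m + 2) * (s - 1)) / (1 / (real m + 2)) - ln s) \<longlonglongrightarrow> s - 1 - ln s"
    by (intro tendsto_intros)
  moreover have "ln (1 + 1 / (real m + 2) * (s - 1)) / (1 / (real m + 2)) - ln s = amgm_defect (1 / (real m + 2)) s / (1 / (real m + 2))" for m
  proof -
    have e: "1 + e * (s - 1) = 1 - e + e * s" for e by (simp add: algebra_simps)
    show ?thesis unfolding e amgm_defect_def diff_divide_distrib by simp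
  qed
  ultimately show ?thesis by simp
qed

lemma (in bounded_density) exists_pos_left:
  assumes "0 < F v" obtains u where "u \<le> v" "0 < p u"
proof -
  have "\<not> (AE w in law. w \<notin> {..v})"
    using assms by (subst law.prob_eq_0[symmetric]) (auto simp: cdf_def)
  moreover have "AE w in law. w \<notin> {..v}" if "\<And>u. u \<le> v \<Longrightarrow> \<not> 0 < p u"
    using AE_law_pos by eventually_elim (use that in auto)
  ultimately show ?thesis using that by blast
qed

lemma (in bounded_density) exists_pos_right:
  assumes "F v < 1" obtains u where "v \<le> u" "0 < p u"
proof -
  have "\<not> (AE w in law. w \<in> {..v})"
    using assms by (subst law.prob_eq_1[symmetric]) (auto simp: cdf_def)
  moreover have "AE w in law. w \<in> {..v}" if "\<And>u. v \<le> u \<Longrightarrow> \<not> 0 < p u"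
    using AE_law_pos
  proof eventually_elim
    case (elim w)
    then show ?case using that[of w] by (cases "v \<le> w") auto
  qed
  ultimately show ?thesis using that by blast
qed

context knothe
begin

lemma initial_Suc: "(initial k y)(Suc k := y (Suc k)) = initial (Suc k) y"
  by (auto simp: initial_def restrict_def fun_eq_iff)

lemma T_Suc_upd: "(T k y)(Suc k := T (Suc k) y (Suc k)) = T (Suc k) y"
  by simp

definition all_good :: "nat \<Rightarrow> (nat \<Rightarrow> real) \<Rightarrow> bool" where
  "all_good k y \<longleftrightarrow> (\<forall>j\<le>k. good j (initial j y))"

lemma AE_all_good: assumes "k \<le> n" shows "AE y in N.marg k. all_good k y"
proof -
  have "AE y in N.marg k. \<forall>j\<in>{..k}. good j (initial j y)"
    using assms by (intro AE_finite_allI N.AE_marg_initial AE_good) auto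
  then show ?thesis by eventually_elim (auto simp: all_good_def)
qed

text \<open>The reciprocal of the derivative \<open>\<theta>\<close> of the \<open>Suc k\<close>-th coordinate of \<open>T\<close> in its own variable.\<close>

definition ratio :: "nat \<Rightarrow> (nat \<Rightarrow> real) \<Rightarrow> real" where
  "ratio k y = M.cond k (T k y) (T (Suc k) y (Suc k)) / N.cond k (initial k y) (y (Suc k))"

lemma cond_pos:
  assumes "all_good (Suc k) y"
  shows "0 < M.cond k (T k y) (T (Suc k) y (Suc k))" "0 < N.cond k (initial k y) (y (Suc k))"
    "M (Suc k) (T (Suc k) y) = M k (T k y) * M.cond k (T k y) (T (Suc k) y (Suc k))"
    "N (Suc k) (initial (Suc k) y) = N k (initial k y) * N.cond k (initial k y) (y (Suc k))"
proof -
  have "good k (initial k y)" "good (Suc k) (initial (Suc k) y)" using assms by (auto simp: all_good_def)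
  then have pos: "0 < M k (T k y)" "0 < N k (initial k y)" "0 < M (Suc k) (T (Suc k) y)" "0 < N (Suc k) (initial (Suc k) y)"
    unfolding good_def by (simp_all only: T_initial order_refl)
  show "0 < M.cond k (T k y) (T (Suc k) y (Suc k))" "0 < N.cond k (initial k y) (y (Suc k))"
    "M (Suc k) (T (Suc k) y) = M k (T k y) * M.cond k (T k y) (T (Suc k) y (Suc k))"
    "N (Suc k) (initial (Suc k) y) = N k (initial k y) * N.cond k (initial k y) (y (Suc k))"
    unfolding M.cond_def N.cond_def T_Suc_upd initial_Suc using pos by simp_all
qed

lemma all_good_pos:
  assumes "all_good k y"
  shows "0 < M k (T k y)" "0 < N k (initial k y)"
proof -
  have "good k (initial k y)" using assms by (auto simp: all_good_def)
  then show "0 < M k (T k y)" "0 < N k (initial k y)" by (auto simp: good_def T_initial)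
qed

text \<open>The conditional densities multiply up to \<open>M k (T k y)\<close> and to \<open>N k y\<close>, and each factor \<open>(1 - t) / p + t / q\<close> of the weight,
multiplied by \<open>p powr (1 - t)\<close> and \<open>q powr t\<close>, has the logarithm \<open>amgm_defect t (p / q)\<close>.\<close>

lemma ln_weight:
  assumes t: "0 < t" "t < 1" and "all_good k y"
  shows "0 < weight t k y \<and> ln (weight t k y) + (1 - t) * ln (M k (T k y)) + t * ln (N k (initial k y)) = (\<Sum>j<k. amgm_defect t (ratio j y))"
  using assms(3)
proof (induction k)
  case 0
  have "initial 0 y \<in> space (Rn 0)" by (simp add: initial_def Rn_def space_PiM restrict_def)
  then show ?case using M.N_0[OF T_in_space, of y] N.N_0 by simp
next
  case (Suc k)
  then have g: "all_good k y" by (auto simp: all_good_def)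
  define p where "p = M.cond k (T k y) (T (Suc k) y (Suc k))"
  define q where "q = N.cond k (initial k y) (y (Suc k))"
  have pq: "0 < p" "0 < q" using cond_pos[OF Suc.prems] by (auto simp: p_def q_def)
  have IH: "0 < weight t k y" "ln (weight t k y) + (1 - t) * ln (M k (T k y)) + t * ln (N k (initial k y)) = (\<Sum>j<k. amgm_defect t (ratio j y))"
    using Suc.IH[OF g] by auto
  have W: "weight t (Suc k) y = weight t k y * ((1 - t) / p + t / q)" by (simp only: weight.simps p_def q_def)
  have f: "(1 - t) / p + t / q = (1 - t + t * (p / q)) / p" using pq by (simp add: field_simps)
  have pos: "0 < 1 - t + t * (p / q)" using t pq by (intro add_pos_pos) auto
  have e1: "ln (weight t (Suc k) y) = ln (weight t k y) + (ln (1 - t + t * (p / q)) - ln p)"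
    unfolding W f using IH(1) pos pq by (simp add: ln_mult ln_div)
  have e2: "ln (M (Suc k) (T (Suc k) y)) = ln (M k (T k y)) + ln p"
    unfolding cond_pos(3)[OF Suc.prems] p_def[symmetric] using pq all_good_pos[OF g] by (simp add: ln_mult)
  have e3: "ln (N (Suc k) (initial (Suc k) y)) = ln (N k (initial k y)) + ln q"
    unfolding cond_pos(4)[OF Suc.prems] q_def[symmetric] using pq all_good_pos[OF g] by (simp add: ln_mult)
  have e4: "ratio k y = p / q" by (simp only: ratio_def p_def q_def)
  have e5: "ln (p / q) = ln p - ln q" using pq by (simp add: ln_div)
  have alg: "(w + (l - lp)) + (1 - t) * (m + lp) + t * (m' + lq) = S + (l - t * (lp - lq))"
    if "w + (1 - t) * m + t * m' = S" for w m m' S l lp lq :: real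
    using that by (simp add: algebra_simps)
  have "ln (weight t (Suc k) y) + (1 - t) * ln (M (Suc k) (T (Suc k) y)) + t * ln (N (Suc k) (initial (Suc k) y))
     = (\<Sum>j<Suc k. amgm_defect t (ratio j y))"
    unfolding e1 e2 e3 alg[OF IH(2)] sum.lessThan_Suc by (simp only: amgm_defect_def e4 e5)
  moreover have "0 < weight t (Suc k) y" unfolding W f using IH(1) pos pq by simp
  ultimately show ?case by blast
qed

lemma ratio_pos: "all_good n y \<Longrightarrow> k < n \<Longrightarrow> 0 < ratio k y"
  using cond_pos(1,2)[of k y] by (auto simp: all_good_def ratio_def)

text \<open>Log-concavity bounds \<open>M n\<close> at the interpolated point from below. The inequality \<open>ln x \<le> x - 1\<close> is used in place of Jensen's because
its right-hand side keeps the amount by which the mean energy falls short of \<open>1\<close>, which is at least \<open>t\<close> times the total gap.\<close>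

lemma sum_defect_le:
  assumes t: "0 < t" "t < 1" and y: "all_good n y" "y \<in> space (Rn n)"
  shows "(\<Sum>k<n. amgm_defect t (ratio k y)) \<le> t * ln (N n y / M n y) + energy t n y - 1"
proof -
  have N: "0 < N n y" using all_good_pos(2)[OF y(1)] by (simp add: initial_self[OF y(2)])
  have MT: "0 < M n (T n y)" by (rule all_good_pos[OF y(1)])
  have M: "0 < M n y" by (rule dominated[OF order_refl y(2) N])
  have w: "0 < weight t n y" using ln_weight[OF t y(1)] by simp
  define z where "z = segment_point n t (T n y) y"
  have lc: "M n (T n y) powr (1 - t) * M n y powr t \<le> M n z"
    using M_log_concave[OF order_refl] y(2) t unfolding log_concave_def z_def by simp
  have "0 < M n (T n y) powr (1 - t) * M n y powr t" using M MT by simp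
  then have Mz: "0 < M n z" using lc by simp
  have "(1 - t) * ln (M n (T n y)) + t * ln (M n y) = ln (M n (T n y) powr (1 - t) * M n y powr t)"
    using M MT by (simp add: ln_mult ln_powr)
  also have "\<dots> \<le> ln (M n z)" using lc M MT Mz by (subst ln_le_cancel_iff) auto
  finally have "(1 - t) * ln (M n (T n y)) + t * ln (M n y) \<le> ln (M n z)" .
  then have "(\<Sum>k<n. amgm_defect t (ratio k y)) \<le> ln (weight t n y) + ln (M n z) + t * (ln (N n y) - ln (M n y))"
    using ln_weight[OF t y(1)] by (simp add: initial_self[OF y(2)] algebra_simps)
  also have "ln (weight t n y) + ln (M n z) = ln (energy t n y)"
    using w Mz by (simp add: energy_def z_def ln_mult)
  also have "\<dots> \<le> energy t n y - 1"
    using w Mz by (intro ln_le_minus_one) (simp add: energy_def z_def)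
  finally show ?thesis using N M by (simp add: ln_div)
qed

definition defect :: "real \<Rightarrow> nat \<Rightarrow> (nat \<Rightarrow> real) \<Rightarrow> real \<Rightarrow> real" where
  "defect t k y v = N.cond k y v * amgm_defect t (M.cond k (T k y) (fibre_map k y v) / N.cond k y v)"

definition fibre_entropy :: "nat \<Rightarrow> (nat \<Rightarrow> real) \<Rightarrow> real \<Rightarrow> real" where
  "fibre_entropy k y v = (if 0 < cdf_of (N.cond k y) v \<and> cdf_of (N.cond k y) v < 1
     then entropy_gap (M.cond k (T k y) (fibre_map k y v)) (N.cond k y v) else 0)"

lemma measurable_fibre_terms:
  assumes k: "k < n"
  shows "(\<lambda>(y, v). defect t k y v) \<in> borel_measurable (Rn k \<Otimes>\<^sub>M borel)"
    "(\<lambda>(y, v). fibre_entropy k y v) \<in> borel_measurable (Rn k \<Otimes>\<^sub>M borel)"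
    "ratio k \<in> borel_measurable (Rn (Suc k))"
proof -
  have [measurable]: "T k \<in> measurable (Rn k) (Rn k)" using k by auto
  note [measurable] = M.cond_measurable[OF k] N.cond_measurable[OF k] fibre_map_measurable[OF k]
  have [measurable]: "(\<lambda>x. cdf_of (N.cond k (fst x)) (snd x)) \<in> borel_measurable (Rn k \<Otimes>\<^sub>M borel)"
    by (rule borel_measurable_cdf_of) measurable
  show "(\<lambda>(y, v). defect t k y v) \<in> borel_measurable (Rn k \<Otimes>\<^sub>M borel)"
    unfolding defect_def amgm_defect_def split_beta' by measurable
  show "(\<lambda>(y, v). fibre_entropy k y v) \<in> borel_measurable (Rn k \<Otimes>\<^sub>M borel)"
    unfolding fibre_entropy_def entropy_gap_def split_beta' by measurable
  have pk[measurable]: "initial k \<in> measurable (Rn (Suc k)) (Rn k)" by simp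
  note [measurable] = measurable_last_coordinate[of k] T_measurable_Suc[OF k]
  show "ratio k \<in> borel_measurable (Rn (Suc k))"
    unfolding ratio_def by measurable
qed

lemma ratio_initial: "ratio k (initial (Suc k) y) = ratio k y"
proof -
  have "initial (Suc k) y (Suc k) = y (Suc k)" by (simp add: initial_def)
  moreover have "T (Suc k) (initial (Suc k) y) = T (Suc k) y" "T k (initial (Suc k) y) = T k y" by (rule T_initial, simp)+
  ultimately show ?thesis unfolding ratio_def by (simp only: initial_initial le_SucI order_refl)
qed

lemma ratio_append: "y \<in> space (Rn k) \<Longrightarrow> ratio k (y(Suc k := v)) = M.cond k (T k y) (fibre_map k y v) / N.cond k y v"
  unfolding ratio_def by (simp only: T_Suc_append T_append initial_append order_refl initial_self fun_upd_same)

lemma nn_integral_defect: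
  assumes k: "k < n"
  shows "(\<integral>\<^sup>+y. ennreal (amgm_defect t (ratio k y)) \<partial>N.marg n) = (\<integral>\<^sup>+y. \<integral>\<^sup>+v. ennreal (defect t k y v) \<partial>lborel \<partial>N.marg k)"
proof -
  note [measurable] = measurable_fibre_terms[OF k]
  have "(\<integral>\<^sup>+y. ennreal (amgm_defect t (ratio k y)) \<partial>N.marg n) = (\<integral>\<^sup>+y. ennreal (amgm_defect t (ratio k (initial (Suc k) y))) \<partial>N.marg n)"
    by (simp add: ratio_initial)
  also have "\<dots> = (\<integral>\<^sup>+y. ennreal (amgm_defect t (ratio k y)) \<partial>N.marg (Suc k))"
    using k unfolding amgm_defect_def by (intro N.nn_integral_marg_initial[where \<phi>="\<lambda>y. ennreal (ln (1 - t + t * ratio k y) - t * ln (ratio k y))"]) auto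
  also have "\<dots> = (\<integral>\<^sup>+y. \<integral>\<^sup>+v. ennreal (N.cond k y v) * ennreal (amgm_defect t (ratio k (y(Suc k := v)))) \<partial>lborel \<partial>N.marg k)"
    unfolding amgm_defect_def by (rule N.nn_integral_marg_Suc[OF k]) measurable
  also have "\<dots> = (\<integral>\<^sup>+y. \<integral>\<^sup>+v. ennreal (defect t k y v) \<partial>lborel \<partial>N.marg k)"
  proof (intro nn_integral_cong)
    fix y v assume "y \<in> space (N.marg k)"
    moreover have "0 \<le> N.cond k y v" by (simp add: N.cond_def N.N_nonneg)
    ultimately show "ennreal (N.cond k y v) * ennreal (amgm_defect t (ratio k (y(Suc k := v)))) = ennreal (defect t k y v)"
      by (simp only: N.space_marg ratio_append defect_def ennreal_mult')
  qed
  finally show ?thesis .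
qed

text \<open>The mean of \<open>sum_defect_le\<close>, in which \<open>energy_sum\<close> bounds the mean energy by \<open>1\<close> minus \<open>t\<close> times the gaps.\<close>

lemma entropy_lower_bound_interpolated:
  assumes t: "0 < t" "t < 1"
    and int: "integrable (N.marg n) (\<lambda>y. ln (N n y / M n y))"
  shows "(\<Sum>k<n. \<integral>\<^sup>+y. \<integral>\<^sup>+v. ennreal (defect t k y v / t) + ennreal (gap t k y v) \<partial>lborel \<partial>N.marg k)
    \<le> ennreal (\<integral>y. ln (N n y / M n y) \<partial>N.marg n)"
proof -
  interpret prob_space "N.marg n" by (rule N.prob_space_marg) simp
  let ?L = "\<lambda>y. ln (N n y / M n y)" and ?E = "\<integral>\<^sup>+y. ennreal (energy t n y) \<partial>N.marg n"
  let ?J = "\<lambda>k. \<integral>\<^sup>+y. \<integral>\<^sup>+v. ennreal (gap t k y v) \<partial>lborel \<partial>N.marg k" and ?B = "\<lambda>k. \<integral>\<^sup>+y. ennreal (amgm_defect t (ratio k y)) \<partial>N.marg n"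
  define D where "D = (\<integral>y. ?L y \<partial>N.marg n)"
  define J where "J = (\<Sum>k<n. ?J k)"
  define E where "E = (\<integral>y. energy t n y \<partial>N.marg n)"
  have [measurable]: "energy t n \<in> borel_measurable (Rn n)" by simp
  have e0: "0 \<le> energy t n y" for y
    unfolding energy_def using t by (intro mult_nonneg_nonneg weight_nonneg M.N_nonneg) auto
  have sum1: "?E + ennreal t * J \<le> 1"
    unfolding J_def by (rule energy_sum[OF t order_refl])
  then have "?E \<le> 1" by (rule order_trans[rotated]) simp
  then have "?E < \<infinity>" by (rule le_less_trans) simp
  then have ei: "integrable (N.marg n) (energy t n)"
    using e0 by (intro integrableI_nonneg) auto
  have E: "?E = ennreal E" "0 \<le> E"
    unfolding E_def using e0 by (auto intro!: nn_integral_eq_integral[OF ei] integral_nonneg)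
  have EJ: "ennreal E + ennreal t * J \<le> ennreal 1" using sum1 E by simp
  have "ennreal t * J \<le> 1" by (rule order_trans[OF _ sum1]) simp
  then have "ennreal t * J < \<infinity>" by (rule le_less_trans) simp
  then obtain j where j: "ennreal t * J = ennreal j" "0 \<le> j" by (cases "ennreal t * J") auto
  have Ej: "E + j \<le> 1" using EJ E(2) j by (simp add: ennreal_plus[symmetric] del: ennreal_plus)
  have good: "AE y in N.marg n. all_good n y \<and> y \<in> space (Rn n)"
    using AE_all_good[OF order_refl] AE_space by eventually_elim (auto simp: N.space_marg)
  have defect0: "AE y in N.marg n. \<forall>k<n. 0 \<le> amgm_defect t (ratio k y)"
    using good by eventually_elim (auto intro!: amgm_defect_nonneg ratio_pos t)
  have meas: "(\<lambda>y. ennreal (amgm_defect t (ratio k y))) \<in> borel_measurable (N.marg n)" if "k < n" for k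
  proof -
    note [measurable] = measurable_fibre_terms[OF that]
    have [measurable]: "initial (Suc k) \<in> measurable (Rn n) (Rn (Suc k))" using that by simp
    have "(\<lambda>y. ennreal (amgm_defect t (ratio k (initial (Suc k) y)))) \<in> borel_measurable (N.marg n)"
      unfolding amgm_defect_def by measurable
    then show ?thesis by (simp add: ratio_initial)
  qed
  have nonneg: "AE y in N.marg n. 0 \<le> t * ?L y + energy t n y - 1"
    using good defect0
  proof eventually_elim
    case y: (elim y)
    then have "0 \<le> (\<Sum>k<n. amgm_defect t (ratio k y))" by (intro sum_nonneg) auto
    also have "\<dots> \<le> t * ?L y + energy t n y - 1" using y by (intro sum_defect_le t) auto
    finally show ?case .
  qed
  have li: "integrable (N.marg n) (\<lambda>y. t * ?L y + energy t n y - 1)" using int ei by auto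
  have "(\<Sum>k<n. ?B k) = (\<integral>\<^sup>+y. (\<Sum>k<n. ennreal (amgm_defect t (ratio k y))) \<partial>N.marg n)"
    using meas by (intro nn_integral_sum[symmetric]) auto
  also have "\<dots> \<le> (\<integral>\<^sup>+y. ennreal (t * ?L y + energy t n y - 1) \<partial>N.marg n)"
    using good defect0
  proof (intro nn_integral_mono_AE, eventually_elim)
    fix y assume y: "all_good n y \<and> y \<in> space (Rn n)" "\<forall>k<n. 0 \<le> amgm_defect t (ratio k y)"
    then have "(\<Sum>k<n. ennreal (amgm_defect t (ratio k y))) = ennreal (\<Sum>k<n. amgm_defect t (ratio k y))"
      by (intro sum_ennreal) auto
    also have "\<dots> \<le> ennreal (t * ?L y + energy t n y - 1)"
      using y by (intro ennreal_leI sum_defect_le t) auto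
    finally show "(\<Sum>k<n. ennreal (amgm_defect t (ratio k y))) \<le> ennreal (t * ?L y + energy t n y - 1)" .
  qed
  also have "\<dots> = ennreal (\<integral>y. t * ?L y + energy t n y - 1 \<partial>N.marg n)"
    by (rule nn_integral_eq_integral[OF li nonneg])
  also have "(\<integral>y. t * ?L y + energy t n y - 1 \<partial>N.marg n) = t * D + E - 1"
    using int ei prob_space by (simp add: D_def E_def)
  finally have B: "(\<Sum>k<n. ?B k) \<le> ennreal (t * D + E - 1)" .
  have "(\<Sum>k<n. \<integral>\<^sup>+y. \<integral>\<^sup>+v. ennreal (defect t k y v / t) + ennreal (gap t k y v) \<partial>lborel \<partial>N.marg k)
    = (\<Sum>k<n. ennreal (1 / t) * ?B k + ?J k)"
  proof (intro sum.cong refl)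
    fix k assume "k \<in> {..<n}"
    then have k: "k < n" by simp
    note [measurable] = measurable_fibre_terms[OF k] gap_measurable[OF k]
    have 1: "ennreal (defect t k y v / t) = ennreal (1 / t) * ennreal (defect t k y v)" for y v
      using t by (subst ennreal_mult'[symmetric]) auto
    have 2: "(\<integral>\<^sup>+v. ennreal (defect t k y v / t) + ennreal (gap t k y v) \<partial>lborel)
       = ennreal (1 / t) * (\<integral>\<^sup>+v. ennreal (defect t k y v) \<partial>lborel) + (\<integral>\<^sup>+v. ennreal (gap t k y v) \<partial>lborel)" if "y \<in> space (N.marg k)" for y
    proof -
      have y: "y \<in> space (Rn k)" using that by (simp add: N.space_marg)
      have [measurable]: "(\<lambda>v. defect t k y v) \<in> borel_measurable borel" "(\<lambda>v. gap t k y v) \<in> borel_measurable borel"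
        using measurable_Pair2[OF measurable_fibre_terms(1)[OF k] y] measurable_Pair2[OF gap_measurable[OF k] y] by simp_all
      show ?thesis unfolding 1 by (subst nn_integral_add) (auto simp: nn_integral_cmult)
    qed
    show "(\<integral>\<^sup>+y. \<integral>\<^sup>+v. ennreal (defect t k y v / t) + ennreal (gap t k y v) \<partial>lborel \<partial>N.marg k)
      = ennreal (1 / t) * ?B k + ?J k"
      unfolding nn_integral_defect[OF k]
      by (subst nn_integral_cong[OF 2], assumption, subst nn_integral_add) (auto simp: nn_integral_cmult)
  qed
  also have "\<dots> = ennreal (1 / t) * (\<Sum>k<n. ?B k) + J"
    by (simp add: J_def sum.distrib sum_distrib_left)
  also have "J = ennreal (1 / t) * (ennreal t * J)"
    using t by (simp add: mult.assoc[symmetric] ennreal_mult[symmetric])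
  also have "ennreal (1 / t) * (\<Sum>k<n. ?B k) + ennreal (1 / t) * (ennreal t * J)
     \<le> ennreal (1 / t) * ennreal (t * D + E - 1) + ennreal (1 / t) * ennreal j"
    unfolding j(1) by (intro add_mono mult_left_mono B) auto
  also have "\<dots> \<le> ennreal D"
  proof (cases "0 \<le> t * D + E - 1")
    case True
    have "ennreal (1 / t) * ennreal (t * D + E - 1) + ennreal (1 / t) * ennreal j = ennreal (1 / t * (t * D + E - 1) + 1 / t * j)"
      using True t j by (simp add: ennreal_mult[symmetric] ennreal_plus[symmetric] del: ennreal_plus)
    also have "\<dots> \<le> ennreal D"
    proof (rule ennreal_leI)
      have "1 / t * (t * D + E - 1) + 1 / t * j = D + (E + j - 1) / t" using t by (simp add: field_simps)
      also have "\<dots> \<le> D" using Ej t by (simp add: divide_nonpos_pos)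
      finally show "1 / t * (t * D + E - 1) + 1 / t * j \<le> D" .
    qed
    finally show ?thesis .
  next
    case False
    have "0 \<le> (\<integral>y. t * ?L y + energy t n y - 1 \<partial>N.marg n)"
      by (rule integral_nonneg_AE[OF nonneg])
    also have "\<dots> = t * D + E - 1" using int ei prob_space by (simp add: D_def E_def)
    finally show ?thesis using False by simp
  qed
  finally show ?thesis by (simp add: D_def)
qed

end

section \<open>Letting the interpolation parameter tend to zero\<close>

lemma sum_liminf_le:
  fixes X :: "nat \<Rightarrow> nat \<Rightarrow> ennreal"
  shows "(\<Sum>k<n. liminf (\<lambda>m. X m k)) \<le> liminf (\<lambda>m. \<Sum>k<n. X m k)"
  using nn_integral_liminf[of X "count_space {..<n}"]
  by (simp add: nn_integral_count_space_finite)

context knothe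
begin

lemma initial_T: "j \<le> k \<Longrightarrow> initial j (T k y) = T j y"
proof (induction k rule: dec_induct)
  case base
  show ?case by (rule initial_self[OF T_in_space])
next
  case (step k)
  then show ?case by (simp only: T.simps initial_append)
qed

text \<open>Points with positive density of both laws exist on either side, and the fibres of \<open>M (Suc k)\<close> are unimodal.\<close>

lemma M_pos_interior:
  assumes k: "k < n" and y: "y \<in> space (Rn k)" "0 < N k y"
    and v: "0 < cdf_of (N.cond k y) v" "cdf_of (N.cond k y) v < 1"
  shows "0 < M (Suc k) (y(Suc k := v))"
proof -
  interpret q: bounded_density "N.cond k y" R by (rule N.cond_density[OF k y])
  obtain u where u: "u \<le> v" "0 < N.cond k y u" using q.exists_pos_left v by (auto simp: q.cdf_of_eq)
  obtain w where w: "v \<le> w" "0 < N.cond k y w" using q.exists_pos_right v by (auto simp: q.cdf_of_eq)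
  have "0 < M (Suc k) (y(Suc k := x))" if "0 < N.cond k y x" for x
    using that k y by (intro dominated append_in_space) (auto simp: N.cond_def zero_less_divide_iff)
  then have "0 < min (M (Suc k) (y(Suc k := u))) (M (Suc k) (y(Suc k := w)))" using u w by simp
  also have "\<dots> \<le> M (Suc k) (y(Suc k := v))"
    using M_log_concave[of "Suc k"] k y by (intro log_concave_fibre_quasi_concave u w M.N_nonneg) auto
  finally show ?thesis .
qed

lemma weight_limit:
  "all_good k y \<Longrightarrow> (\<lambda>m. weight (1 / (real m + 2)) k y) \<longlonglongrightarrow> 1 / M k (T k y)"
proof (induction k)
  case 0
  then show ?case using M.N_0[OF T_in_space, of y] by simp
next
  case (Suc k)
  then have g: "all_good k y" by (auto simp: all_good_def)
  define p where "p = M.cond k (T k y) (T (Suc k) y (Suc k))"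
  define q where "q = N.cond k (initial k y) (y (Suc k))"
  have pq: "0 < p" "0 < q" using cond_pos[OF Suc.prems] by (auto simp: p_def q_def)
  have t: "(\<lambda>m. 1 / (real m + 2)) \<longlonglongrightarrow> 0" by real_asymp
  have "(\<lambda>m. weight (1 / (real m + 2)) k y * ((1 - 1 / (real m + 2)) / p + 1 / (real m + 2) / q))
      \<longlonglongrightarrow> 1 / M k (T k y) * ((1 - 0) / p + 0 / q)"
    using pq by (intro tendsto_intros t Suc.IH[OF g]) auto
  moreover have "1 / M k (T k y) * ((1 - 0) / p + 0 / q) = 1 / M (Suc k) (T (Suc k) y)"
    unfolding cond_pos(3)[OF Suc.prems] p_def[symmetric] by simp
  ultimately show ?case by (simp only: weight.simps p_def q_def)
qed

text \<open>If \<open>N.cond k y v > 0\<close> the defect has the right first order term. Otherwise log-concavity along the segment from \<open>T\<close> to the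
identity bounds the gap below by a quantity continuous at \<open>t = 0\<close>; for this \<open>M (Suc k)\<close> has to be positive at
both ends of the segment, which is \<open>M_pos_interior\<close>.\<close>

lemma fibre_entropy_le_liminf:
  assumes k: "k < n" and y: "all_good k y" "y \<in> space (Rn k)"
  defines "t \<equiv> \<lambda>m. 1 / (real m + 2)"
  shows "ennreal (fibre_entropy k y v) \<le> liminf (\<lambda>m. ennreal (defect (t m) k y v / t m) + ennreal (gap (t m) k y v))"
proof (cases "0 < cdf_of (N.cond k y) v \<and> cdf_of (N.cond k y) v < 1")
  case False
  then show ?thesis by (simp only: fibre_entropy_def if_False) simp
next
  case vI: True
  have t01: "0 < t m" "t m < 1" for m by (auto simp: t_def)
  have tlim: "t \<longlonglongrightarrow> 0" unfolding t_def by real_asymp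
  have "good k (initial k y)" using y by (auto simp: all_good_def)
  then have good: "good k y" by (simp only: initial_self[OF y(2)])
  interpret monotone_transport "M.cond k (T k y)" "N.cond k y" R by (rule fibre_transport[OF k good])
  have S: "S = fibre_map k y" by (rule fibre_S[OF k good])
  have "v \<in> I" using vI by (simp add: I_def q.cdf_of_eq)
  define P where "P = M.cond k (T k y) (fibre_map k y v)"
  have P: "0 < P" using p_S_pos[OF \<open>v \<in> I\<close>] by (simp add: P_def S)
  have fe: "fibre_entropy k y v = entropy_gap P (N.cond k y v)" using vI by (simp add: fibre_entropy_def P_def)
  have "\<exists>g. g \<longlonglongrightarrow> fibre_entropy k y v \<and> (\<forall>m. ennreal (g m) \<le> ennreal (defect (t m) k y v / t m) + ennreal (gap (t m) k y v))"
  proof (cases "N.cond k y v = 0")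
    case False
    then have q: "0 < N.cond k y v" using q.p_nonneg[of v] by simp
    have "(\<lambda>m. N.cond k y v * (amgm_defect (t m) (P / N.cond k y v) / t m)) \<longlonglongrightarrow> N.cond k y v * (P / N.cond k y v - 1 - ln (P / N.cond k y v))"
      unfolding t_def using P q by (intro tendsto_mult_left amgm_defect_limit) auto
    moreover have "N.cond k y v * (P / N.cond k y v - 1 - ln (P / N.cond k y v)) = fibre_entropy k y v"
      using q by (simp add: fe entropy_gap_def algebra_simps)
    ultimately show ?thesis
      by (intro exI[of _ "\<lambda>m. defect (t m) k y v / t m"]) (auto simp: defect_def P_def)
  next
    case True
    define y' where "y' = y(Suc k := v)"
    define a where "a = M (Suc k) (T (Suc k) y')"
    define c where "c = M (Suc k) y'"
    have T': "T (Suc k) y' = (T k y)(Suc k := fibre_map k y v)" unfolding y'_def by (rule T_Suc_append[OF y(2)])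
    have Mk: "0 < M k (T k y)" using good by (simp add: good_def)
    have aP: "a = P * M k (T k y)" using Mk unfolding a_def T' P_def M.cond_def by simp
    have a: "0 < a" unfolding aP using P Mk by simp
    have c: "0 < c" unfolding c_def y'_def using good vI by (intro M_pos_interior[OF k]) (auto simp: good_def)
    have ys: "y' \<in> space (Rn (Suc k))" unfolding y'_def by (rule append_in_space[OF y(2)])
    let ?g = "\<lambda>m. weight (t m) k y * (a powr (1 - t m) * c powr t m)"
    have "(\<lambda>m. weight (t m) k y) \<longlonglongrightarrow> 1 / M k (T k y)"
      unfolding t_def by (rule weight_limit[OF y(1)])
    then have "?g \<longlonglongrightarrow> 1 / M k (T k y) * (a powr (1 - 0) * c powr 0)"
      using a c by (intro tendsto_intros tlim) auto
    moreover have "1 / M k (T k y) * (a powr (1 - 0) * c powr 0) = fibre_entropy k y v"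
      using a c Mk P True by (simp add: fe entropy_gap_def aP)
    moreover have gle: "?g m \<le> gap (t m) k y v" for m
    proof -
      have le: "a powr (1 - t m) * c powr t m \<le> M (Suc k) (segment_point (Suc k) (t m) (T (Suc k) y') y')"
        unfolding a_def c_def using k by (intro log_concaveD M_log_concave T_in_space ys t01) auto
      have seg: "segment_point (Suc k) (t m) (T (Suc k) y') y' = (segment_point k (t m) (T k y) y)(Suc k := (1 - t m) * fibre_map k y v + t m * v)"
        unfolding T' by (simp only: y'_def segment_point_append)
      have gp: "gap (t m) k y v = weight (t m) k y * M (Suc k) (segment_point (Suc k) (t m) (T (Suc k) y') y')"
        unfolding seg using vI True by (simp add: gap_def)
      show ?thesis
        unfolding gp by (intro mult_left_mono le weight_nonneg) (use t01[of m] in auto)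
    qed
    have "ennreal (?g m) \<le> ennreal (defect (t m) k y v / t m) + ennreal (gap (t m) k y v)" for m
      by (rule order_trans[OF ennreal_leI[OF gle]]) simp
    ultimately show ?thesis by (intro exI[of _ ?g]) auto
  qed
  then obtain g where g: "g \<longlonglongrightarrow> fibre_entropy k y v"
    "\<And>m. ennreal (g m) \<le> ennreal (defect (t m) k y v / t m) + ennreal (gap (t m) k y v)" by blast
  have "ennreal (fibre_entropy k y v) = liminf (\<lambda>m. ennreal (g m))"
    using tendsto_ennrealI[OF g(1)] by (intro lim_imp_Liminf[symmetric]) auto
  also have "\<dots> \<le> liminf (\<lambda>m. ennreal (defect (t m) k y v / t m) + ennreal (gap (t m) k y v))"
    by (intro Liminf_mono always_eventually allI g(2))
  finally show ?thesis .
qed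

lemma entropy_lower_bound:
  assumes int: "integrable (N.marg n) (\<lambda>y. ln (N n y / M n y))"
  shows "(\<Sum>k<n. \<integral>\<^sup>+y. \<integral>\<^sup>+v. ennreal (fibre_entropy k y v) \<partial>lborel \<partial>N.marg k)
    \<le> ennreal (\<integral>y. ln (N n y / M n y) \<partial>N.marg n)"
proof -
  \<comment> \<open>Any sequence in the open unit interval tending to zero would do.\<close>
  define t where "t m = 1 / (real m + 2)" for m
  have t01: "0 < t m" "t m < 1" for m by (auto simp: t_def)
  define h where "h m k y v = ennreal (defect (t m) k y v / t m) + ennreal (gap (t m) k y v)" for m k y v
  let ?F = "\<lambda>k. \<integral>\<^sup>+y. \<integral>\<^sup>+v. ennreal (fibre_entropy k y v) \<partial>lborel \<partial>N.marg k" and ?H = "\<lambda>m k. \<integral>\<^sup>+y. \<integral>\<^sup>+v. h m k y v \<partial>lborel \<partial>N.marg k"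
  have "(\<Sum>k<n. ?F k)
    \<le> (\<Sum>k<n. liminf (\<lambda>m. ?H m k))"
  proof (rule sum_mono)
    fix k assume "k \<in> {..<n}"
    then have k: "k < n" by simp
    note [measurable] = measurable_fibre_terms[OF k] gap_measurable[OF k]
    have hm[measurable]: "(\<lambda>(y, v). h m k y v) \<in> borel_measurable (Rn k \<Otimes>\<^sub>M borel)" for m
      unfolding h_def by measurable
    have "?F k
      \<le> (\<integral>\<^sup>+y. liminf (\<lambda>m. \<integral>\<^sup>+v. h m k y v \<partial>lborel) \<partial>N.marg k)"
      using AE_all_good[OF less_imp_le[OF k]] AE_space
    proof (intro nn_integral_mono_AE, eventually_elim)
      fix y assume y: "all_good k y" "y \<in> space (N.marg k)"
      then have ys: "y \<in> space (Rn k)" by (simp add: N.space_marg)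
      have "(\<integral>\<^sup>+v. ennreal (fibre_entropy k y v) \<partial>lborel) \<le> (\<integral>\<^sup>+v. liminf (\<lambda>m. h m k y v) \<partial>lborel)"
        unfolding h_def t_def by (intro nn_integral_mono fibre_entropy_le_liminf k y ys)
      also have "\<dots> \<le> liminf (\<lambda>m. \<integral>\<^sup>+v. h m k y v \<partial>lborel)"
      proof (rule nn_integral_liminf)
        show "(\<lambda>v. h m k y v) \<in> borel_measurable lborel" for m
          using measurable_Pair2[OF hm ys] by simp
      qed
      finally show "(\<integral>\<^sup>+v. ennreal (fibre_entropy k y v) \<partial>lborel) \<le> liminf (\<lambda>m. \<integral>\<^sup>+v. h m k y v \<partial>lborel)" .
    qed
    also have "\<dots> \<le> liminf (\<lambda>m. ?H m k)"
      by (rule nn_integral_liminf) measurable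
    finally show "?F k
      \<le> liminf (\<lambda>m. ?H m k)" .
  qed
  also have "\<dots> \<le> liminf (\<lambda>m. \<Sum>k<n. ?H m k)"
    by (rule sum_liminf_le)
  also have "\<dots> \<le> liminf (\<lambda>m. ennreal (\<integral>y. ln (N n y / M n y) \<partial>N.marg n))"
    unfolding h_def by (intro Liminf_mono always_eventually allI entropy_lower_bound_interpolated t01 int)
  finally show ?thesis by (simp add: Liminf_const)
qed

text \<open>The squared difference of the \<open>Suc k\<close>-th coordinates of the two recentered vectors under the coupling by \<open>T\<close>.\<close>

definition cost :: "nat \<Rightarrow> (nat \<Rightarrow> real) \<Rightarrow> real" where
  "cost k y = ((y (Suc k) - N.cond_mean k (initial k y)) - (T (Suc k) y (Suc k) - M.cond_mean k (T k y)))\<^sup>2"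

lemma cost_initial: "cost k (initial (Suc k) y) = cost k y"
proof -
  have "initial (Suc k) y (Suc k) = y (Suc k)" by (simp add: initial_def)
  moreover have "T (Suc k) (initial (Suc k) y) = T (Suc k) y" "T k (initial (Suc k) y) = T k y" by (rule T_initial, simp)+
  ultimately show ?thesis unfolding cost_def by (simp only: initial_initial le_SucI order_refl)
qed

lemma cost_measurable: assumes k: "k < n" shows "cost k \<in> borel_measurable (Rn (Suc k))"
proof -
  note [measurable] = N.cond_mean_measurable[OF k] M.cond_mean_measurable[OF k]
  have pk[measurable]: "initial k \<in> measurable (Rn (Suc k)) (Rn k)" by simp
  note [measurable] = measurable_last_coordinate[of k] T_measurable_Suc[OF k]
  show ?thesis unfolding cost_def by measurable
qed

text \<open>Given the first \<open>k\<close> coordinates, the cost is the squared deviation of the displacement \<open>v - S v\<close> from its mean, as \<open>S\<close>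
carries one conditional law to the other; its mean is the variance bounded by \<open>variance_displacement\<close>.\<close>

lemma cost_le_fibre_entropy:
  assumes k: "k < n"
  shows "(\<integral>\<^sup>+y. ennreal (cost k y) \<partial>N.marg n)
    \<le> ennreal (16 * R\<^sup>2) * (\<integral>\<^sup>+y. \<integral>\<^sup>+v. ennreal (fibre_entropy k y v) \<partial>lborel \<partial>N.marg k)"
proof -
  note [measurable] = cost_measurable[OF k] measurable_fibre_terms[OF k]
  have "(\<integral>\<^sup>+y. ennreal (cost k y) \<partial>N.marg n) = (\<integral>\<^sup>+y. ennreal (cost k (initial (Suc k) y)) \<partial>N.marg n)"
    by (simp only: cost_initial)
  also have "\<dots> = (\<integral>\<^sup>+y. ennreal (cost k y) \<partial>N.marg (Suc k))"
    using k by (intro N.nn_integral_marg_initial) auto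
  also have "\<dots> = (\<integral>\<^sup>+y. \<integral>\<^sup>+v. ennreal (N.cond k y v) * ennreal (cost k (y(Suc k := v))) \<partial>lborel \<partial>N.marg k)"
    by (rule N.nn_integral_marg_Suc[OF k]) measurable
  also have "\<dots> \<le> (\<integral>\<^sup>+y. ennreal (16 * R\<^sup>2) * (\<integral>\<^sup>+v. ennreal (fibre_entropy k y v) \<partial>lborel) \<partial>N.marg k)"
    using AE_good[OF less_imp_le[OF k]]
  proof (intro nn_integral_mono_AE, eventually_elim)
    fix y assume good: "good k y"
    interpret monotone_transport "M.cond k (T k y)" "N.cond k y" R by (rule fibre_transport[OF k good])
    have S: "S = fibre_map k y" by (rule fibre_S[OF k good])
    have ys: "y \<in> space (Rn k)" using good by (simp add: good_def)
    define f where "f v = v - S v" for v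
    have [measurable]: "f \<in> borel_measurable borel" unfolding f_def by measurable
    have i1: "integrable q.law (\<lambda>v. v)"
      by (rule q.law.integrable_const_bound[of _ R]) (use q.AE_law_range in \<open>eventually_elim, auto\<close>)
    have "\<bar>S v\<bar> \<le> R" for v using S_range[of v] by auto
    then have i2: "integrable q.law S"
      by (intro q.law.integrable_const_bound[of _ R]) auto
    have m1: "(\<integral>v. v \<partial>q.law) = N.cond_mean k y"
      unfolding N.cond_mean_def by (rule q.integral_law) auto
    have "(\<integral>v. S v \<partial>q.law) = (\<integral>x. x \<partial>p.law)"
      unfolding push[symmetric] by (rule integral_distr[symmetric]) auto
    also have "\<dots> = M.cond_mean k (T k y)"
      unfolding M.cond_mean_def by (rule p.integral_law) auto
    finally have m2: "(\<integral>v. S v \<partial>q.law) = M.cond_mean k (T k y)" .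
    have mean: "(\<integral>v. f v \<partial>q.law) = N.cond_mean k y - M.cond_mean k (T k y)"
      unfolding f_def m1[symmetric] m2[symmetric] by (rule Bochner_Integration.integral_diff[OF i1 i2])
    have c: "cost k (y(Suc k := v)) = (f v - (\<integral>w. f w \<partial>q.law))\<^sup>2" for v
    proof -
      have "cost k (y(Suc k := v)) = ((v - N.cond_mean k y) - (S v - M.cond_mean k (T k y)))\<^sup>2"
        unfolding cost_def S by (simp only: T_Suc_append[OF ys] T_append initial_append order_refl initial_self[OF ys] fun_upd_same)
      then show ?thesis unfolding mean by (simp add: f_def algebra_simps)
    qed
    have "(\<integral>\<^sup>+v. ennreal (N.cond k y v) * ennreal (cost k (y(Suc k := v))) \<partial>lborel) = (\<integral>\<^sup>+v. ennreal ((f v - (\<integral>w. f w \<partial>q.law))\<^sup>2) \<partial>q.law)"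
      unfolding c by (rule q.nn_integral_law[symmetric]) measurable
    also have "\<dots> \<le> ennreal (16 * R\<^sup>2) * (\<integral>\<^sup>+v. indicator I v * ennreal (entropy_gap (M.cond k (T k y) (S v)) (N.cond k y v)) \<partial>lborel)"
      unfolding f_def by (rule variance_displacement)
    also have "(\<integral>\<^sup>+v. indicator I v * ennreal (entropy_gap (M.cond k (T k y) (S v)) (N.cond k y v)) \<partial>lborel) = (\<integral>\<^sup>+v. ennreal (fibre_entropy k y v) \<partial>lborel)"
      by (intro nn_integral_cong) (auto simp: fibre_entropy_def S I_def q.cdf_of_eq indicator_def)
    finally show "(\<integral>\<^sup>+v. ennreal (N.cond k y v) * ennreal (cost k (y(Suc k := v))) \<partial>lborel)
      \<le> ennreal (16 * R\<^sup>2) * (\<integral>\<^sup>+v. ennreal (fibre_entropy k y v) \<partial>lborel)" .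
  qed
  also have "\<dots> = ennreal (16 * R\<^sup>2) * (\<integral>\<^sup>+y. \<integral>\<^sup>+v. ennreal (fibre_entropy k y v) \<partial>lborel \<partial>N.marg k)"
    by (rule nn_integral_cmult) measurable
  finally show ?thesis .
qed

lemma transport_entropy:
  assumes int: "integrable (N.marg n) (\<lambda>y. ln (N n y / M n y))"
  shows "W2_squared n (recentered_law n (M.marg n)) (recentered_law n (N.marg n))
    \<le> ennreal (16 * R\<^sup>2) * ennreal (\<integral>y. ln (N n y / M n y) \<partial>N.marg n)"
proof -
  let ?F = "\<lambda>k. \<integral>\<^sup>+y. \<integral>\<^sup>+v. ennreal (fibre_entropy k y v) \<partial>lborel \<partial>N.marg k"
  interpret prob_space "N.marg n" by (rule N.prob_space_marg) simp
  define rM where "rM = recentered n (M.marg n) (\<lambda>x. x)"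
  define rN where "rN = recentered n (N.marg n) (\<lambda>x. x)"
  have "rM \<in> measurable (M.marg n) (Rn n)" "rN \<in> measurable (N.marg n) (Rn n)"
    unfolding rM_def rN_def by (intro measurable_recentered; simp)+
  then have [measurable]: "rM \<in> measurable (Rn n) (Rn n)" "rN \<in> measurable (Rn n) (Rn n)" by simp_all
  have [measurable]: "T n \<in> measurable (Rn n) (Rn n)" by simp
  define \<pi> where "\<pi> = distr (N.marg n) (Rn n \<Otimes>\<^sub>M Rn n) (\<lambda>y. (rM (T n y), rN y))"
  have "\<pi> \<in> couplings n (recentered_law n (M.marg n)) (recentered_law n (N.marg n))"
    unfolding couplings_def
  proof (intro CollectI conjI)
    show "prob_space \<pi>" unfolding \<pi>_def by (rule prob_space_distr) measurable
    show "sets \<pi> = sets (Rn n \<Otimes>\<^sub>M Rn n)" by (simp add: \<pi>_def)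
    have "distr \<pi> (Rn n) fst = distr (N.marg n) (Rn n) (\<lambda>y. rM (T n y))"
      unfolding \<pi>_def by (subst distr_distr) (auto simp: comp_def)
    also have "\<dots> = distr (distr (N.marg n) (Rn n) (T n)) (Rn n) rM"
      by (subst distr_distr) (auto simp: comp_def)
    finally show "distr \<pi> (Rn n) fst = recentered_law n (M.marg n)"
      unfolding distr_T[OF order_refl] recentered_law_def rM_def .
    show "distr \<pi> (Rn n) snd = recentered_law n (N.marg n)"
      unfolding \<pi>_def recentered_law_def rN_def[symmetric] by (subst distr_distr) (auto simp: comp_def)
  qed
  then have "W2_squared n (recentered_law n (M.marg n)) (recentered_law n (N.marg n))
    \<le> (\<integral>\<^sup>+(x, y). ennreal ((L2_set (\<lambda>i. y i - x i) {1..n})\<^sup>2) \<partial>\<pi>)"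
    unfolding W2_squared_def by (rule INF_lower)
  also have "\<dots> = (\<integral>\<^sup>+(x, y). ennreal (\<Sum>k<n. (y (Suc k) - x (Suc k))\<^sup>2) \<partial>\<pi>)"
    by (intro nn_integral_cong) (auto simp: L2_set_def sum_nonneg sum.atLeast1_atMost_eq)
  also have "\<dots> = (\<integral>\<^sup>+y. ennreal (\<Sum>k<n. (rN y (Suc k) - rM (T n y) (Suc k))\<^sup>2) \<partial>N.marg n)"
  proof -
    have c: "(\<lambda>p. fst p (Suc k)) \<in> borel_measurable (Rn n \<Otimes>\<^sub>M Rn n)" "(\<lambda>p. snd p (Suc k)) \<in> borel_measurable (Rn n \<Otimes>\<^sub>M Rn n)" if "k < n" for k
    proof -
      have i: "Suc k \<in> {1..n}" using that by auto
      show "(\<lambda>p. fst p (Suc k)) \<in> borel_measurable (Rn n \<Otimes>\<^sub>M Rn n)" "(\<lambda>p. snd p (Suc k)) \<in> borel_measurable (Rn n \<Otimes>\<^sub>M Rn n)"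
        by (rule measurable_compose[OF measurable_fst measurable_coordinate[OF i]] measurable_compose[OF measurable_snd measurable_coordinate[OF i]])+
    qed
    have "(\<lambda>p. \<Sum>k<n. (snd p (Suc k) - fst p (Suc k))\<^sup>2) \<in> borel_measurable (Rn n \<Otimes>\<^sub>M Rn n)"
      by (intro borel_measurable_sum borel_measurable_power borel_measurable_diff c) auto
    then show ?thesis unfolding \<pi>_def by (subst nn_integral_distr) (auto simp: split_beta')
  qed
  also have "\<dots> = (\<integral>\<^sup>+y. (\<Sum>k<n. ennreal (cost k y)) \<partial>N.marg n)"
  proof (rule nn_integral_cong_AE)
    have Tm: "T n \<in> measurable (N.marg n) (Rn n)" by simp
    have "AE y in N.marg n. \<forall>k<n. rM (T n y) (Suc k) = T n y (Suc k) - M.cond_mean k (initial k (T n y))"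
    proof (rule AE_distrD[OF Tm])
      show "AE x in distr (N.marg n) (Rn n) (T n). \<forall>k<n. rM x (Suc k) = x (Suc k) - M.cond_mean k (initial k x)"
        unfolding distr_T[OF order_refl] rM_def by (rule M.AE_recentered)
    qed
    with N.AE_recentered show "AE y in N.marg n. ennreal (\<Sum>k<n. (rN y (Suc k) - rM (T n y) (Suc k))\<^sup>2) = (\<Sum>k<n. ennreal (cost k y))"
    proof eventually_elim
      case (elim y)
      note 1 = elim(1)
      note 2 = elim(2)
      have "(rN y (Suc k) - rM (T n y) (Suc k))\<^sup>2 = cost k y" if k: "k < n" for k
      proof -
        have "T n y (Suc k) = initial (Suc k) (T n y) (Suc k)" by (simp add: initial_def)
        also have "\<dots> = T (Suc k) y (Suc k)" using k by (simp only: initial_T Suc_leI)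
        finally have "T n y (Suc k) = T (Suc k) y (Suc k)" .
        moreover have "initial k (T n y) = T k y" using k by (simp only: initial_T less_imp_le)
        ultimately show ?thesis using 1 2 k by (simp only: rN_def cost_def)
      qed
      then have "(\<Sum>k<n. (rN y (Suc k) - rM (T n y) (Suc k))\<^sup>2) = (\<Sum>k<n. cost k y)" by (intro sum.cong) auto
      then show ?case
        by (simp add: sum_ennreal cost_def)
    qed
  qed
  also have "\<dots> = (\<Sum>k<n. \<integral>\<^sup>+y. ennreal (cost k y) \<partial>N.marg n)"
  proof (rule nn_integral_sum)
    fix k assume "k \<in> {..<n}"
    then have k: "k < n" by simp
    note [measurable] = cost_measurable[OF k]
    have [measurable]: "initial (Suc k) \<in> measurable (Rn n) (Rn (Suc k))" using k by simp
    have "(\<lambda>y. ennreal (cost k (initial (Suc k) y))) \<in> borel_measurable (N.marg n)" by measurable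
    then show "(\<lambda>y. ennreal (cost k y)) \<in> borel_measurable (N.marg n)" by (simp only: cost_initial)
  qed
  also have "\<dots> \<le> (\<Sum>k<n. ennreal (16 * R\<^sup>2) * ?F k)"
    by (intro sum_mono cost_le_fibre_entropy) auto
  also have "\<dots> = ennreal (16 * R\<^sup>2) * (\<Sum>k<n. ?F k)"
    by (rule sum_distrib_left[symmetric])
  also have "\<dots> \<le> ennreal (16 * R\<^sup>2) * ennreal (\<integral>y. ln (N n y / M n y) \<partial>N.marg n)"
    by (intro mult_left_mono entropy_lower_bound int) auto
  finally show ?thesis .
qed

end

section \<open>The transport-entropy inequality\<close>

lemma log_concave_exp_neg:
  fixes R :: real
  assumes V: "convex_potential n V"
  defines "f \<equiv> \<lambda>y. if \<forall>i\<in>{1..n}. y i \<in> {-R..R} then enn2real (exp_neg (V y)) else 0"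
  shows "log_concave n f"
  unfolding log_concave_def
proof (intro ballI allI impI)
  fix x y t assume x: "x \<in> space (Rn n)" and y: "y \<in> space (Rn n)" and t: "0 < t" "t < (1::real)"
  define z where "z = segment_point n t x y"
  show "f x powr (1 - t) * f y powr t \<le> f (segment_point n t x y)"
  proof (cases "f x = 0 \<or> f y = 0")
    case True
    then show ?thesis by (auto simp: f_def)
  next
    case False
    then have box: "\<forall>i\<in>{1..n}. x i \<in> {-R..R}" "\<forall>i\<in>{1..n}. y i \<in> {-R..R}"
      and fin: "V x \<noteq> \<infinity>" "V y \<noteq> \<infinity>" by (auto simp: f_def exp_neg_def split: if_splits)
    then obtain a b where ab: "V x = ereal a" "V y = ereal b"
      using V x y unfolding convex_potential_def by (metis ereal_cases)
    have "V z \<le> ereal (1 - t) * V x + ereal t * V y"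
      using V x y t unfolding convex_potential_def z_def segment_point_def by auto
    then have Vz: "V z \<le> ereal ((1 - t) * a + t * b)" by (simp add: ab)
    moreover have "V z \<noteq> -\<infinity>" using V unfolding convex_potential_def z_def by simp
    ultimately obtain c where c: "V z = ereal c" by (cases "V z") auto
    have "z i \<in> {-R..R}" if i: "i \<in> {1..n}" for i
    proof -
      have "(1 - t) * x i + t * y i \<in> {-R..R}"
        using convexD_alt[of "{-R..R}" "x i" "y i" t] box i t by auto
      then show ?thesis using i by (simp add: z_def segment_point_def)
    qed
    then have "f z = exp (- c)" by (simp add: f_def c exp_neg_def)
    moreover have "f x = exp (- a)" "f y = exp (- b)" using box by (simp_all add: f_def ab exp_neg_def)
    moreover have "c \<le> (1 - t) * a + t * b" using Vz by (simp add: c)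
    ultimately show ?thesis
      unfolding z_def[symmetric] by (simp add: exp_powr_real exp_add[symmetric] algebra_simps)
  qed
qed

text \<open>If \<open>marginal n f k y\<close> were \<open>0\<close>, the fibre of \<open>f\<close> over \<open>y\<close> would vanish almost everywhere, and with it the fibre of \<open>g\<close>.\<close>

lemma marginal_pos_mono:
  fixes f g :: "(nat \<Rightarrow> real) \<Rightarrow> real" and R :: real
  assumes f: "f \<in> borel_measurable (Rn n)" "\<And>y. 0 \<le> f y"
    and supp: "\<And>(y::nat \<Rightarrow> real) i. i \<in> {1..n} \<Longrightarrow> y i \<notin> {-R..R} \<Longrightarrow> f y = 0"
    and lc: "log_concave n f"
    and g: "\<And>y. y \<in> space (Rn n) \<Longrightarrow> 0 < g y \<Longrightarrow> 0 < f y"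
    and k: "k \<le> n" and y: "y \<in> space (Rn k)" "0 < marginal n g k y"
  shows "0 < marginal n f k y"
  using k y
proof (induction k arbitrary: y rule: inc_induct)
  case base
  then show ?case using g by (simp add: marginal_self)
next
  case (step k)
  show ?case
  proof (rule ccontr)
    assume "\<not> 0 < marginal n f k y"
    then have z: "marginal n f k y = 0" using marginal_nonneg[where f=f and n=n and k=k and y=y, OF f(2)] by simp
    have [measurable]: "(\<lambda>v. marginal n f (Suc k) (y(Suc k := v))) \<in> borel_measurable borel"
      by (rule measurable_fibre[OF marginal_measurable[OF f(1)]]) (use step in auto)
    have "(\<integral>\<^sup>+v. ennreal (marginal n f (Suc k) (y(Suc k := v))) \<partial>lborel) = 0"
      using marginal_fibre[OF f(1) f(2) supp lc step.hyps(2) step.prems(1)] z by simp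
    then have "AE v in lborel. ennreal (marginal n f (Suc k) (y(Suc k := v))) = 0"
      by (simp add: nn_integral_0_iff_AE)
    then have "(\<integral>\<^sup>+v. ennreal (marginal n g (Suc k) (y(Suc k := v))) \<partial>lborel) = (\<integral>\<^sup>+(v::real). 0 \<partial>lborel)"
    proof (intro nn_integral_cong_AE, eventually_elim)
      fix v assume "ennreal (marginal n f (Suc k) (y(Suc k := v))) = 0"
      then have "marginal n f (Suc k) (y(Suc k := v)) \<le> 0" by (simp only: ennreal_eq_0_iff)
      then have "\<not> 0 < marginal n g (Suc k) (y(Suc k := v))"
        using step.IH[OF append_in_space[OF step.prems(1)], of v] by (auto simp: fun_upd_def)
      then show "ennreal (marginal n g (Suc k) (y(Suc k := v))) = 0" by (simp add: ennreal_neg)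
    qed
    then show False using step.prems(2) unfolding marginal_step[OF step.hyps(2)] by simp
  qed
qed

lemma density_real_RN_deriv:
  assumes "prob_space \<mu>" "prob_space \<nu>" "absolutely_continuous \<mu> \<nu>" "sets \<nu> = sets \<mu>"
  shows "density \<mu> (\<lambda>x. ennreal (enn2real (RN_deriv \<mu> \<nu> x))) = \<nu>"
proof -
  interpret \<mu>: prob_space \<mu> by fact
  interpret \<nu>: prob_space \<nu> by fact
  have "AE x in \<mu>. RN_deriv \<mu> \<nu> x \<noteq> \<infinity>"
    using assms by (intro \<mu>.RN_deriv_finite \<nu>.sigma_finite_measure_axioms)
  then have "density \<mu> (\<lambda>x. ennreal (enn2real (RN_deriv \<mu> \<nu> x))) = density \<mu> (RN_deriv \<mu> \<nu>)"
    by (intro density_cong) (auto elim!: eventually_mono simp: less_top)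
  then show ?thesis using assms by (simp add: \<mu>.density_RN_deriv)
qed

text \<open>With \<open>r = d\<nu>/d\<mu>\<close>, the integrand becomes \<open>- r ln r \<le> 1\<close> after passing from \<open>\<nu>\<close> to \<open>\<mu>\<close>.\<close>

lemma nn_integral_neg_entropy_density_le:
  assumes "prob_space \<mu>" "prob_space \<nu>" "absolutely_continuous \<mu> \<nu>" "sets \<nu> = sets \<mu>"
  shows "(\<integral>\<^sup>+x. ennreal (- entropy_density (exp 1) \<mu> \<nu> x) \<partial>\<nu>) \<le> 1"
proof -
  interpret \<mu>: prob_space \<mu> by fact
  let ?r = "\<lambda>x. enn2real (RN_deriv \<mu> \<nu> x)" and ?e = "entropy_density (exp 1) \<mu> \<nu>"
  have "(\<integral>\<^sup>+x. ennreal (- ?e x) \<partial>\<nu>) = (\<integral>\<^sup>+x. ennreal (- ?e x) \<partial>density \<mu> (\<lambda>x. ennreal (?r x)))"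
    by (simp only: density_real_RN_deriv[OF assms])
  also have "\<dots> = (\<integral>\<^sup>+x. ennreal (?r x) * ennreal (- ?e x) \<partial>\<mu>)"
    by (rule nn_integral_density) measurable
  also have "\<dots> \<le> (\<integral>\<^sup>+x. 1 \<partial>\<mu>)"
  proof (rule nn_integral_mono)
    fix x
    define r where "r = ?r x"
    have r: "0 \<le> r" and e: "?e x = ln r" by (simp_all add: r_def entropy_density_def log_ln)
    have "r * - ln r \<le> 1"
    proof (cases "r = 0")
      case False
      then have "ln (1 / r) \<le> 1 / r - 1" using r by (intro ln_le_minus_one) auto
      then have "- ln r \<le> 1 / r" using False r by (simp add: ln_div)
      then show ?thesis using False r by (simp add: field_simps)
    qed simp
    then show "ennreal (?r x) * ennreal (- ?e x) \<le> 1"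
      using r by (simp add: e r_def[symmetric] ennreal_mult'[symmetric] ennreal_le_1 del: mult_minus_right)
  qed
  also have "\<dots> = 1" using \<mu>.emeasure_space_1 by simp
  finally show ?thesis .
qed

lemma relative_entropy_cases:
  assumes "prob_space \<mu>" "prob_space \<nu>" "sets \<nu> = sets \<mu>"
  obtains "relative_entropy \<nu> \<mu> = \<infinity>"
  | "absolutely_continuous \<mu> \<nu>" "integrable \<nu> (entropy_density (exp 1) \<mu> \<nu>)"
    "relative_entropy \<nu> \<mu> = ereal (\<integral>x. entropy_density (exp 1) \<mu> \<nu> x \<partial>\<nu>)"
    "0 \<le> (\<integral>x. entropy_density (exp 1) \<mu> \<nu> x \<partial>\<nu>)"
proof (cases "absolutely_continuous \<mu> \<nu>")
  case False
  then show ?thesis using that(1) by (simp add: relative_entropy_def)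
next
  case ac: True
  interpret \<mu>: prob_space \<mu> by fact
  interpret \<nu>: prob_space \<nu> by fact
  let ?e = "entropy_density (exp 1) \<mu> \<nu>"
  have neg: "(\<integral>\<^sup>+x. ennreal (- ?e x) \<partial>\<nu>) \<le> 1"
    by (rule nn_integral_neg_entropy_density_le[OF assms(1,2) ac assms(3)])
  have negf: "(\<integral>\<^sup>+x. ennreal (- ?e x) \<partial>\<nu>) \<noteq> \<infinity>" using neg by (auto simp: top_unique)
  have [measurable]: "?e \<in> borel_measurable \<nu>"
    using measurable_entropy_density[of "exp 1" \<mu> \<nu>] unfolding measurable_cong_sets[OF assms(3) refl] .
  show ?thesis
  proof (cases "(\<integral>\<^sup>+x. ennreal (?e x) \<partial>\<nu>) = \<infinity>")
    case True
    obtain b where "(\<integral>\<^sup>+x. ennreal (- ?e x) \<partial>\<nu>) = ennreal b" "0 \<le> b"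
      using negf by (cases "\<integral>\<^sup>+x. ennreal (- ?e x) \<partial>\<nu>") auto
    then have "relative_entropy \<nu> \<mu> = \<infinity>"
      using True ac by (simp add: relative_entropy_def enn2ereal_ennreal)
    then show ?thesis by (rule that(1))
  next
    case False
    then have int: "integrable \<nu> ?e" using negf by (simp add: real_integrable_def)
    interpret information_space \<mu> "exp 1" by unfold_locales simp
    define r where "r x = enn2real (RN_deriv \<mu> \<nu> x)" for x
    have [measurable]: "r \<in> borel_measurable \<mu>" unfolding r_def by measurable
    have Dr: "density \<mu> (\<lambda>x. ennreal (r x)) = \<nu>"
      unfolding r_def by (rule density_real_RN_deriv[OF assms(1,2) ac assms(3)])
    have "0 \<le> KL_divergence (exp 1) \<mu> (density \<mu> (\<lambda>x. ennreal (r x)))"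
    proof (rule KL_nonneg)
      show "prob_space (density \<mu> (\<lambda>x. ennreal (r x)))" unfolding Dr by fact
      have "integrable (density \<mu> (\<lambda>x. ennreal (r x))) ?e" unfolding Dr by (rule int)
      then have "integrable \<mu> (\<lambda>x. r x *\<^sub>R ?e x)"
        by (subst (asm) integrable_density) (auto simp: r_def)
      then show "integrable \<mu> (\<lambda>x. r x * log (exp 1) (r x))" by (simp add: r_def entropy_density_def)
    qed (auto simp: r_def)
    then have "0 \<le> (\<integral>x. ?e x \<partial>\<nu>)" unfolding Dr by (simp add: KL_divergence_def)
    then show ?thesis
      using that(2) ac int relative_entropy_eq_KL_divergence[OF ac int] by (simp add: KL_divergence_def)
  qed
qed

text \<open>The density of \<open>\<mu>\<close> is set to \<open>0\<close> outside the cube, which changes it on a null set and keeps it log-concave as the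
cube is convex; the density of \<open>\<nu>\<close> is this one multiplied by \<open>d\<nu>/d\<mu>\<close>, so that it vanishes wherever the
density of \<open>\<mu>\<close> does.\<close>

lemma recentered_transport_entropy:
  assumes R: "0 < R" and \<mu>: "\<mu> \<in> prob_measures n" and \<nu>: "\<nu> \<in> prob_measures n"
    and lc: "log_concave_vector n \<mu> (\<lambda>x. x)"
    and box: "AE x in \<mu>. \<forall>i\<in>{1..n}. x i \<in> {-R..R}"
  shows "enn2ereal (W2_squared n (recentered_law n \<mu>) (recentered_law n \<nu>))
    \<le> ereal (16 * R\<^sup>2) * relative_entropy \<nu> \<mu>"
proof -
  have \<mu>p: "prob_space \<mu>" and \<mu>s[measurable_cong]: "sets \<mu> = sets (Rn n)" using \<mu> by (auto simp: prob_measures_def)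
  have \<nu>p: "prob_space \<nu>" and \<nu>s[measurable_cong]: "sets \<nu> = sets (Rn n)" using \<nu> by (auto simp: prob_measures_def)
  have s: "sets \<nu> = sets \<mu>" using \<mu>s \<nu>s by simp
  interpret \<mu>: prob_space \<mu> by fact
  interpret \<nu>: prob_space \<nu> by fact
  from \<mu>p \<nu>p s show ?thesis
  proof (cases rule: relative_entropy_cases)
    case 1
    then show ?thesis using R by simp
  next
    case 2
    let ?e = "entropy_density (exp 1) \<mu> \<nu>"
    obtain V where V: "convex_potential n V" and d: "distributed \<mu> (lborel_n n) (\<lambda>x. x) (\<lambda>x. exp_neg (V x))"
      using lc by (auto simp: log_concave_vector_def)
    have [measurable]: "(\<lambda>x. exp_neg (V x)) \<in> borel_measurable (Rn n)"
      using distributed_borel_measurable[OF d] by simp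
    have \<mu>0: "\<mu> = density (lborel_n n) (\<lambda>x. exp_neg (V x))"
      using distributed_distr_eq_density[OF d] distr_id2[of "lborel_n n" \<mu>] \<mu>s by simp
    define f where "f = (\<lambda>y. if \<forall>i\<in>{1..n}. y i \<in> {-R..R} then enn2real (exp_neg (V y)) else 0)"
    have [measurable]: "Measurable.pred (Rn n) (\<lambda>y. \<forall>i\<in>{1..n}. y i \<in> {-R..R})"
      unfolding Rn_def by measurable
    have fm[measurable]: "f \<in> borel_measurable (Rn n)" unfolding f_def by measurable
    have f0: "0 \<le> f y" for y by (simp add: f_def)
    have fs: "f y = 0" if "i \<in> {1..n}" "y i \<notin> {-R..R}" for y :: "nat \<Rightarrow> real" and i
      using that by (auto simp: f_def)
    have fl: "log_concave n f" unfolding f_def by (rule log_concave_exp_neg[OF V])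
    have \<mu>f: "\<mu> = density (lborel_n n) (\<lambda>y. ennreal (f y))"
      unfolding \<mu>0
    proof (rule density_cong)
      have "AE x in lborel_n n. 0 < exp_neg (V x) \<longrightarrow> (\<forall>i\<in>{1..n}. x i \<in> {-R..R})"
        using box unfolding \<mu>0 by (subst (asm) AE_density) auto
      then show "AE x in lborel_n n. exp_neg (V x) = ennreal (f x)"
        by eventually_elim (auto simp: f_def exp_neg_def)
    qed measurable
    define r where "r y = enn2real (RN_deriv \<mu> \<nu> y)" for y
    have "r \<in> borel_measurable \<mu>" unfolding r_def by measurable
    then have [measurable]: "r \<in> borel_measurable (Rn n)" unfolding measurable_cong_sets[OF \<mu>s refl] .
    define g where "g y = f y * r y" for y
    have gm[measurable]: "g \<in> borel_measurable (Rn n)" unfolding g_def by measurable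
    have g0: "0 \<le> g y" for y by (simp add: g_def r_def f0)
    have gs: "g y = 0" if "i \<in> {1..n}" "y i \<notin> {-R..R}" for y :: "nat \<Rightarrow> real" and i
      using fs[of i y] that by (simp add: g_def)
    have "\<nu> = density \<mu> (\<lambda>x. ennreal (r x))"
      unfolding r_def by (rule density_real_RN_deriv[OF \<mu>p \<nu>p 2(1) s, symmetric])
    also have "\<dots> = density (lborel_n n) (\<lambda>y. ennreal (f y) * ennreal (r y))"
      unfolding \<mu>f by (subst density_density_eq) auto
    also have "\<dots> = density (lborel_n n) (\<lambda>y. ennreal (g y))"
      by (simp add: g_def ennreal_mult' f0)
    finally have \<nu>g: "\<nu> = density (lborel_n n) (\<lambda>y. ennreal (g y))" .
    have tot: "(\<integral>\<^sup>+y. ennreal (f y) \<partial>lborel_n n) = 1" "(\<integral>\<^sup>+y. ennreal (g y) \<partial>lborel_n n) = 1"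
    proof -
      have "emeasure \<mu> (space \<mu>) = (\<integral>\<^sup>+y. ennreal (f y) \<partial>lborel_n n)"
        unfolding \<mu>f by (subst emeasure_density) (auto intro!: nn_integral_cong simp: space_lborel_n)
      then show "(\<integral>\<^sup>+y. ennreal (f y) \<partial>lborel_n n) = 1" using \<mu>.emeasure_space_1 by simp
      have "emeasure \<nu> (space \<nu>) = (\<integral>\<^sup>+y. ennreal (g y) \<partial>lborel_n n)"
        unfolding \<nu>g by (subst emeasure_density) (auto intro!: nn_integral_cong simp: space_lborel_n)
      then show "(\<integral>\<^sup>+y. ennreal (g y) \<partial>lborel_n n) = 1" using \<nu>.emeasure_space_1 by simp
    qed
    interpret M: density_chain "marginal n f" n R by (rule density_chain_marginal[OF fm f0 fs tot(1)])
    interpret N: density_chain "marginal n g" n R by (rule density_chain_marginal[OF gm g0 gs tot(2)])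
    have gf: "0 < f y" if "0 < g y" for y
      using that f0[of y] by (cases "f y = 0") (auto simp: g_def)
    interpret knothe "marginal n f" "marginal n g" n R
    proof
      show "log_concave k (marginal n f k)" if "k \<le> n" for k
        by (rule log_concave_marginal[OF fm f0 fs fl that])
      show "(\<integral>\<^sup>+v. ennreal (marginal n f (Suc k) (x(Suc k := v))) \<partial>lborel) = ennreal (marginal n f k x)"
        if "k < n" "x \<in> space (Rn k)" for k x
        by (rule marginal_fibre[OF fm f0 fs fl that])
      show "0 < marginal n f k y" if "k \<le> n" "y \<in> space (Rn k)" "0 < marginal n g k y" for k y
        by (rule marginal_pos_mono[OF fm f0 fs fl gf that])
    qed
    have mM: "M.marg n = \<mu>" by (simp add: M.marg_def marginal_self \<mu>f)
    have mN: "N.marg n = \<nu>" by (simp add: N.marg_def marginal_self \<nu>g)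
    have L: "AE y in \<nu>. ln (marginal n g n y / marginal n f n y) = ?e y"
    proof -
      have "AE y in N.marg n. 0 < marginal n g n y" by (rule N.AE_N_pos) simp
      then show ?thesis unfolding mN marginal_self
        by eventually_elim (auto simp: g_def r_def entropy_density_def log_ln)
    qed
    have [measurable]: "?e \<in> borel_measurable \<nu>"
      using measurable_entropy_density[of "exp 1" \<mu> \<nu>] unfolding measurable_cong_sets[OF s refl] .
    have Lm: "(\<lambda>y. ln (marginal n g n y / marginal n f n y)) \<in> borel_measurable \<nu>"
      unfolding marginal_self by measurable
    have int: "integrable (N.marg n) (\<lambda>y. ln (marginal n g n y / marginal n f n y))"
      unfolding mN using 2(2) integrable_cong_AE[OF Lm _ L] by simp
    have eq: "(\<integral>y. ln (marginal n g n y / marginal n f n y) \<partial>\<nu>) = (\<integral>y. ?e y \<partial>\<nu>)"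
      by (rule integral_cong_AE[OF Lm _ L]) simp
    have "W2_squared n (recentered_law n \<mu>) (recentered_law n \<nu>) \<le> ennreal (16 * R\<^sup>2) * ennreal (\<integral>y. ?e y \<partial>\<nu>)"
      using transport_entropy[OF int] unfolding mM mN eq .
    also have "\<dots> = ennreal (16 * R\<^sup>2 * (\<integral>y. ?e y \<partial>\<nu>))"
      using 2(4) by (simp add: ennreal_mult)
    finally have "enn2ereal (W2_squared n (recentered_law n \<mu>) (recentered_law n \<nu>)) \<le> enn2ereal (ennreal (16 * R\<^sup>2 * (\<integral>y. ?e y \<partial>\<nu>)))"
      by (simp add: less_eq_ennreal.rep_eq)
    also have "\<dots> = ereal (16 * R\<^sup>2) * relative_entropy \<nu> \<mu>"
      using 2(4) unfolding 2(3) by (simp add: enn2ereal_ennreal)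
    finally show ?thesis .
  qed
qed

theorem theorem1p12:
  shows "\<exists>c::real. c > 0 \<and>
    (\<forall>n::nat. n \<ge> 1 \<longrightarrow> (\<forall>R::real. R > 0 \<longrightarrow>
      (\<forall>\<mu>\<in>prob_measures n.
         log_concave_vector n \<mu> (\<lambda>x. x) \<and> (AE x in \<mu>. \<forall>i\<in>{1..n}. x i \<in> {-R..R}) \<longrightarrow>
         (\<forall>\<nu>\<in>prob_measures n.
            enn2ereal (W2_squared n (recentered_law n \<mu>) (recentered_law n \<nu>))
              \<le> ereal (c * R\<^sup>2) * relative_entropy \<nu> \<mu>))))"
  using recentered_transport_entropy by (intro exI[of _ 16]) auto

end
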